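(* Let $\mathcal{Q}$ be a quasilinkage on $[n]$ and let $M(\mathcal{Q})$ be its moduli space (a cell complex). Then: (1) For every vertex $v$ of $M(\mathcal{Q})$ there exists a generic length vector $L_v$ such that the star of $v$ in $M(\mathcal{Q})$ is combinatorially isomorphic to the star of some vertex of the cell complex $CWM^*(L_v)$. (2) For every cell $\sigma$ of $M(\mathcal{Q})$ there exists a generic length vector $L_\sigma$ such that the star of $\sigma$ in $M(\mathcal{Q})$ is combinatorially isomorphic to the star of some vertex of the cell complex $CWM^*(L_\sigma)$. (The number of entries of $L_\sigma$ is allowed to differ from $n$.) (3) The complex $M(\mathcal{Q})$ is a combinatorial manifold.
   Context: Notation: $[n]=\{1,\dots,n\}$. A quasilinkage on $[n]$ is a family $\mathcal{Q}$ of subsets of $[n]$ such that: (i) $\{i\}\in\mathcal{Q}$ for all $i\in[n]$; (ii) if $S\in\mathcal{Q}$ and $T\subset S$ then $T\in\mathcal{Q}$; (iii) for every $S\subset[n]$, exactly one of $S$ and $[n]\setminus S$ belongs to $\mathcal{Q}$. Elements of $\mathcal{Q}$ are called ($\mathcal{Q}$-)short sets, and other subsets of $[n]$ are called long. Cell complex of a family: A cyclically ordered partition of $[n]$ is a partition into non-empty (unordered) blocks together with a cyclic ordering of the blocks, i.e. an ordered partition $(S_1,\dots,S_k)$ considered up to cyclic rotation. For a family $\mathcal{F}$ of subsets of $[n]$, it is called $\mathcal{F}$-admissible if every $S_i\in\mathcal{F}$. A cyclically ordered partition $\lambda$ is finer than $\lambda'$ (a refinement of $\lambda'$) if $\lambda'$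 is obtained from $\lambda$ by repeatedly merging cyclically consecutive blocks. The cell complex $M(\mathcal{F})$ is the regular cell complex whose $k$-cells are labeled bijectively by the $\mathcal{F}$-admissible cyclically ordered partitions of $[n]$ into $n-k$ non-empty blocks (the label of a cell $C$ is $\lambda(C)$), where a closed cell $C$ belongs to the boundary of another closed cell $C'$ exactly when $\lambda(C)$ is finer than $\lambda(C')$. Each closed cell is combinatorially a product of permutohedra. For a quasilinkage $\mathcal{Q}$, $M(\mathcal{Q})$ is called its moduli space. Real linkages: a length vector is $L=(l_1,\dots,l_m)$ with all $l_i>0$; it is generic if $\sum_{i\in J}l_i\neq\sum_{i\notin J}l_i$ for every $J\subset[m]$. A set $J\subset[m]$ is $L$-short if $\sum_{i\in J}l_i<\sum_{i\notin J}l_i$; $\mathcal{S}(L)$ is the family of $L$-short sets. $CWM^*(L)$ denotes the cell complex $M(\mathcal{S}(L))$, i.e. the regular cell complex whose $k$-cells are labeled bijectively by the cyclically ordered partitions of $[m]$ into $m-k$ non-empty blocks all of which are $L$-short (the label of a cell $C$ is $\lambda(C)$), where a closed cell $C$ belongs to the boundary of another closed cell $C'$ exactly when $\lambda(C)$ is finer than $\lambda(C')$. The star of a cell $\sigma$ is the collection of cells $C$ with $\sigma\subseteq\overline{C}$, partially ordered by incidence; two stars are combinatorially isomorphic if these posets are isomorphic. *)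

theory Defs
  imports Complex_Main "HOL-Library.Disjoint_Sets"
begin

section \<open>Quasilinkages and length vectors\<close>

definition quasilinkage :: "nat \<Rightarrow> nat set set \<Rightarrow> bool" where
  "quasilinkage n Q \<longleftrightarrow>
     Q \<subseteq> Pow {1..n} \<and>
     (\<forall>i\<in>{1..n}. {i} \<in> Q) \<and>
     (\<forall>S\<in>Q. \<forall>T. T \<subseteq> S \<longrightarrow> T \<in> Q) \<and>
     (\<forall>S. S \<subseteq> {1..n} \<longrightarrow> (S \<in> Q) \<noteq> ({1..n} - S \<in> Q))"

text \<open>A length vector with \<open>m\<close> entries is a function on \<open>nat\<close>, of which only the values on
  \<open>{1..m}\<close> matter.\<close>

definition length_vector :: "nat \<Rightarrow> (nat \<Rightarrow> real) \<Rightarrow> bool" where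
  "length_vector m l \<longleftrightarrow> (\<forall>i\<in>{1..m}. 0 < l i)"

definition generic :: "nat \<Rightarrow> (nat \<Rightarrow> real) \<Rightarrow> bool" where
  "generic m l \<longleftrightarrow> (\<forall>J. J \<subseteq> {1..m} \<longrightarrow> (\<Sum>i\<in>J. l i) \<noteq> (\<Sum>i\<in>{1..m} - J. l i))"

definition short_sets :: "nat \<Rightarrow> (nat \<Rightarrow> real) \<Rightarrow> nat set set" where
  "short_sets m l = {J. J \<subseteq> {1..m} \<and> (\<Sum>i\<in>J. l i) < (\<Sum>i\<in>{1..m} - J. l i)}"


section \<open>Cell complexes\<close>

text \<open>A regular cell complex is determined by its face poset and is given here by it:
  \<open>face X C D\<close> means that the closed cell \<open>C\<close> is contained in the closed cell \<open>D\<close>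
  (so \<open>face X\<close> is reflexive).\<close>

record 'c cell_complex =
  cells :: "'c set"
  cell_dim :: "'c \<Rightarrow> nat"
  face :: "'c \<Rightarrow> 'c \<Rightarrow> bool"

definition vertices :: "'c cell_complex \<Rightarrow> 'c set" where
  "vertices X = {C \<in> cells X. cell_dim X C = 0}"

definition star :: "'c cell_complex \<Rightarrow> 'c \<Rightarrow> 'c set" where
  "star X \<sigma> = {C \<in> cells X. face X \<sigma> C}"

definition stars_isomorphic :: "'c cell_complex \<Rightarrow> 'c \<Rightarrow> 'd cell_complex \<Rightarrow> 'd \<Rightarrow> bool" where
  "stars_isomorphic X \<sigma> Y \<tau> \<longleftrightarrow>
     (\<exists>f. bij_betw f (star X \<sigma>) (star Y \<tau>) \<and>
          (\<forall>C\<in>star X \<sigma>. \<forall>D\<in>star X \<sigma>. face X C D \<longleftrightarrow> face Y (f C) (f D)))"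


section \<open>Cyclically ordered partitions and the complex of a family\<close>

definition ordered_partition :: "nat \<Rightarrow> nat set list \<Rightarrow> bool" where
  "ordered_partition n xs \<longleftrightarrow> distinct xs \<and> partition_on {1..n} (set xs)"

text \<open>A cyclically ordered partition is the set of all rotations of an ordered partition.\<close>

definition cyclic_class :: "'a list \<Rightarrow> 'a list set" where
  "cyclic_class xs = {rotate i xs | i. True}"

definition cyclic_partitions :: "nat \<Rightarrow> nat set list set set" where
  "cyclic_partitions n = {cyclic_class xs | xs. ordered_partition n xs}"

definition blocks :: "nat set list set \<Rightarrow> nat set set" where
  "blocks \<pi> = (\<Union>xs\<in>\<pi>. set xs)"

text \<open>Merging two cyclically consecutive blocks: up to rotation, these are the first two.\<close>

definition merge_step :: "nat set list set \<Rightarrow> nat set list set \<Rightarrow> bool" where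
  "merge_step \<pi> \<pi>' \<longleftrightarrow>
     (\<exists>A B xs. \<pi> = cyclic_class (A # B # xs) \<and> \<pi>' = cyclic_class ((A \<union> B) # xs))"

definition finer :: "nat set list set \<Rightarrow> nat set list set \<Rightarrow> bool" where
  "finer = merge_step\<^sup>*\<^sup>*"

definition family_complex :: "nat \<Rightarrow> nat set set \<Rightarrow> nat set list set cell_complex" where
  "family_complex n F =
     \<lparr>cells = {C \<in> cyclic_partitions n. blocks C \<subseteq> F},
      cell_dim = (\<lambda>C. n - card (blocks C)),
      face = finer\<rparr>"

definition CWM :: "nat \<Rightarrow> (nat \<Rightarrow> real) \<Rightarrow> nat set list set cell_complex" where
  "CWM m l = family_complex m (short_sets m l)"


section \<open>Combinatorial manifolds\<close>

text \<open>Abstract simplicial complexes contain the empty simplex; \<open>{{}}\<close> is the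
  \<open>(-1)\<close>-dimensional sphere.\<close>

definition finite_simplicial_complex :: "'v set set \<Rightarrow> bool" where
  "finite_simplicial_complex K \<longleftrightarrow>
     finite K \<and> {} \<in> K \<and> (\<forall>s\<in>K. finite s) \<and> (\<forall>s\<in>K. \<forall>t. t \<subseteq> s \<longrightarrow> t \<in> K)"

definition link :: "'v set set \<Rightarrow> 'v \<Rightarrow> 'v set set" where
  "link K v = {s. v \<notin> s \<and> insert v s \<in> K}"

text \<open>The proper faces of the \<open>d\<close>-simplex, i.e. the standard \<open>(d-1)\<close>-sphere.\<close>

definition simplex_boundary :: "nat \<Rightarrow> nat set set" where
  "simplex_boundary d = {s. s \<subset> {0..d}}"

text \<open>Points of the geometric realization, in barycentric coordinates.\<close>

definition realization :: "'v set set \<Rightarrow> ('v \<Rightarrow> real) set" where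
  "realization K =
     {x. (\<forall>v. 0 \<le> x v) \<and> {v. x v \<noteq> 0} \<in> K \<and> (\<Sum>v | x v \<noteq> 0. x v) = 1}"

definition simplexwise_linear :: "('w \<Rightarrow> 'v \<Rightarrow> real) \<Rightarrow> ('w \<Rightarrow> real) \<Rightarrow> 'v \<Rightarrow> real" where
  "simplexwise_linear p y = (\<lambda>v. \<Sum>w | y w \<noteq> 0. y w * p w v)"

text \<open>\<open>K'\<close>, with its vertices \<open>w\<close> placed at the points \<open>p w\<close> of \<open>|K|\<close>, is a subdivision
  of \<open>K\<close>: every simplex of \<open>K'\<close> lies in a simplex of \<open>K\<close>, and the induced map
  \<open>|K'| \<rightarrow> |K|\<close>, linear on simplices, is bijective (hence a homeomorphism, the complexes
  being finite).\<close>

definition subdivision :: "'w set set \<Rightarrow> ('w \<Rightarrow> 'v \<Rightarrow> real) \<Rightarrow> 'v set set \<Rightarrow> bool" where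
  "subdivision K' p K \<longleftrightarrow>
     finite_simplicial_complex K' \<and>
     (\<forall>w. {w} \<in> K' \<longrightarrow> p w \<in> realization K) \<and>
     (\<forall>s\<in>K'. \<exists>t\<in>K. \<forall>w\<in>s. {v. p w v \<noteq> 0} \<subseteq> t) \<and>
     bij_betw (simplexwise_linear p) (realization K') (realization K)"

text \<open>Finite complexes are PL homeomorphic iff they have isomorphic subdivisions. Up to
  isomorphism the common subdivision is one abstract complex with vertices in \<open>nat\<close>.\<close>

definition PL_homeomorphic :: "'v set set \<Rightarrow> 'u set set \<Rightarrow> bool" where
  "PL_homeomorphic K L \<longleftrightarrow>
     (\<exists>(K' :: nat set set) p q. subdivision K' p K \<and> subdivision K' q L)"

definition combinatorial_manifold_of_dim :: "nat \<Rightarrow> 'v set set \<Rightarrow> bool" where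
  "combinatorial_manifold_of_dim d K \<longleftrightarrow>
     finite_simplicial_complex K \<and>
     (\<forall>v. {v} \<in> K \<longrightarrow> PL_homeomorphic (link K v) (simplex_boundary d))"

text \<open>The barycentric subdivision of a regular cell complex is the order complex of its
  face poset.\<close>

definition barycentric_subdivision :: "'c cell_complex \<Rightarrow> 'c set set" where
  "barycentric_subdivision X =
     {s. finite s \<and> s \<subseteq> cells X \<and> (\<forall>C\<in>s. \<forall>D\<in>s. face X C D \<or> face X D C)}"

definition combinatorial_manifold :: "'c cell_complex \<Rightarrow> bool" where
  "combinatorial_manifold X \<longleftrightarrow>
     (\<exists>d. combinatorial_manifold_of_dim d (barycentric_subdivision X))"

end

theory Submission
  imports Defs "HOL-Library.Function_Algebras"
begin

text \<open>
  The star of a cell with \<open>k\<close> blocks consists of the sets of cuts \<open>J \<subseteq> {..<k}\<close> between its blocks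
  whose parts are all short, ordered by reverse inclusion, so it depends only on which arcs of the
  cycle of blocks are short. Write \<open>i \<rightarrow> j\<close> if the arc from \<open>i\<close> to \<open>j\<close> is short. Every cut \<open>i\<close> has an
  antipodal edge, where the arcs starting at \<open>i\<close> become long, and giving each edge the length one plus
  the number of cuts it is antipodal to realises the short arcs by a length vector. This proves (1)
  and (2).

  For (3), a simplicial complex is a PL sphere as soon as its simplices span the cones of a complete
  fan: two complete fans in the same space have a common simplicial refinement, namely the order
  complex of the sign vectors of all linear forms that cut out their cones, so every complete fan can
  be compared with the one over the boundary of a simplex. The link of a cell in the barycentric
  subdivision is the join of the order complexes of the cells below and above it. Those below are the
  sign vectors of a product of braid arrangements. Those above are the faces of the simplicial
  polytope whose Gale diagram is given by the cut points on a circle realising the arcs; a set of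
  cuts is admissible iff it contains a cyclic triangle of the tournament \<open>\<rightarrow>\<close>, that is, iff the
  centre lies in the interior of the convex hull of its points.
\<close>

text \<open>No length vector need realise all of \<open>Q\<close>. A star sees only whether unions
  of consecutive blocks are short, and for these a length vector with one entry per block always
  exists.

  Both posets around a cell become fans by one greedy principle: a point is split along a chain by
  repeatedly subtracting the largest multiple of a marked point of its cell that stays in the closed
  cell. Cones replace realizations so that normalising factors enter only when a subdivision is
  extracted.

  For the coarsenings, the relevant cones consist of the nonnegative functions on the cuts whose
  zero set is admissible. Modulo affine functions restricted to the cut points, every function has
  exactly one such representative: subtract the affine function supporting its lower hull over the
  centre. The quotient has dimension k - 3. The refinements contribute n - k dimensions, one for
  each element that is not the base point of its block, so the link of every cell is a sphere of
  dimension n - 4.\<close>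

instantiation "fun" :: (type, real_vector) real_vector
begin

text \<open>Coordinates and fan vectors are plain functions; with pointwise scaling,
  \<open>linear\<close>, \<open>span\<close> and \<open>subspace\<close> apply to them.\<close>

definition scaleR_fun_def: "r *\<^sub>R f = (\<lambda>x. r *\<^sub>R f x)"

instance
  by standard (auto simp: scaleR_fun_def fun_eq_iff scaleR_add_right scaleR_add_left)

end

lemma scaleR_fun_apply [simp]: "(r *\<^sub>R f) x = r *\<^sub>R f x"
  by (simp add: scaleR_fun_def)

lemma sum_fun_apply: "(\<Sum>w\<in>S. f w) i = (\<Sum>w\<in>S. f w i)"
  by (induction S rule: infinite_finite_induct) auto

section \<open>Complete fans\<close>

abbreviation supp :: "('w \<Rightarrow> real) \<Rightarrow> 'w set" where
  "supp y \<equiv> {w. y w \<noteq> 0}"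

text \<open>The realization without the condition that the coordinates sum to one.\<close>

definition cone :: "'w set set \<Rightarrow> ('w \<Rightarrow> real) set" where
  "cone K = {y. (\<forall>w. 0 \<le> y w) \<and> supp y \<in> K}"

definition lin :: "('w \<Rightarrow> 'v::real_vector) \<Rightarrow> ('w \<Rightarrow> real) \<Rightarrow> 'v" where
  "lin \<phi> y = (\<Sum>w | y w \<noteq> 0. y w *\<^sub>R \<phi> w)"

text \<open>Bijectivity says at once that the rays of each simplex are independent, that cones meet
  only in common faces, and that they cover \<open>V\<close>.\<close>

definition complete_fan :: "'v::real_vector set \<Rightarrow> 'w set set \<Rightarrow> ('w \<Rightarrow> 'v) \<Rightarrow> bool" where
  "complete_fan V K \<phi> \<longleftrightarrow> finite_simplicial_complex K \<and> bij_betw (lin \<phi>) (cone K) V"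

lemma lin_eq: "finite S \<Longrightarrow> supp y \<subseteq> S \<Longrightarrow> lin \<phi> y = (\<Sum>w\<in>S. y w *\<^sub>R \<phi> w)"
  unfolding lin_def by (rule sum.mono_neutral_left) auto

lemma lin_zero [simp]: "lin \<phi> (\<lambda>w. 0) = 0"
  by (simp add: lin_def)

lemma lin_single: "lin \<phi> (\<lambda>v. if v = w then c else 0) = c *\<^sub>R \<phi> w"
  by (subst lin_eq[of "{w}"]) auto

lemma cone_support_finite: "finite_simplicial_complex K \<Longrightarrow> y \<in> cone K \<Longrightarrow> finite (supp y)"
  by (auto simp: cone_def finite_simplicial_complex_def)

lemma cone_mono: "finite_simplicial_complex K \<Longrightarrow> s \<in> K \<Longrightarrow> supp y \<subseteq> s \<Longrightarrow>
    (\<And>w. 0 \<le> y w) \<Longrightarrow> y \<in> cone K"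
  by (auto simp: cone_def finite_simplicial_complex_def)

section \<open>Order complexes\<close>

definition order_complex :: "'p set \<Rightarrow> ('p \<Rightarrow> 'p \<Rightarrow> bool) \<Rightarrow> 'p set set" where
  "order_complex P le = {s. finite s \<and> s \<subseteq> P \<and> (\<forall>a\<in>s. \<forall>b\<in>s. le a b \<or> le b a)}"

lemma finite_simplicial_complex_order_complex: "finite P \<Longrightarrow> finite_simplicial_complex (order_complex P le)"
  unfolding finite_simplicial_complex_def
proof (intro conjI)
  assume "finite P"
  then show "finite (order_complex P le)"
    by (intro finite_subset[of "order_complex P le" "Pow P"]) (auto simp: order_complex_def)
qed (auto simp: order_complex_def dest: finite_subset)

lemma chain_has_top:
  assumes "finite s" "s \<noteq> {}" "\<forall>a\<in>s. \<forall>b\<in>s. le a b \<or> le b a"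
    and "\<And>a b c. a \<in> s \<Longrightarrow> b \<in> s \<Longrightarrow> c \<in> s \<Longrightarrow> le a b \<Longrightarrow> le b c \<Longrightarrow> le a c"
  shows "\<exists>m\<in>s. \<forall>a\<in>s. le a m"
  using assms
proof (induction s rule: finite_ne_induct)
  case (singleton x)
  show ?case using singleton.prems(1) by simp
next
  case (insert x F)
  have "\<forall>a\<in>F. \<forall>b\<in>F. le a b \<or> le b a" using insert.prems(1) by simp
  moreover have "le a c" if "a \<in> F" "b \<in> F" "c \<in> F" "le a b" "le b c" for a b c
    using insert.prems(2)[of a b c] that by simp
  ultimately have "\<exists>m\<in>F. \<forall>a\<in>F. le a m" by (rule insert.IH)
  then obtain m where m: "m \<in> F" "\<forall>a\<in>F. le a m" by blast
  consider "le x m" | "le m x" using insert.prems(1) m(1) by blast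
  then show ?case
  proof cases
    case 1
    then show ?thesis using m by blast
  next
    case 2
    then have "\<forall>a\<in>F. le a x" using m insert.prems(2)[of _ m x] by blast
    then show ?thesis using insert.prems(1) by blast
  qed
qed

text \<open>\<open>X\<close> is to be thought of as a union of cones, not necessarily a subspace;
  \<open>car x\<close> is the cell with \<open>x\<close> in its relative interior, and
  \<open>b s\<close> marks a point of the cell \<open>s\<close>. By \<open>add\<close>, moving from
  the boundary of a cell towards its marked point enters the interior; by \<open>sub\<close>, moving
  away from it reaches the boundary. This is the barycentric subdivision of a complex of cones,
  stated so that no cell has to be described.\<close>

locale greedy =
  fixes P :: "'p set" and le :: "'p \<Rightarrow> 'p \<Rightarrow> bool" and X :: "'v::real_vector set"
    and car :: "'v \<Rightarrow> 'p" and b :: "'p \<Rightarrow> 'v"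
  assumes fin: "finite P"
    and refl: "\<And>p. p \<in> P \<Longrightarrow> le p p"
    and antisym: "\<And>p q. p \<in> P \<Longrightarrow> q \<in> P \<Longrightarrow> le p q \<Longrightarrow> le q p \<Longrightarrow> p = q"
    and trans: "\<And>p q r. p \<in> P \<Longrightarrow> q \<in> P \<Longrightarrow> r \<in> P \<Longrightarrow> le p q \<Longrightarrow> le q r \<Longrightarrow> le p r"
    and zero: "0 \<in> X"
    and car: "\<And>x. x \<in> X \<Longrightarrow> x \<noteq> 0 \<Longrightarrow> car x \<in> P"
    and add: "\<And>s t y. s \<in> P \<Longrightarrow> t > 0 \<Longrightarrow> y \<in> X \<Longrightarrow> y = 0 \<or> le (car y) s \<and> car y \<noteq> s \<Longrightarrow>
        y + t *\<^sub>R b s \<in> X \<and> y + t *\<^sub>R b s \<noteq> 0 \<and> car (y + t *\<^sub>R b s) = s"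
    and sub: "\<And>x. x \<in> X \<Longrightarrow> x \<noteq> 0 \<Longrightarrow> \<exists>t>0. x - t *\<^sub>R b (car x) \<in> X \<and>
        (x - t *\<^sub>R b (car x) = 0 \<or>
         le (car (x - t *\<^sub>R b (car x))) (car x) \<and> car (x - t *\<^sub>R b (car x)) \<noteq> car x)"
begin

definition below :: "'v \<Rightarrow> 'p \<Rightarrow> bool" where
  "below y s \<longleftrightarrow> y = 0 \<or> le (car y) s \<and> car y \<noteq> s"

lemma supp_top:
  assumes "y \<in> cone (order_complex P le)" "y \<noteq> (\<lambda>w. 0)"
  obtains m where "y m > 0" "\<And>a. y a \<noteq> 0 \<Longrightarrow> le a m"
proof -
  have "supp y \<in> order_complex P le" and ne: "supp y \<noteq> {}" using assms by (auto simp: cone_def)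
  then have "\<exists>m\<in>supp y. \<forall>a\<in>supp y. le a m"
    by (intro chain_has_top) (auto simp: order_complex_def subset_iff intro: trans)
  then show ?thesis using assms(1) that unfolding cone_def by (force simp: less_le)
qed

lemma lin_upd:
  assumes "finite (supp y)"
  shows "lin b y = lin b (y(m := 0)) + y m *\<^sub>R b m"
proof -
  let ?S = "insert m (supp y)"
  have "lin b y = (\<Sum>w\<in>?S. y w *\<^sub>R b w)" using assms by (intro lin_eq) auto
  also have "\<dots> = y m *\<^sub>R b m + (\<Sum>w\<in>?S - {m}. y w *\<^sub>R b w)"
    using assms by (intro sum.remove) auto
  also have "(\<Sum>w\<in>?S - {m}. y w *\<^sub>R b w) = (\<Sum>w\<in>?S - {m}. (y(m := 0)) w *\<^sub>R b w)"
    by (rule sum.cong) auto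
  also have "\<dots> = lin b (y(m := 0))" using assms by (intro lin_eq[symmetric]) auto
  finally show ?thesis by simp
qed

lemma upd_cone: "y \<in> cone (order_complex P le) \<Longrightarrow> y(m := 0) \<in> cone (order_complex P le)"
  by (rule cone_mono[OF finite_simplicial_complex_order_complex[OF fin], of "supp y"])
    (auto simp: cone_def)

lemma cone_finite: "y \<in> cone (order_complex P le) \<Longrightarrow> finite (supp y)"
  by (rule cone_support_finite[OF finite_simplicial_complex_order_complex[OF fin]])

text \<open>The top \<open>m\<close> of the support is recovered as the carrier of the sum: by
  induction the part without \<open>m\<close> is zero or has its carrier strictly below
  \<open>m\<close>, and \<open>add\<close> then lifts the sum into \<open>m\<close>.\<close>

lemma lin_carrier:
  assumes "y \<in> cone (order_complex P le)"
  shows "lin b y \<in> X \<and> (\<forall>m. y m > 0 \<longrightarrow> (\<forall>a. y a \<noteq> 0 \<longrightarrow> le a m) \<longrightarrow>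
    lin b y \<noteq> 0 \<and> car (lin b y) = m \<and> below (lin b (y(m := 0))) m)"
  using assms
proof (induction "card (supp y)" arbitrary: y rule: less_induct)
  case less
  have step: "lin b y \<in> X \<and> lin b y \<noteq> 0 \<and> car (lin b y) = m \<and> below (lin b (y(m := 0))) m"
    if m: "y m > 0" "\<forall>a. y a \<noteq> 0 \<longrightarrow> le a m" for m
  proof -
    let ?y = "y(m := 0)"
    have mP: "m \<in> P" using less.prems m by (auto simp: cone_def order_complex_def)
    have "card (supp ?y) < card (supp y)"
      by (rule psubset_card_mono[OF cone_finite[OF less.prems]]) (use m in auto)
    note IH = less.hyps[OF this upd_cone[OF less.prems]]
    have bel: "below (lin b ?y) m"
    proof (cases "?y = (\<lambda>w. 0)")
      case True
      then show ?thesis by (simp add: below_def)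
    next
      case False
      obtain m' where m': "?y m' > 0" "\<And>a. ?y a \<noteq> 0 \<Longrightarrow> le a m'"
        using supp_top[OF upd_cone[OF less.prems] False] by blast
      then have "car (lin b ?y) = m'" using IH by blast
      moreover have "m' \<noteq> m" "le m' m" using m' m by (auto split: if_splits)
      ultimately show ?thesis by (simp add: below_def)
    qed
    have "lin b ?y + y m *\<^sub>R b m \<in> X \<and> lin b ?y + y m *\<^sub>R b m \<noteq> 0 \<and> car (lin b ?y + y m *\<^sub>R b m) = m"
      by (rule add) (use mP m IH bel in \<open>auto simp: below_def\<close>)
    then show ?thesis using lin_upd[OF cone_finite[OF less.prems], of m] bel by simp
  qed
  show ?case
  proof (cases "y = (\<lambda>w. 0)")
    case True
    then show ?thesis using zero by simp
  next
    case False
    obtain m where "y m > 0" "\<forall>a. y a \<noteq> 0 \<longrightarrow> le a m"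
      using supp_top[OF less.prems False] by blast
    then show ?thesis using step by blast
  qed
qed

text \<open>Otherwise the remainder of \<open>y'\<close> would be the remainder of \<open>y\<close>
  plus a positive multiple of \<open>b m\<close>, so by \<open>add\<close> it would have carrier
  \<open>m\<close> although it lies strictly below \<open>m\<close>.\<close>

lemma lin_unique_coeff:
  assumes y: "y \<in> cone (order_complex P le)" "y' \<in> cone (order_complex P le)" and eq: "lin b y = lin b y'"
    and m: "y m > 0" "\<forall>a. y a \<noteq> 0 \<longrightarrow> le a m" "y' m > 0" "\<forall>a. y' a \<noteq> 0 \<longrightarrow> le a m"
  shows "\<not> y m > y' m"
proof
  assume gt: "y m > y' m"
  let ?z = "lin b (y(m := 0))" and ?z' = "lin b (y'(m := 0))"
  have mP: "m \<in> P" using y m by (auto simp: cone_def order_complex_def)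
  have z: "?z \<in> X" "below ?z m" "below ?z' m"
    using lin_carrier[OF y(1)] lin_carrier[OF y(2)] lin_carrier[OF upd_cone[OF y(1)]] m by blast+
  have "?z + y m *\<^sub>R b m = ?z' + y' m *\<^sub>R b m"
    using lin_upd[OF cone_finite[OF y(1)], of m] lin_upd[OF cone_finite[OF y(2)], of m] eq by simp
  then have "?z' = ?z + (y m - y' m) *\<^sub>R b m" by (simp add: algebra_simps)
  then have "?z' \<noteq> 0 \<and> car ?z' = m"
    using add[of m "y m - y' m" ?z] mP gt z by (auto simp: below_def)
  then show False using z(3) by (auto simp: below_def)
qed

lemma lin_inj:
  assumes "y \<in> cone (order_complex P le)" "y' \<in> cone (order_complex P le)" "lin b y = lin b y'"
  shows "y = y'"
  using assms
proof (induction "card (supp y)" arbitrary: y y' rule: less_induct)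
  case less
  have zeroD: "v = (\<lambda>w. 0)" if "v \<in> cone (order_complex P le)" "lin b v = 0" for v
    using supp_top[OF that(1)] lin_carrier[OF that(1)] that(2) by blast
  show ?case
  proof (cases "y = (\<lambda>w. 0)")
    case True
    then show ?thesis using zeroD[of y'] less.prems by simp
  next
    case False
    then have False': "y' \<noteq> (\<lambda>w. 0)" using zeroD[of y] less.prems by auto
    obtain m where m: "y m > 0" "\<forall>a. y a \<noteq> 0 \<longrightarrow> le a m" using supp_top[OF less.prems(1) False] by blast
    obtain m' where m': "y' m' > 0" "\<forall>a. y' a \<noteq> 0 \<longrightarrow> le a m'" using supp_top[OF less.prems(2) False'] by blast
    have [simp]: "m' = m" using lin_carrier[OF less.prems(1)] lin_carrier[OF less.prems(2)] m m' less.prems(3) by metis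
    have eqm: "y m = y' m"
      using lin_unique_coeff[OF less.prems m m'[simplified]]
        lin_unique_coeff[OF less.prems(2,1) less.prems(3)[symmetric] m'[simplified] m] by simp
    have "card (supp (y(m := 0))) < card (supp y)"
      by (rule psubset_card_mono[OF cone_finite[OF less.prems(1)]]) (use m in auto)
    moreover have "lin b (y(m := 0)) = lin b (y'(m := 0))"
      using lin_upd[OF cone_finite[OF less.prems(1)], of m] lin_upd[OF cone_finite[OF less.prems(2)], of m]
        less.prems(3) eqm by simp
    ultimately have "y(m := 0) = y'(m := 0)"
      using less.hyps[OF _ upd_cone[OF less.prems(1)] upd_cone[OF less.prems(2)]] by blast
    then show ?thesis using eqm by (metis fun_upd_triv fun_upd_upd)
  qed
qed

lemma lin_surj:
  assumes "x \<in> X"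
  shows "\<exists>y\<in>cone (order_complex P le). lin b y = x"
  using assms
\<comment> \<open>\<open>car 0\<close> is arbitrary; the conjunct \<open>x \<noteq> 0\<close> gives
  the origin measure 0.\<close>
proof (induction "card {p \<in> P. x \<noteq> 0 \<and> le p (car x)}" arbitrary: x rule: less_induct)
  case less
  show ?case
  proof (cases "x = 0")
    case True
    then show ?thesis by (intro bexI[of _ "\<lambda>w. 0"]) (auto simp: cone_def order_complex_def)
  next
    case False
    let ?s = "car x"
    have sP: "?s \<in> P" by (rule car[OF less.prems False])
    obtain t where t: "t > 0" "x - t *\<^sub>R b ?s \<in> X" "below (x - t *\<^sub>R b ?s) ?s"
      using sub[OF less.prems False] unfolding below_def by blast
    let ?x = "x - t *\<^sub>R b ?s"
    have "card {p \<in> P. ?x \<noteq> 0 \<and> le p (car ?x)} < card {p \<in> P. x \<noteq> 0 \<and> le p ?s}"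
    proof (rule psubset_card_mono)
      show "finite {p \<in> P. x \<noteq> 0 \<and> le p ?s}" using fin by simp
      show "{p \<in> P. ?x \<noteq> 0 \<and> le p (car ?x)} \<subset> {p \<in> P. x \<noteq> 0 \<and> le p ?s}"
      proof (cases "?x = 0")
        case True
        then show ?thesis using sP refl False by auto
      next
        case nz: False
        then have c: "le (car ?x) ?s" "car ?x \<noteq> ?s" "car ?x \<in> P" using t car by (auto simp: below_def)
        then have "\<not> le ?s (car ?x)" using antisym sP by blast
        moreover have "le p ?s" if "p \<in> P" "le p (car ?x)" for p using that trans c sP by blast
        ultimately show ?thesis using sP refl False by auto
      qed
    qed
    from less.hyps[OF this t(2)] obtain y where y: "y \<in> cone (order_complex P le)" "lin b y = ?x" by blast
    \<comment> \<open>The new top \<open>?s\<close> has to be strictly above the whole chain found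
      for the remainder; it suffices to compare it with the top of that chain, which is the carrier
      of the remainder.\<close>
    have lt: "le a ?s \<and> a \<noteq> ?s" if "y a \<noteq> 0" for a
    proof -
      have "y \<noteq> (\<lambda>w. 0)" using that by auto
      then obtain m where m: "y m > 0" "\<forall>a. y a \<noteq> 0 \<longrightarrow> le a m" using supp_top[OF y(1)] by blast
      then have "car ?x = m" "?x \<noteq> 0" using lin_carrier[OF y(1)] y(2) by auto
      then have "le m ?s" "m \<noteq> ?s" using t(3) by (auto simp: below_def)
      moreover have "m \<in> P" "a \<in> P" "le a m" using y(1) m that by (auto simp: cone_def order_complex_def)
      ultimately show ?thesis using trans[of a m ?s] antisym[of m a] sP by blast
    qed
    let ?y = "y(?s := t)"
    have ys: "y ?s = 0" using lt by blast
    then have supp: "supp ?y = insert ?s (supp y)" using t by auto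
    have "supp y \<in> order_complex P le" using y by (simp add: cone_def)
    then have "insert ?s (supp y) \<in> order_complex P le"
      using lt sP refl by (auto simp: order_complex_def)
    then have "?y \<in> cone (order_complex P le)" using y t supp by (simp add: cone_def)
    moreover have "?y(?s := 0) = y" using ys by (auto simp: fun_eq_iff)
    then have "lin b ?y = lin b y + t *\<^sub>R b ?s"
      using lin_upd[OF cone_finite[OF calculation], of ?s] by (simp del: fun_upd_apply add: fun_upd_same)
    then have "lin b ?y = x" using y by simp
    ultimately show ?thesis by blast
  qed
qed

theorem complete_fan_order_complex: "complete_fan X (order_complex P le) b"
  unfolding complete_fan_def bij_betw_def inj_on_def
  using finite_simplicial_complex_order_complex[OF fin] lin_inj lin_surj lin_carrier by blast

end

text \<open>Cells of a central hyperplane arrangement. Since \<open>\<Lambda>\<close> is closed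
  under negation, the forms that are nonnegative at a point determine its full sign vector, and
  \<open>le\<close> compares closed cells. By \<open>sep\<close> the forms have no common zero but
  the origin, so every cell is pointed.\<close>

lemma sign_fan:
  fixes V :: "'v::real_vector set" and \<Lambda> :: "('v \<Rightarrow> real) set"
  assumes V: "subspace V" and lin\<Lambda>: "\<And>f. f \<in> \<Lambda> \<Longrightarrow> linear f" and fin\<Lambda>: "finite \<Lambda>"
    and neg: "\<And>f. f \<in> \<Lambda> \<Longrightarrow> (\<lambda>x. - f x) \<in> \<Lambda>"
    and sep: "\<And>x. x \<in> V \<Longrightarrow> x \<noteq> 0 \<Longrightarrow> \<exists>f\<in>\<Lambda>. f x < 0"
    and fin: "finite P" and car: "\<And>x. x \<in> V \<Longrightarrow> x \<noteq> 0 \<Longrightarrow> car x \<in> P"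
    and b: "\<And>s. s \<in> P \<Longrightarrow> b s \<in> V \<and> b s \<noteq> 0 \<and> car (b s) = s"
    and le: "\<And>x y. x \<in> V \<Longrightarrow> x \<noteq> 0 \<Longrightarrow> y \<in> V \<Longrightarrow> y \<noteq> 0 \<Longrightarrow>
        le (car x) (car y) \<longleftrightarrow> (\<forall>f\<in>\<Lambda>. 0 \<le> f y \<longrightarrow> 0 \<le> f x)"
    and antisym: "\<And>p q. p \<in> P \<Longrightarrow> q \<in> P \<Longrightarrow> le p q \<Longrightarrow> le q p \<Longrightarrow> p = q"
  shows "complete_fan V (order_complex P le) b"
proof -
  have leb: "le p q \<longleftrightarrow> (\<forall>f\<in>\<Lambda>. 0 \<le> f (b q) \<longrightarrow> 0 \<le> f (b p))" if "p \<in> P" "q \<in> P" for p q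
    using le[of "b p" "b q"] b that by metis
  have f0: "f 0 = 0" if "f \<in> \<Lambda>" for f using linear_0 lin\<Lambda> that by blast
  interpret greedy P le V car b
  proof
    show "finite P" by fact
    show "le p p" if "p \<in> P" for p using leb that by blast
    show "p = q" if "p \<in> P" "q \<in> P" "le p q" "le q p" for p q using antisym that by blast
    show "le p r" if "p \<in> P" "q \<in> P" "r \<in> P" "le p q" "le q r" for p q r using leb that by blast
    show "0 \<in> V" using V by (rule subspace_0)
    show "car x \<in> P" if "x \<in> V" "x \<noteq> 0" for x using car that by blast
  next
    fix s y and t :: real
    assume s: "s \<in> P" and t: "t > 0" and y: "y \<in> V" and bel: "y = 0 \<or> le (car y) s \<and> car y \<noteq> s"
    let ?z = "y + t *\<^sub>R b s"
    have bs: "b s \<in> V" "b s \<noteq> 0" "car (b s) = s" using b s by auto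
    have fz: "f ?z = f y + t * f (b s)" if "f \<in> \<Lambda>" for f
      using lin\<Lambda>[OF that] by (simp add: linear_add linear_scale)
    have key: "0 \<le> f y" if "f \<in> \<Lambda>" "0 \<le> f (b s)" for f
      using bel le[of y "b s"] y bs that f0[of f] by (cases "y = 0") auto
    have key': "f ?z < 0" if "f \<in> \<Lambda>" "f (b s) < 0" for f
    proof -
      have "0 \<le> - f y" using key[OF neg[OF that(1)]] that(2) by simp
      moreover have "t * f (b s) < 0" using t that(2) by (rule mult_pos_neg)
      ultimately show ?thesis using fz[OF that(1)] by linarith
    qed
    have zV: "?z \<in> V" using V y bs by (simp add: subspace_add subspace_scale)
    have z0: "?z \<noteq> 0"
    proof -
      obtain f where "f \<in> \<Lambda>" "f (b s) < 0" using sep bs by blast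
      then show ?thesis using key'[of f] f0[of f] by force
    qed
    have sgn: "0 \<le> f ?z \<longleftrightarrow> 0 \<le> f (b s)" if "f \<in> \<Lambda>" for f
    proof
      show "0 \<le> f (b s)" if "0 \<le> f ?z" using key'[OF \<open>f \<in> \<Lambda>\<close>] that by fastforce
      show "0 \<le> f ?z" if "0 \<le> f (b s)" using key[OF \<open>f \<in> \<Lambda>\<close> that] fz[OF \<open>f \<in> \<Lambda>\<close>] t that by simp
    qed
    have "car ?z = car (b s)"
      by (rule antisym)
        (use car[OF zV z0] car[OF bs(1,2)] le[OF zV z0 bs(1,2)] le[OF bs(1,2) zV z0] sgn in auto)
    then show "?z \<in> V \<and> ?z \<noteq> 0 \<and> car ?z = s" using zV z0 bs by simp
  next
    fix x assume x: "x \<in> V" "x \<noteq> 0"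
    define u where "u = b (car x)"
    have u: "u \<in> V" "u \<noteq> 0" "car u = car x" using b car x by (auto simp: u_def)
    have sgn: "0 \<le> f u \<longleftrightarrow> 0 \<le> f x" if "f \<in> \<Lambda>" for f
      using le[of x u] le[of u x] le[of u u] x u that by auto
    have pos: "0 < f u \<longleftrightarrow> 0 < f x" if "f \<in> \<Lambda>" for f
      using sgn[OF neg[OF that]] by auto
    define \<Lambda>' where "\<Lambda>' = {f \<in> \<Lambda>. 0 < f x}"
    obtain f where "f \<in> \<Lambda>" "f x < 0" using sep x by blast
    then have ne: "\<Lambda>' \<noteq> {}" using neg[of f] by (auto simp: \<Lambda>'_def)
    have fin': "finite \<Lambda>'" using fin\<Lambda> by (simp add: \<Lambda>'_def)
    \<comment> \<open>Ratio test: the largest \<open>t\<close> for which x - t u stays in the closed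
      cell of \<open>x\<close>. A form \<open>g\<close> attaining the minimum vanishes there, which
      changes the sign vector.\<close>
    define t where "t = Min ((\<lambda>f. f x / f u) ` \<Lambda>')"
    have "t \<in> (\<lambda>f. f x / f u) ` \<Lambda>'" unfolding t_def using fin' ne by (intro Min_in) auto
    then obtain g where g: "g \<in> \<Lambda>" "0 < g x" "t = g x / g u" by (auto simp: \<Lambda>'_def)
    have t: "t > 0" using g pos[OF g(1)] by simp
    have tle: "t * f u \<le> f x" if "f \<in> \<Lambda>" "0 < f x" for f
    proof -
      have "t \<le> f x / f u" unfolding t_def using fin' that by (intro Min_le) (auto simp: \<Lambda>'_def)
      then show ?thesis using pos[OF that(1)] that(2) by (simp add: pos_le_divide_eq)
    qed
    let ?y = "x - t *\<^sub>R u"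
    have fy: "f ?y = f x - t * f u" if "f \<in> \<Lambda>" for f
      using lin\<Lambda>[OF that] by (simp add: linear_diff linear_scale)
    have yV: "?y \<in> V" using V x u by (simp add: subspace_diff subspace_scale)
    have ge: "0 \<le> f ?y" if "f \<in> \<Lambda>" "0 \<le> f x" for f
    proof (cases "f x = 0")
      case True
      then have "f u = 0" using sgn[OF that(1)] sgn[OF neg[OF that(1)]] by auto
      then show ?thesis using fy[OF that(1)] True by simp
    next
      case False
      then show ?thesis using fy[OF that(1)] tle[OF that(1)] that(2) by simp
    qed
    have "le (car ?y) (car x)" if "?y \<noteq> 0" using le[OF yV that x] ge by blast
    moreover have "car ?y \<noteq> car x" if y0: "?y \<noteq> 0"
    proof
      assume eq: "car ?y = car x"
      have "g u \<noteq> 0" using pos[OF g(1)] g(2) by simp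
      then have "g ?y = 0" using fy[OF g(1)] g by simp
      then have "0 \<le> - g x"
        using le[OF x yV y0] le[OF yV y0 yV y0] eq neg[OF g(1)] by (metis neg_0_equal_iff_equal order_refl)
      then show False using g by simp
    qed
    ultimately show "\<exists>t>0. x - t *\<^sub>R b (car x) \<in> V \<and> (x - t *\<^sub>R b (car x) = 0 \<or>
         le (car (x - t *\<^sub>R b (car x))) (car x) \<and> car (x - t *\<^sub>R b (car x)) \<noteq> car x)"
      using t yV unfolding u_def by blast
  qed
  show ?thesis by (rule complete_fan_order_complex)
qed

section \<open>Common refinements of complete fans\<close>

lemma fan_unique: "complete_fan V K \<phi> \<Longrightarrow> y \<in> cone K \<Longrightarrow> y' \<in> cone K \<Longrightarrow> lin \<phi> y = lin \<phi> y' \<Longrightarrow> y = y'"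
  by (auto simp: complete_fan_def bij_betw_def inj_on_def)

lemma fan_exists: "complete_fan V K \<phi> \<Longrightarrow> x \<in> V \<Longrightarrow> \<exists>y\<in>cone K. lin \<phi> y = x"
  by (force simp: complete_fan_def bij_betw_def)

lemma fan_in: "complete_fan V K \<phi> \<Longrightarrow> y \<in> cone K \<Longrightarrow> lin \<phi> y \<in> V"
  by (auto simp: complete_fan_def bij_betw_def)

lemma fan_simplex_finite: "complete_fan V K \<phi> \<Longrightarrow> s \<in> K \<Longrightarrow> finite s"
  by (auto simp: complete_fan_def finite_simplicial_complex_def)

lemma fan_coneI: "complete_fan V K \<phi> \<Longrightarrow> s \<in> K \<Longrightarrow> supp y \<subseteq> s \<Longrightarrow>
    (\<And>w. 0 \<le> y w) \<Longrightarrow> y \<in> cone K"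
  by (auto simp: complete_fan_def intro: cone_mono)

text \<open>The positive and the negative part of the relation lie in the same cone and have the
  same image, so they coincide; having disjoint supports, both vanish.\<close>

lemma fan_relation_trivial:
  assumes K: "complete_fan V K \<phi>" and s: "s \<in> K" and sum: "(\<Sum>w\<in>s. g w *\<^sub>R \<phi> w) = 0" and w: "w \<in> s"
  shows "g w = 0"
proof -
  have fin: "finite s" by (rule fan_simplex_finite[OF K s])
  define p where "p h w = (if w \<in> s then max 0 (h w) else 0)" for h :: "'b \<Rightarrow> real" and w
  have cone: "p h \<in> cone K" for h by (rule fan_coneI[OF K s]) (auto simp: p_def)
  have lp: "lin \<phi> (p h) = (\<Sum>w\<in>s. max 0 (h w) *\<^sub>R \<phi> w)" for h
    by (subst lin_eq[OF fin]) (auto simp: p_def intro!: sum.cong)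
  have "lin \<phi> (p g) - lin \<phi> (p (\<lambda>w. - g w)) = (\<Sum>w\<in>s. g w *\<^sub>R \<phi> w)"
    unfolding lp sum_subtractf[symmetric] scaleR_diff_left[symmetric]
    by (intro sum.cong) (auto simp: max_def)
  then have "p g = p (\<lambda>w. - g w)" using fan_unique[OF K cone cone] sum by simp
  then have "p g w = p (\<lambda>w. - g w) w" by simp
  then show ?thesis using w by (auto simp: p_def max_def split: if_splits)
qed

lemma fan_simplex_independent:
  assumes K: "complete_fan V K \<phi>" and s: "s \<in> K"
  shows "inj_on \<phi> s" "independent (\<phi> ` s)"
proof -
  have fin: "finite s" by (rule fan_simplex_finite[OF K s])
  show inj: "inj_on \<phi> s"
  proof
    fix a b assume ab: "a \<in> s" "b \<in> s" "\<phi> a = \<phi> b"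
    show "a = b"
    proof (rule ccontr)
      assume ne: "a \<noteq> b"
      let ?g = "\<lambda>w. (if w = a then 1 else 0) - (if w = b then 1 else 0) :: real"
      have "(\<Sum>w\<in>s. ?g w *\<^sub>R \<phi> w) = (\<Sum>w\<in>s. if w = a then \<phi> w else 0) - (\<Sum>w\<in>s. if w = b then \<phi> w else 0)"
        unfolding sum_subtractf[symmetric] by (intro sum.cong) (auto simp: algebra_simps)
      also have "\<dots> = 0" using fin ab by simp
      finally have "?g a = 0" by (rule fan_relation_trivial[OF K s _ ab(1)])
      then show False using ne by simp
    qed
  qed
  show "independent (\<phi> ` s)"
  proof (rule independent_if_scalars_zero)
    show "finite (\<phi> ` s)" using fin by simp
    fix f x assume "(\<Sum>x\<in>\<phi> ` s. f x *\<^sub>R x) = 0" "x \<in> \<phi> ` s"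
    then show "f x = 0"
      using fan_relation_trivial[OF K s, of "\<lambda>w. f (\<phi> w)"] by (auto simp: sum.reindex[OF inj])
  qed
qed

text \<open>Extend the rays of \<open>s\<close> to a basis \<open>B\<close> of \<open>V\<close>,
  finite because of \<open>T\<close>, and use dual coordinates: the cone is where those along
  \<open>s\<close> are nonnegative and the others vanish, each equation being two opposite
  inequalities.\<close>

lemma cone_halfspaces:
  assumes K: "complete_fan V K \<phi>" and s: "s \<in> K" and T: "finite T" "V \<subseteq> span T"
  shows "\<exists>\<Lambda> :: (_ \<Rightarrow> real) set. finite \<Lambda> \<and> (\<forall>f\<in>\<Lambda>. linear f) \<and>
    (\<forall>y\<in>cone K. supp y \<subseteq> s \<longleftrightarrow> (\<forall>f\<in>\<Lambda>. 0 \<le> f (lin \<phi> y)))"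
proof -
  let ?S = "\<phi> ` s"
  have fin: "finite s" by (rule fan_simplex_finite[OF K s])
  have ind: "inj_on \<phi> s" "independent ?S" using fan_simplex_independent[OF K s] by auto
  have SV: "?S \<subseteq> V"
  proof
    fix x assume "x \<in> ?S"
    then obtain w where w: "w \<in> s" "x = \<phi> w" by blast
    let ?y = "\<lambda>v. if v = w then 1 else 0 :: real"
    have "?y \<in> cone K" by (rule fan_coneI[OF K s]) (use w in auto)
    then have "lin \<phi> ?y \<in> V" by (rule fan_in[OF K])
    then show "x \<in> V" using w by (simp add: lin_single)
  qed
  obtain B where B: "?S \<subseteq> B" "B \<subseteq> V" "independent B" "V \<subseteq> span B"
    using maximal_independent_subset_extend[OF SV ind(2)] .
  have finB: "finite B" using independent_span_bound[OF T(1) B(3)] B T by blast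
  have "\<exists>g :: _ \<Rightarrow> real. linear g \<and> (\<forall>x\<in>B. g x = (if x = c then 1 else 0))" for c
    using linear_independent_extend[OF B(3), of "\<lambda>x. if x = c then 1 else 0 :: real"] by auto
  then obtain g :: "_ \<Rightarrow> _ \<Rightarrow> real" where g: "\<And>c. linear (g c)" "\<And>c x. x \<in> B \<Longrightarrow> g c x = (if x = c then 1 else 0)"
    by metis
  have gsum: "g c (\<Sum>x\<in>B. u x *\<^sub>R x) = u c" if "c \<in> B" for c u
  proof -
    have "g c (\<Sum>x\<in>B. u x *\<^sub>R x) = (\<Sum>x\<in>B. u x * g c x)"
      using g(1)[of c] by (simp add: linear_sum linear_scale)
    also have "\<dots> = (\<Sum>x\<in>B. if x = c then u x else 0)" by (rule sum.cong) (auto simp: g(2))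
    finally show ?thesis using that finB by simp
  qed
  have expand: "x = (\<Sum>c\<in>B. g c x *\<^sub>R c)" if "x \<in> V" for x
  proof -
    have "x \<in> range (\<lambda>u. \<Sum>c\<in>B. u c *\<^sub>R c)" using that B(4) span_finite[OF finB] by auto
    then obtain u where u: "x = (\<Sum>c\<in>B. u c *\<^sub>R c)" by blast
    have "u c = g c x" if "c \<in> B" for c using gsum[OF that, of u] u by simp
    then show ?thesis using u by (metis (mono_tags, lifting) sum.cong)
  qed
  define \<Lambda> where "\<Lambda> = g ` B \<union> (\<lambda>c x. - g c x) ` (B - ?S)"
  have "supp y \<subseteq> s \<longleftrightarrow> (\<forall>f\<in>\<Lambda>. 0 \<le> f (lin \<phi> y))" if y: "y \<in> cone K" for y
  proof
    assume "supp y \<subseteq> s"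
    then have "lin \<phi> y = (\<Sum>w\<in>s. y w *\<^sub>R \<phi> w)" by (rule lin_eq[OF fin])
    then have eq: "g c (lin \<phi> y) = (\<Sum>w\<in>s. y w * g c (\<phi> w))" for c
      using g(1)[of c] by (simp add: linear_sum linear_scale)
    have nn: "0 \<le> g c (lin \<phi> y)" for c unfolding eq
      by (rule sum_nonneg) (use y B g(2) in \<open>auto simp: cone_def\<close>)
    have "g c (lin \<phi> y) = 0" if c: "c \<in> B - ?S" for c unfolding eq
    proof (rule sum.neutral, rule ballI)
      fix w assume "w \<in> s"
      then have "\<phi> w \<in> B" "\<phi> w \<noteq> c" using B c by auto
      then show "y w * g c (\<phi> w) = 0" by (simp add: g(2))
    qed
    then show "\<forall>f\<in>\<Lambda>. 0 \<le> f (lin \<phi> y)" using nn by (auto simp: \<Lambda>_def)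
  next
    let ?x = "lin \<phi> y"
    assume *: "\<forall>f\<in>\<Lambda>. 0 \<le> f ?x"
    have nn: "0 \<le> g c ?x" if "c \<in> B" for c using * that by (auto simp: \<Lambda>_def)
    have z: "g c ?x = 0" if c: "c \<in> B - ?S" for c
    proof -
      have "(\<lambda>x. - g c x) \<in> \<Lambda>" using c unfolding \<Lambda>_def by (intro UnI2 imageI)
      then have "0 \<le> - g c ?x" by (rule bspec[OF *])
      then show ?thesis using nn[of c] c by simp
    qed
    define y' where "y' w = (if w \<in> s then g (\<phi> w) ?x else 0)" for w
    have y': "y' \<in> cone K" by (rule fan_coneI[OF K s]) (use nn B in \<open>auto simp: y'_def\<close>)
    have "lin \<phi> y' = (\<Sum>w\<in>s. g (\<phi> w) ?x *\<^sub>R \<phi> w)"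
      by (subst lin_eq[OF fin]) (auto simp: y'_def)
    also have "\<dots> = (\<Sum>c\<in>?S. g c ?x *\<^sub>R c)" by (simp add: sum.reindex[OF ind(1)])
    also have "\<dots> = (\<Sum>c\<in>B. g c ?x *\<^sub>R c)"
      by (rule sum.mono_neutral_left) (use finB B z in auto)
    also have "\<dots> = ?x" using expand[OF fan_in[OF K y]] by simp
    finally have "y' = y" by (rule fan_unique[OF K y' y])
    moreover have "supp y' \<subseteq> s" by (auto simp: y'_def)
    ultimately show "supp y \<subseteq> s" by simp
  qed
  moreover have "finite \<Lambda>" using finB by (simp add: \<Lambda>_def)
  moreover have "linear f" if "f \<in> \<Lambda>" for f
    using that g(1) by (auto simp: \<Lambda>_def intro!: linear_compose_neg)
  ultimately show ?thesis by blast
qed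

text \<open>Refinement of fans descends to realizations after normalisation: \<open>C w\<close>
  gives the \<open>K\<close>-coordinates of the ray \<open>b w\<close> and \<open>h w\<close> is
  their sum, so \<open>p w\<close> is the point where the ray meets the realization. The map induced
  by \<open>p\<close> is \<open>D\<close> after \<open>q\<close>, where \<open>q\<close> divides
  coordinates by \<open>h\<close> and \<open>D\<close> is the change of coordinates from
  \<open>K'\<close> to \<open>K\<close>.\<close>

lemma subdivision_if_refines:
  assumes K': "complete_fan V K' b" and K: "complete_fan V K \<phi>"
    and ref: "\<And>s. s \<in> K' \<Longrightarrow> \<exists>t\<in>K. \<forall>w\<in>s. \<exists>y\<in>cone K. supp y \<subseteq> t \<and> lin \<phi> y = b w"
  shows "\<exists>p. subdivision K' p K"
proof -
  define C where "C w = (SOME y. y \<in> cone K \<and> lin \<phi> y = b w)" for w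
  have sub': "t \<in> K'" if "s \<in> K'" "t \<subseteq> s" for s t
    using K' that by (auto simp: complete_fan_def finite_simplicial_complex_def)
  have C: "C w \<in> cone K" "lin \<phi> (C w) = b w" if "s \<in> K'" "w \<in> s" for s w
  proof -
    have "\<exists>y. y \<in> cone K \<and> lin \<phi> y = b w" using ref[OF that(1)] that(2) by blast
    from someI_ex[OF this] show "C w \<in> cone K" "lin \<phi> (C w) = b w" by (auto simp: C_def)
  qed
  have refC: "\<exists>t\<in>K. \<forall>w\<in>s. supp (C w) \<subseteq> t" if s: "s \<in> K'" for s
    using ref[OF s] C[OF s] fan_unique[OF K] by metis
  define tot where "tot y = (\<Sum>v | y v \<noteq> 0. y v)" for y :: "'c \<Rightarrow> real"
  define h where "h w = tot (C w)" for w
  have hpos: "h w > 0" if "s \<in> K'" "w \<in> s" for s w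
  proof -
    have 1: "(\<lambda>v. if v = w then 1 else 0 :: real) \<in> cone K'"
      by (rule fan_coneI[OF K' that(1)]) (use that in auto)
    have 2: "(\<lambda>v. 0) \<in> cone K'" by (rule fan_coneI[OF K' that(1)]) auto
    have "b w \<noteq> 0"
    proof
      assume "b w = 0"
      then have "(\<lambda>v. if v = w then 1 else 0 :: real) = (\<lambda>v. 0)"
        by (intro fan_unique[OF K' 1 2]) (simp add: lin_single)
      then show False by (metis zero_neq_one)
    qed
    then have "C w \<noteq> (\<lambda>v. 0)" using C[OF that] by (metis lin_zero)
    then obtain v where v: "C w v \<noteq> 0" by auto
    have "finite (supp (C w))"
      using cone_support_finite C(1)[OF that] K by (auto simp: complete_fan_def)
    moreover have "0 \<le> C w v" for v using C(1)[OF that] by (auto simp: cone_def)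
    ultimately show ?thesis unfolding h_def tot_def
      by (intro sum_pos2[of _ v]) (use v in \<open>auto simp: less_le\<close>)
  qed
  define p where "p w v = C w v / h w" for w v
  define D where "D y v = (\<Sum>w | y w \<noteq> 0. y w * C w v)" for y v
  have fin': "finite (supp y)" if "y \<in> cone K'" for y
    using that K' by (auto simp: complete_fan_def intro: cone_support_finite)
  have D: "D y \<in> cone K" "lin \<phi> (D y) = lin b y" "tot (D y) = (\<Sum>w | y w \<noteq> 0. y w * h w)"
    if y: "y \<in> cone K'" for y
  proof -
    let ?s = "supp y"
    have s: "?s \<in> K'" and nn: "\<And>w. 0 \<le> y w" using y by (auto simp: cone_def)
    obtain t where t: "t \<in> K" "\<And>w. w \<in> ?s \<Longrightarrow> supp (C w) \<subseteq> t" using refC[OF s] by blast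
    have fint: "finite t" by (rule fan_simplex_finite[OF K t(1)])
    have supp: "supp (D y) \<subseteq> t"
    proof
      fix v assume "v \<in> supp (D y)"
      then obtain w where "w \<in> ?s" "C w v \<noteq> 0" unfolding D_def
        by (smt (verit, best) mem_Collect_eq mult_eq_0_iff sum.neutral)
      then show "v \<in> t" using t by blast
    qed
    show "D y \<in> cone K"
    proof (rule fan_coneI[OF K t(1) supp])
      show "0 \<le> D y v" for v unfolding D_def
        by (rule sum_nonneg) (use C(1)[OF s] nn in \<open>auto simp: cone_def\<close>)
    qed
    have "lin \<phi> (D y) = (\<Sum>v\<in>t. \<Sum>w\<in>?s. (y w * C w v) *\<^sub>R \<phi> v)"
      unfolding lin_eq[OF fint supp] by (simp add: D_def scaleR_sum_left)
    also have "\<dots> = (\<Sum>w\<in>?s. y w *\<^sub>R (\<Sum>v\<in>t. C w v *\<^sub>R \<phi> v))"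
      by (subst sum.swap) (simp add: scaleR_sum_right)
    also have "\<dots> = (\<Sum>w\<in>?s. y w *\<^sub>R b w)"
    proof (rule sum.cong[OF refl])
      fix w assume w: "w \<in> ?s"
      show "y w *\<^sub>R (\<Sum>v\<in>t. C w v *\<^sub>R \<phi> v) = y w *\<^sub>R b w"
        by (metis lin_eq[OF fint t(2)[OF w], of \<phi>] C(2)[OF s w])
    qed
    finally show "lin \<phi> (D y) = lin b y" by (simp add: lin_def)
    have "tot (D y) = (\<Sum>v\<in>t. \<Sum>w\<in>?s. y w * C w v)"
      unfolding tot_def D_def[symmetric] using fint supp by (intro sum.mono_neutral_left) auto
    also have "\<dots> = (\<Sum>w\<in>?s. y w * (\<Sum>v\<in>t. C w v))"
      by (subst sum.swap) (simp add: sum_distrib_left)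
    also have "\<dots> = (\<Sum>w\<in>?s. y w * h w)"
      unfolding h_def tot_def using fint t(2)
      by (intro sum.cong arg_cong2[where f="(*)"] sum.mono_neutral_right) auto
    finally show "tot (D y) = (\<Sum>w\<in>?s. y w * h w)" .
  qed
  define q where "q z w = z w / h w" for z w
  have suppq: "supp (q z) = supp z" if "z \<in> cone K'" for z
    using that hpos[of "supp z"] by (fastforce simp: q_def cone_def)
  have q: "q z \<in> cone K'" if z: "z \<in> cone K'" for z
  proof (rule fan_coneI[OF K', of "supp z"])
    show "supp z \<in> K'" using z by (simp add: cone_def)
    then show "0 \<le> q z w" for w using z hpos[of "supp z" w]
      by (cases "z w = 0") (auto simp: q_def cone_def)
    show "supp (q z) \<subseteq> supp z" using suppq[OF z] by simp
  qed
  have S: "simplexwise_linear p z = D (q z)" if z: "z \<in> cone K'" for z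
    unfolding simplexwise_linear_def D_def suppq[OF z] by (simp add: p_def q_def)
  have tot: "tot (D (q z)) = (\<Sum>w | z w \<noteq> 0. z w)" if z: "z \<in> cone K'" for z
  proof -
    have "supp z \<in> K'" using z by (simp add: cone_def)
    then have "q z w * h w = z w" if "z w \<noteq> 0" for w
      using hpos[of "supp z" w] that by (simp add: q_def)
    then show ?thesis unfolding D(3)[OF q[OF z]] suppq[OF z] by (intro sum.cong) auto
  qed
  have qinj: "z = z'" if "z \<in> cone K'" "z' \<in> cone K'" "q z = q z'" for z z'
  proof
    fix w
    have eq: "supp z = supp z'" using suppq that by metis
    show "z w = z' w"
    proof (cases "z w = 0")
      case False
      then have "h w > 0" using that hpos[of "supp z" w] by (simp add: cone_def)
      then show ?thesis using fun_cong[OF that(3), of w] by (simp add: q_def)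
    qed (use eq in auto)
  qed
  have qsurj: "\<exists>z\<in>cone K'. q z = y" if y: "y \<in> cone K'" for y
  proof
    let ?z = "\<lambda>w. y w * h w"
    have s: "supp y \<in> K'" using y by (simp add: cone_def)
    have hw: "h w > 0" if "y w \<noteq> 0" for w using hpos[OF s] that by simp
    show "q ?z = y" using hw by (force simp: q_def fun_eq_iff)
    show "?z \<in> cone K'"
    proof (rule fan_coneI[OF K' s])
      show "0 \<le> y w * h w" for w
        using hw[of w] y by (cases "y w = 0") (auto simp: cone_def)
    qed auto
  qed
  have real: "realization L = {x \<in> cone L. (\<Sum>v | x v \<noteq> 0. x v) = 1}" for L :: "'x set set"
    by (auto simp: realization_def cone_def)
  have "bij_betw (simplexwise_linear p) (realization K') (realization K)"
    unfolding bij_betw_def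
  proof
    show "inj_on (simplexwise_linear p) (realization K')"
    proof
      fix z z' assume z: "z \<in> realization K'" "z' \<in> realization K'"
        "simplexwise_linear p z = simplexwise_linear p z'"
      then have zc: "z \<in> cone K'" "z' \<in> cone K'" by (auto simp: real)
      then have "D (q z) = D (q z')" using z(3) S by simp
      then have "lin b (q z) = lin b (q z')" using D(2) q zc by metis
      then have "q z = q z'" using fan_unique[OF K'] q zc by blast
      then show "z = z'" using qinj zc by blast
    qed
    show "simplexwise_linear p ` realization K' = realization K"
    proof (intro equalityI subsetI)
      fix x assume "x \<in> simplexwise_linear p ` realization K'"
      then obtain z where z: "z \<in> cone K'" "(\<Sum>w | z w \<noteq> 0. z w) = 1" "x = D (q z)"
        using S by (auto simp: real)
      then show "x \<in> realization K" using D(1)[OF q[OF z(1)]] tot[OF z(1)]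
        by (simp add: real tot_def)
    next
      fix x assume x: "x \<in> realization K"
      then have xc: "x \<in> cone K" by (simp add: real)
      obtain y where y: "y \<in> cone K'" "lin b y = lin \<phi> x"
        using fan_exists[OF K' fan_in[OF K xc]] by blast
      obtain z where z: "z \<in> cone K'" "q z = y" using qsurj[OF y(1)] by blast
      have "D y = x" using fan_unique[OF K D(1)[OF y(1)] xc] D(2)[OF y(1)] y(2) by simp
      then have "simplexwise_linear p z = x" "(\<Sum>w | z w \<noteq> 0. z w) = 1"
        using S[OF z(1)] tot[OF z(1)] z x by (auto simp: real tot_def)
      then show "x \<in> simplexwise_linear p ` realization K'" using z by (force simp: real)
    qed
  qed
  moreover have "p w \<in> realization K" if w: "{w} \<in> K'" for w
  proof -
    have h: "h w > 0" using hpos[OF w] by simp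
    have supp: "supp (p w) = supp (C w)" using h by (auto simp: p_def)
    have "(\<Sum>v | p w v \<noteq> 0. p w v) = tot (C w) / h w"
      unfolding supp tot_def by (simp add: p_def sum_divide_distrib)
    then show ?thesis using h C(1)[OF w] supp
      by (auto simp: real cone_def h_def p_def)
  qed
  moreover have "\<exists>t\<in>K. \<forall>w\<in>s. supp (p w) \<subseteq> t" if "s \<in> K'" for s
    using refC[OF that] by (auto simp: p_def)
  moreover have "finite_simplicial_complex K'" using K' by (simp add: complete_fan_def)
  ultimately show ?thesis unfolding subdivision_def by blast
qed

text \<open>For a chain \<open>s\<close>, the simplex of \<open>K\<close> carrying the top point
  \<open>b m\<close> serves for all of \<open>s\<close>: each inequality defining its cone holds at
  \<open>b m\<close>, hence at every \<open>b a\<close>.\<close>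

lemma halfspaces_refine:
  assumes K: "complete_fan V K \<phi>"
    and H: "\<And>t y. t \<in> K \<Longrightarrow> y \<in> cone K \<Longrightarrow> supp y \<subseteq> t \<longleftrightarrow> (\<forall>f\<in>H t. 0 \<le> (f (lin \<phi> y) :: real))"
    and \<Lambda>: "\<And>t f. t \<in> K \<Longrightarrow> f \<in> H t \<Longrightarrow> f \<in> \<Lambda>"
    and V: "\<And>a. a \<in> s \<Longrightarrow> b a \<in> V"
    and top: "s \<noteq> {} \<Longrightarrow> \<exists>m\<in>s. \<forall>a\<in>s. \<forall>f\<in>\<Lambda>. 0 \<le> f (b m) \<longrightarrow> 0 \<le> f (b a)"
  shows "\<exists>t\<in>K. \<forall>w\<in>s. \<exists>y\<in>cone K. supp y \<subseteq> t \<and> lin \<phi> y = b w"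
proof (cases "s = {}")
  case True
  then show ?thesis using K by (auto simp: complete_fan_def finite_simplicial_complex_def)
next
  case False
  then obtain m where m: "m \<in> s" "\<And>a f. a \<in> s \<Longrightarrow> f \<in> \<Lambda> \<Longrightarrow> 0 \<le> f (b m) \<Longrightarrow> 0 \<le> f (b a)"
    using top by blast
  obtain y where y: "y \<in> cone K" "lin \<phi> y = b m" using fan_exists[OF K V[OF m(1)]] by blast
  let ?t = "supp y"
  have t: "?t \<in> K" using y by (simp add: cone_def)
  have nn: "0 \<le> f (b a)" if "f \<in> H ?t" "a \<in> s" for f a
    using H[OF t y(1)] y(2) m(2)[OF that(2) \<Lambda>[OF t that(1)]] that(1) by auto
  have "\<exists>z\<in>cone K. supp z \<subseteq> ?t \<and> lin \<phi> z = b a" if a: "a \<in> s" for a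
  proof -
    obtain z where z: "z \<in> cone K" "lin \<phi> z = b a" using fan_exists[OF K V[OF a]] by blast
    then show ?thesis using H[OF t z(1)] nn a by auto
  qed
  then show ?thesis using t by blast
qed

theorem PL_homeomorphic_if_complete_fans:
  assumes K: "complete_fan V K \<phi>" and L: "complete_fan V L \<psi>"
    and V: "subspace V" and T: "finite T" "V \<subseteq> span T"
  shows "PL_homeomorphic K L"
proof -
  obtain \<Lambda>K where \<Lambda>K: "\<And>s. s \<in> K \<Longrightarrow> finite (\<Lambda>K s)" "\<And>s f. s \<in> K \<Longrightarrow> f \<in> \<Lambda>K s \<Longrightarrow> linear f"
    "\<And>s y. s \<in> K \<Longrightarrow> y \<in> cone K \<Longrightarrow> supp y \<subseteq> s \<longleftrightarrow> (\<forall>f\<in>\<Lambda>K s. 0 \<le> (f (lin \<phi> y) :: real))"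
    using cone_halfspaces[OF K _ T] by metis
  obtain \<Lambda>L where \<Lambda>L: "\<And>s. s \<in> L \<Longrightarrow> finite (\<Lambda>L s)" "\<And>s f. s \<in> L \<Longrightarrow> f \<in> \<Lambda>L s \<Longrightarrow> linear f"
    "\<And>s y. s \<in> L \<Longrightarrow> y \<in> cone L \<Longrightarrow> supp y \<subseteq> s \<longleftrightarrow> (\<forall>f\<in>\<Lambda>L s. 0 \<le> (f (lin \<psi> y) :: real))"
    using cone_halfspaces[OF L _ T] by metis
  have finKL: "finite K" "finite L" "{} \<in> K" "{} \<in> L"
    using K L by (auto simp: complete_fan_def finite_simplicial_complex_def)
  define \<Lambda>0 where "\<Lambda>0 = (\<Union>s\<in>K. \<Lambda>K s) \<union> (\<Union>s\<in>L. \<Lambda>L s)"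
  define \<Lambda> where "\<Lambda> = \<Lambda>0 \<union> (\<lambda>f x. - f x) ` \<Lambda>0"
  define sg where "sg x = {f \<in> \<Lambda>. 0 \<le> f x}" for x
  have fin\<Lambda>: "finite \<Lambda>" using finKL \<Lambda>K(1) \<Lambda>L(1) by (auto simp: \<Lambda>_def \<Lambda>0_def)
  have lin\<Lambda>: "linear f" if "f \<in> \<Lambda>" for f
    using that \<Lambda>K(2) \<Lambda>L(2) by (auto simp: \<Lambda>_def \<Lambda>0_def intro!: linear_compose_neg)
  have neg: "(\<lambda>x. - f x) \<in> \<Lambda>" if "f \<in> \<Lambda>" for f using that by (auto simp: \<Lambda>_def)
  \<comment> \<open>The forms belonging to the empty simplex cut out its cone, the origin, so one of
    them is negative at any other point.\<close>
  have sep: "\<exists>f\<in>\<Lambda>. f x < 0" if x: "x \<in> V" "x \<noteq> 0" for x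
  proof -
    obtain y where y: "y \<in> cone K" "lin \<phi> y = x" using fan_exists[OF K x(1)] by blast
    then have "y \<noteq> (\<lambda>w. 0)" using x(2) by auto
    then have "\<not> supp y \<subseteq> {}" by auto
    then obtain f where "f \<in> \<Lambda>K {}" "f x < 0" using \<Lambda>K(3)[OF finKL(3) y(1)] y(2) by force
    then show ?thesis using finKL(3) by (auto simp: \<Lambda>_def \<Lambda>0_def)
  qed
  have "finite (sg ` V)" by (rule finite_subset[of _ "Pow \<Lambda>"]) (auto simp: sg_def fin\<Lambda>)
  \<comment> \<open>\<open>PL_homeomorphic\<close> asks for a common subdivision with vertices in
    \<open>nat\<close>, hence the sign vectors are numbered.\<close>
  then obtain h :: "_ \<Rightarrow> nat" where h: "inj_on h (sg ` V)"
    using finite_imp_inj_to_nat_seg by metis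
  define car where "car x = h (sg x)" for x
  define P where "P = car ` (V - {0})"
  define b where "b = (\<lambda>s. SOME x. x \<in> V - {0} \<and> car x = s)"
  define le where "le s t \<longleftrightarrow> sg (b t) \<subseteq> sg (b s)" for s t
  have b: "b s \<in> V \<and> b s \<noteq> 0 \<and> car (b s) = s" if "s \<in> P" for s
  proof -
    have "\<exists>x. x \<in> V - {0} \<and> car x = s" using that by (auto simp: P_def)
    from someI_ex[OF this] show ?thesis by (auto simp: b_def)
  qed
  have sgb: "sg (b (car x)) = sg x" if "x \<in> V" "x \<noteq> 0" for x
    using b[of "car x"] that h by (auto simp: P_def car_def inj_on_def)
  have fan: "complete_fan V (order_complex P le) b"
  proof (rule sign_fan[OF V lin\<Lambda> fin\<Lambda> neg sep])
    have "finite (h ` sg ` V)" using \<open>finite (sg ` V)\<close> by (rule finite_imageI)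
    then show "finite P" by (rule rev_finite_subset) (auto simp: P_def car_def)
    show "car x \<in> P" if "x \<in> V" "x \<noteq> 0" for x using that by (auto simp: P_def)
    show "le (car x) (car y) \<longleftrightarrow> (\<forall>f\<in>\<Lambda>. 0 \<le> f y \<longrightarrow> 0 \<le> f x)"
      if "x \<in> V" "x \<noteq> 0" "y \<in> V" "y \<noteq> 0" for x y
      using sgb that by (auto simp: le_def sg_def)
    show "p = q" if "p \<in> P" "q \<in> P" "le p q" "le q p" for p q
    proof -
      have "sg (b p) = sg (b q)" using that by (simp add: le_def)
      then have "car (b p) = car (b q)" by (simp add: car_def)
      then show ?thesis using b that by simp
    qed
  qed (use b in auto)
  have top: "\<exists>m\<in>s. \<forall>a\<in>s. \<forall>f\<in>\<Lambda>. 0 \<le> f (b m) \<longrightarrow> 0 \<le> f (b a)" if "s \<in> order_complex P le" "s \<noteq> {}" for s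
  proof -
    have "\<exists>m\<in>s. \<forall>a\<in>s. le a m"
      by (rule chain_has_top) (use that in \<open>auto simp: order_complex_def le_def\<close>)
    then show ?thesis unfolding le_def sg_def by blast
  qed
  have bV: "b a \<in> V" if "s \<in> order_complex P le" "a \<in> s" for s a using that b by (auto simp: order_complex_def)
  have K\<Lambda>: "f \<in> \<Lambda>" if "t \<in> K" "f \<in> \<Lambda>K t" for t f using that by (auto simp: \<Lambda>_def \<Lambda>0_def)
  have L\<Lambda>: "f \<in> \<Lambda>" if "t \<in> L" "f \<in> \<Lambda>L t" for t f using that by (auto simp: \<Lambda>_def \<Lambda>0_def)
  have refK: "\<exists>t\<in>K. \<forall>w\<in>s. \<exists>y\<in>cone K. supp y \<subseteq> t \<and> lin \<phi> y = b w"
    if s: "s \<in> order_complex P le" for s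
    by (rule halfspaces_refine[OF K, where H = \<Lambda>K and \<Lambda> = \<Lambda>])
      (erule (1) \<Lambda>K(3) | erule (1) K\<Lambda> | erule bV[OF s] | erule top[OF s])+
  have refL: "\<exists>t\<in>L. \<forall>w\<in>s. \<exists>y\<in>cone L. supp y \<subseteq> t \<and> lin \<psi> y = b w"
    if s: "s \<in> order_complex P le" for s
    by (rule halfspaces_refine[OF L, where H = \<Lambda>L and \<Lambda> = \<Lambda>])
      (erule (1) \<Lambda>L(3) | erule (1) L\<Lambda> | erule bV[OF s] | erule top[OF s])+
  obtain p q where "subdivision (order_complex P le) p K" "subdivision (order_complex P le) q L"
    using subdivision_if_refines[OF fan K refK] subdivision_if_refines[OF fan L refL] by blast
  then show ?thesis unfolding PL_homeomorphic_def by blast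
qed


section \<open>The boundary of a simplex, and joins\<close>

definition vec :: "'i set \<Rightarrow> ('i \<Rightarrow> real) set" where
  "vec D = {f. \<forall>i. i \<notin> D \<longrightarrow> f i = 0}"

lemma subspace_vec: "subspace (vec D)"
  by (auto simp: subspace_def vec_def)

lemma vec_spanned:
  assumes "finite D"
  shows "\<exists>T. finite T \<and> vec D \<subseteq> span T"
proof (intro exI conjI subsetI)
  let ?e = "\<lambda>i j. if j = i then 1 else 0 :: real"
  show "finite (?e ` D)" using assms by simp
  fix f :: "'a \<Rightarrow> real" assume "f \<in> vec D"
  then have "f = (\<Sum>i\<in>D. f i *\<^sub>R ?e i)"
    using assms by (auto simp: fun_eq_iff sum_fun_apply vec_def if_distrib cong: if_cong)
  also have "\<dots> \<in> span (?e ` D)"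
    by (intro span_sum span_scale span_base) auto
  finally show "f \<in> span (?e ` D)" .
qed

text \<open>The rays are the unit vectors together with minus their sum. Then \<open>lin\<close>
  yields the differences \<open>y j - y 0\<close>, so \<open>y\<close> is determined up to a common
  shift of its coordinates, and the representative in the cone is the one whose smallest coordinate
  is 0.\<close>

lemma complete_fan_simplex_boundary:
  fixes D :: "'i set"
  assumes "finite D"
  shows "\<exists>\<psi>. complete_fan (vec D) (simplex_boundary (card D)) \<psi>"
proof -
  let ?d = "card D"
  obtain e where e: "bij_betw e {1..?d} D" using ex_bij_betw_nat_finite_1[OF assms] by blast
  define \<psi> :: "nat \<Rightarrow> 'i \<Rightarrow> real" where
    "\<psi> j i = (if j = 0 then (if i \<in> D then -1 else 0) else if i = e j then 1 else 0)" for j i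
  let ?K = "simplex_boundary ?d"
  have fsc: "finite_simplicial_complex ?K"
    unfolding finite_simplicial_complex_def
  proof (intro conjI)
    show "finite ?K" by (rule finite_subset[of _ "Pow {0..?d}"]) (auto simp: simplex_boundary_def)
  qed (auto simp: simplex_boundary_def dest: psubset_imp_subset finite_subset)
  have supp: "supp y \<subseteq> {0..?d}" if "y \<in> cone ?K" for y
    using that by (auto simp: cone_def simplex_boundary_def)
  have lin_at: "lin \<psi> y i = (\<Sum>j\<in>{0..?d}. y j * \<psi> j i)" if "supp y \<subseteq> {0..?d}" for y i
    by (subst lin_eq[OF _ that]) (auto simp: sum_fun_apply)
  have lin_e: "lin \<psi> y (e j) = y j - y 0" if y: "supp y \<subseteq> {0..?d}" and j: "j \<in> {1..?d}" for y j
  proof -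
    have eD: "e j \<in> D" using e j by (auto simp: bij_betw_def)
    have inj: "e j = e i \<longleftrightarrow> i = j" if "i \<in> {1..?d}" for i
      using inj_on_eq_iff[OF bij_betw_imp_inj_on[OF e] j that] by auto
    have "lin \<psi> y (e j) = y 0 * \<psi> 0 (e j) + (\<Sum>i\<in>{1..?d}. y i * \<psi> i (e j))"
      unfolding lin_at[OF y] by (simp add: sum.atLeast_Suc_atMost)
    also have "(\<Sum>i\<in>{1..?d}. y i * \<psi> i (e j)) = (\<Sum>i\<in>{1..?d}. if i = j then y i else 0)"
      by (rule sum.cong) (auto simp: \<psi>_def inj)
    finally have "lin \<psi> y (e j) = y 0 * \<psi> 0 (e j) + y j" using j by simp
    moreover have "\<psi> 0 (e j) = -1" using eD by (simp add: \<psi>_def)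
    ultimately show ?thesis by simp
  qed
  have lin_out: "lin \<psi> y i = 0" if y: "supp y \<subseteq> {0..?d}" and i: "i \<notin> D" for y i
    unfolding lin_at[OF y]
  proof (rule sum.neutral, rule ballI)
    fix j assume "j \<in> {0..?d}"
    then have "e j \<in> D" if "j \<noteq> 0" using e that by (auto simp: bij_betw_def)
    then show "y j * \<psi> j i = 0" using i by (auto simp: \<psi>_def)
  qed
  have "bij_betw (lin \<psi>) (cone ?K) (vec D)"
    unfolding bij_betw_def
  proof
    show "inj_on (lin \<psi>) (cone ?K)"
    proof
      fix y y' assume y: "y \<in> cone ?K" "y' \<in> cone ?K" "lin \<psi> y = lin \<psi> y'"
      obtain j where j: "j \<in> {0..?d}" "y j = 0" using y(1) by (auto simp: cone_def simplex_boundary_def)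
      obtain j' where j': "j' \<in> {0..?d}" "y' j' = 0" using y(2) by (auto simp: cone_def simplex_boundary_def)
      have eq: "y i - y 0 = y' i - y' 0" if "i \<in> {0..?d}" for i
        using lin_e[OF supp[OF y(1)], of i] lin_e[OF supp[OF y(2)], of i] y(3) that by (cases "i = 0") auto
      have nn: "0 \<le> y i" "0 \<le> y' i" for i using y by (auto simp: cone_def)
      have "y 0 = y' 0" using eq[OF j(1)] eq[OF j'(1)] j j' nn(1)[of j'] nn(2)[of j] by linarith
      then have "y i = y' i" if "i \<in> {0..?d}" for i using eq[OF that] by simp
      moreover have "y i = 0" "y' i = 0" if "i \<notin> {0..?d}" for i
        using supp[OF y(1)] supp[OF y(2)] that by auto
      ultimately show "y = y'" by (metis ext)
    qed
    show "lin \<psi> ` cone ?K = vec D"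
    proof (intro equalityI subsetI)
      fix x assume "x \<in> lin \<psi> ` cone ?K"
      then show "x \<in> vec D" using lin_out supp by (auto simp: vec_def)
    next
      fix f assume f: "f \<in> vec D"
      \<comment> \<open>The least shift that makes 0 and all \<open>f (e j)\<close> nonnegative; as
        a maximum it is attained, which supplies the vanishing coordinate.\<close>
      define m where "m = Max (insert 0 ((\<lambda>j. - f (e j)) ` {1..?d}))"
      define y where "y j = (if j = 0 then m else if j \<in> {1..?d} then f (e j) + m else 0)" for j
      have "m \<in> insert 0 ((\<lambda>j. - f (e j)) ` {1..?d})" unfolding m_def by (rule Max_in) auto
      then consider "m = 0" | j where "j \<in> {1..?d}" "m = - f (e j)" by blast
      then have ex: "\<exists>j\<in>{0..?d}. y j = 0"
      proof cases
        case 1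
        then show ?thesis by (intro bexI[of _ 0]) (auto simp: y_def)
      next
        case (2 j)
        then show ?thesis by (intro bexI[of _ j]) (auto simp: y_def)
      qed
      have ge: "m \<ge> 0" "\<And>j. j \<in> {1..?d} \<Longrightarrow> - f (e j) \<le> m"
        unfolding m_def by (rule Max_ge; simp)+
      have s: "supp y \<subseteq> {0..?d}" by (auto simp: y_def)
      have "0 \<le> y j" for j using ge(1) ge(2)[of j] by (auto simp: y_def)
      then have yc: "y \<in> cone ?K" using ex s by (auto simp: cone_def simplex_boundary_def)
      have "lin \<psi> y i = f i" for i
      proof (cases "i \<in> D")
        case True
        then have "i \<in> e ` {1..?d}" using bij_betw_imp_surj_on[OF e] by simp
        then obtain j where j: "j \<in> {1..?d}" "i = e j" by blast
        have "y j - y 0 = f (e j)" using j(1) by (simp add: y_def)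
        then show ?thesis using lin_e[OF s j(1)] j(2) by simp
      next
        case False
        then show ?thesis using lin_out[OF s] f by (simp add: vec_def)
      qed
      then have "lin \<psi> y = f" by (rule ext)
      then show "f \<in> lin \<psi> ` cone ?K" using yc by blast
    qed
  qed
  then show ?thesis using fsc by (auto simp: complete_fan_def)
qed

section \<open>Joins of complete fans\<close>

lemma lin_fun_apply: "lin \<phi> y i = (\<Sum>w | y w \<noteq> 0. y w * \<phi> w i)" for \<phi> :: "'w \<Rightarrow> 'i \<Rightarrow> real"
  by (simp add: lin_def sum_fun_apply)

text \<open>The product of two complete fans. Both complexes share one vertex type, so the set
  \<open>U\<close> decides to which factor a vertex belongs.\<close>

lemma complete_fan_join:
  fixes b1 :: "'w \<Rightarrow> 'i \<Rightarrow> real" and b2 :: "'w \<Rightarrow> 'j \<Rightarrow> real"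
  assumes K1: "complete_fan (vec D1) K1 b1" and K2: "complete_fan (vec D2) K2 b2"
    and U: "\<Union>K1 \<subseteq> U" "\<Union>K2 \<inter> U = {}"
  shows "complete_fan (vec (D1 <+> D2)) {s1 \<union> s2 | s1 s2. s1 \<in> K1 \<and> s2 \<in> K2}
    (\<lambda>w. if w \<in> U then case_sum (b1 w) (\<lambda>_. 0) else case_sum (\<lambda>_. 0) (b2 w))"
    (is "complete_fan _ ?K ?b")
proof -
  have fsc1: "finite_simplicial_complex K1" and fsc2: "finite_simplicial_complex K2"
    using K1 K2 by (auto simp: complete_fan_def)
  define r1 where "r1 y w = (if w \<in> U then y w else 0)" for y :: "'w \<Rightarrow> real" and w
  define r2 where "r2 y w = (if w \<in> U then 0 else y w)" for y :: "'w \<Rightarrow> real" and w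
  have down: "t \<in> K1" if "s \<in> K1" "t \<subseteq> s" for s t using fsc1 that by (auto simp: finite_simplicial_complex_def)
  have down2: "t \<in> K2" if "s \<in> K2" "t \<subseteq> s" for s t using fsc2 that by (auto simp: finite_simplicial_complex_def)
  have split: "s \<in> ?K \<longleftrightarrow> s \<inter> U \<in> K1 \<and> s - U \<in> K2" for s
  proof
    assume "s \<in> ?K"
    then obtain s1 s2 where s: "s = s1 \<union> s2" "s1 \<in> K1" "s2 \<in> K2" by blast
    then have "s \<inter> U = s1" "s - U = s2" using U by auto
    then show "s \<inter> U \<in> K1 \<and> s - U \<in> K2" using s by simp
  next
    assume "s \<inter> U \<in> K1 \<and> s - U \<in> K2"
    moreover have "s = s \<inter> U \<union> (s - U)" by blast
    ultimately show "s \<in> ?K" by blast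
  qed
  have f1: "finite ?K"
  proof (rule finite_subset)
    show "?K \<subseteq> (\<lambda>(a, b). a \<union> b) ` (K1 \<times> K2)" by auto
    show "finite ((\<lambda>(a, b). a \<union> b) ` (K1 \<times> K2))"
      using fsc1 fsc2 by (auto simp: finite_simplicial_complex_def)
  qed
  have f2: "t \<in> ?K" if "s \<in> ?K" "t \<subseteq> s" for s t
    using that unfolding split by (meson Diff_mono Int_mono down down2 order_refl)
  have f3: "finite s" if "s \<in> ?K" for s
    using that fsc1 fsc2 by (auto simp: finite_simplicial_complex_def)
  have f4: "{} \<in> ?K" using fsc1 fsc2 by (auto simp: finite_simplicial_complex_def)
  have fsc: "finite_simplicial_complex ?K"
    unfolding finite_simplicial_complex_def
    by (intro conjI ballI allI impI) (rule f1, rule f4, erule f3, erule f2, assumption)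
  have cone: "y \<in> cone ?K \<longleftrightarrow> r1 y \<in> cone K1 \<and> r2 y \<in> cone K2" for y
  proof -
    have "supp (r1 y) = supp y \<inter> U" "supp (r2 y) = supp y - U"
      by (auto simp: r1_def r2_def)
    moreover have "(\<forall>w. 0 \<le> y w) \<longleftrightarrow> (\<forall>w. 0 \<le> r1 y w) \<and> (\<forall>w. 0 \<le> r2 y w)"
      by (auto simp: r1_def r2_def)
    moreover have "y \<in> cone ?K \<longleftrightarrow> (\<forall>w. 0 \<le> y w) \<and> supp y \<in> ?K"
      unfolding cone_def by (rule mem_Collect_eq)
    ultimately show ?thesis unfolding split by (auto simp: cone_def)
  qed
  have lin: "lin ?b y = case_sum (lin b1 (r1 y)) (lin b2 (r2 y))" if y: "y \<in> cone ?K" for y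
  proof
    fix i
    have fin: "finite (supp y)" by (rule cone_support_finite[OF fsc y])
    have e1: "lin b1 (r1 y) a = (\<Sum>w | y w \<noteq> 0. r1 y w * b1 w a)" for a
      unfolding lin_fun_apply by (rule sum.mono_neutral_left[OF fin]) (auto simp: r1_def)
    have e2: "lin b2 (r2 y) a = (\<Sum>w | y w \<noteq> 0. r2 y w * b2 w a)" for a
      unfolding lin_fun_apply by (rule sum.mono_neutral_left[OF fin]) (auto simp: r2_def)
    show "lin ?b y i = case_sum (lin b1 (r1 y)) (lin b2 (r2 y)) i"
      unfolding lin_fun_apply[of ?b]
      by (cases i) (auto simp: e1 e2 r1_def r2_def intro!: sum.cong)
  qed
  have "bij_betw (lin ?b) (cone ?K) (vec (D1 <+> D2))"
    unfolding bij_betw_def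
  proof
    show "inj_on (lin ?b) (cone ?K)"
    proof
      fix y y' assume y: "y \<in> cone ?K" "y' \<in> cone ?K" "lin ?b y = lin ?b y'"
      have *: "case_sum (lin b1 (r1 y)) (lin b2 (r2 y)) = case_sum (lin b1 (r1 y')) (lin b2 (r2 y'))"
        unfolding lin[OF y(1), symmetric] lin[OF y(2), symmetric] by (rule y(3))
      have "lin b1 (r1 y) a = lin b1 (r1 y') a" for a using fun_cong[OF *, of "Inl a"] by simp
      moreover have "lin b2 (r2 y) a = lin b2 (r2 y') a" for a using fun_cong[OF *, of "Inr a"] by simp
      ultimately have l: "lin b1 (r1 y) = lin b1 (r1 y')" "lin b2 (r2 y) = lin b2 (r2 y')"
        by (simp_all add: fun_eq_iff)
      have "r1 y = r1 y'"
        by (rule fan_unique[OF K1 _ _ l(1)]) (use y(1,2)[unfolded cone] in auto)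
      moreover have "r2 y = r2 y'"
        by (rule fan_unique[OF K2 _ _ l(2)]) (use y(1,2)[unfolded cone] in auto)
      ultimately have "r1 y w = r1 y' w" "r2 y w = r2 y' w" for w by simp_all
      then have "y w = y' w" for w unfolding r1_def r2_def by (cases "w \<in> U") metis+
      then show "y = y'" by (rule ext)
    qed
    show "lin ?b ` cone ?K = vec (D1 <+> D2)"
    proof (intro equalityI subsetI)
      fix x assume "x \<in> lin ?b ` cone ?K"
      then obtain y where y: "y \<in> cone ?K" "x = lin ?b y" by blast
      then have "lin b1 (r1 y) \<in> vec D1" "lin b2 (r2 y) \<in> vec D2"
        using fan_in[OF K1] fan_in[OF K2] cone by blast+
      then show "x \<in> vec (D1 <+> D2)" unfolding y(2) lin[OF y(1)]
        by (auto simp: vec_def split: sum.splits)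
    next
      fix x assume x: "x \<in> vec (D1 <+> D2)"
      have "x \<circ> Inl \<in> vec D1" "x \<circ> Inr \<in> vec D2" using x by (auto simp: vec_def)
      then obtain y1 y2 where y: "y1 \<in> cone K1" "lin b1 y1 = x \<circ> Inl" "y2 \<in> cone K2" "lin b2 y2 = x \<circ> Inr"
        using fan_exists[OF K1] fan_exists[OF K2] by metis
      define y where "y w = (if w \<in> U then y1 w else y2 w)" for w
      have "r1 y = y1" "r2 y = y2"
        using y U by (auto simp: r1_def r2_def y_def fun_eq_iff cone_def)
      then have yc: "y \<in> cone ?K" using y unfolding cone by simp
      moreover have "lin ?b y = x" unfolding lin[OF yc] \<open>r1 y = y1\<close> \<open>r2 y = y2\<close> y(2) y(4)
        by (auto simp: fun_eq_iff split: sum.splits)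
      ultimately show "x \<in> lin ?b ` cone ?K" by blast
    qed
  qed
  then show ?thesis using fsc by (simp add: complete_fan_def)
qed

section \<open>Arcs on a cycle\<close>

text \<open>For \<open>i = j\<close> the arc is the whole cycle.\<close>

definition arc :: "nat \<Rightarrow> nat \<Rightarrow> nat \<Rightarrow> nat set" where
  "arc k i j = {t. t < k \<and> (if i < j then i \<le> t \<and> t < j else i \<le> t \<or> t < j)}"

text \<open>Cut \<open>j\<close> lies just before edge \<open>j\<close>. An edge that precedes all
  cuts belongs to the largest one, by wrapping around.\<close>

definition last_cut :: "nat set \<Rightarrow> nat \<Rightarrow> nat" where
  "last_cut J t = (if \<exists>j\<in>J. j \<le> t then Max {j \<in> J. j \<le> t} else Max J)"

definition part :: "nat \<Rightarrow> nat set \<Rightarrow> nat \<Rightarrow> nat set" where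
  "part k J j = {t. t < k \<and> last_cut J t = j}"

lemma arc_compl: "i \<noteq> j \<Longrightarrow> i < k \<Longrightarrow> j < k \<Longrightarrow> arc k j i = {..<k} - arc k i j"
  by (auto simp: arc_def split: if_splits)

lemma arc_subset: "arc k i j \<subseteq> {..<k}"
  by (auto simp: arc_def)

lemma arc_full: "i < k \<Longrightarrow> arc k i i = {..<k}"
  by (auto simp: arc_def)

lemma arc_Suc: "i < k \<Longrightarrow> t < k \<Longrightarrow> t \<noteq> i \<Longrightarrow> arc k i (Suc t mod k) = insert t (arc k i t)"
  by (cases "Suc t = k") (auto simp: arc_def)

lemma arc_init: "i < k \<Longrightarrow> 2 \<le> k \<Longrightarrow> arc k i (Suc i mod k) = {i}"
  by (cases "Suc i = k") (auto simp: arc_def)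

lemma last_cut_in: "finite J \<Longrightarrow> J \<noteq> {} \<Longrightarrow> last_cut J t \<in> J"
  unfolding last_cut_def using Max_in[of J] Max_in[of "{j \<in> J. j \<le> t}"] by auto

lemma last_cut_eq_iff:
  assumes "finite J" "j \<in> J"
  shows "last_cut J t = j \<longleftrightarrow>
    (j \<le> t \<and> (\<forall>i\<in>J. i \<le> t \<longrightarrow> i \<le> j)) \<or> ((\<forall>i\<in>J. t < i) \<and> (\<forall>i\<in>J. i \<le> j))"
proof (cases "\<exists>j\<in>J. j \<le> t")
  case True
  then have "{j \<in> J. j \<le> t} \<noteq> {}" "finite {j \<in> J. j \<le> t}" using assms by auto
  from Max_eq_iff[OF this(2,1), of j]
  have "last_cut J t = j \<longleftrightarrow> j \<in> {j \<in> J. j \<le> t} \<and> (\<forall>i\<in>{j \<in> J. j \<le> t}. i \<le> j)"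
    using True by (simp add: last_cut_def)
  then show ?thesis using True assms by (auto simp: not_less)
next
  case False
  then have "last_cut J t = j \<longleftrightarrow> (\<forall>i\<in>J. i \<le> j)"
    unfolding last_cut_def using assms Max_eq_iff[of J j] by auto
  then show ?thesis using False assms by (auto simp: not_le)
qed

text \<open>\<open>j'\<close> is the cyclic successor of \<open>j\<close> in \<open>J\<close>: the
  least larger cut, or \<open>Min J\<close> if there is none.\<close>

lemma part_is_arc:
  assumes J: "J \<subseteq> {..<k}" "j \<in> J"
  obtains j' where "j' \<in> J" "part k J j = arc k j j'" "j' = j \<Longrightarrow> J = {j}"
    "\<And>i. i \<in> J \<Longrightarrow> i \<in> arc k j j' \<Longrightarrow> i = j"
proof (cases "\<exists>i\<in>J. j < i")
  case True
  have fin: "finite J" using J finite_subset by blast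
  define j' where "j' = Min {i \<in> J. j < i}"
  have "j' \<in> {i \<in> J. j < i}" unfolding j'_def using fin True by (intro Min_in) auto
  then have j': "j' \<in> J" "j < j'" by auto
  have le: "j' \<le> i" if "i \<in> J" "j < i" for i
    unfolding j'_def using fin that by (intro Min_le) auto
  have "part k J j = arc k j j'"
    unfolding part_def arc_def using J j' le fin
    by (auto simp: last_cut_eq_iff not_less not_le) (metis leD leI le_trans nless_le)+
  moreover have "i = j" if "i \<in> J" "i \<in> arc k j j'" for i
    using that le[OF that(1)] j' by (cases "j < i") (auto simp: arc_def)
  ultimately show ?thesis using that j' by blast
next
  case False
  have fin: "finite J" using J finite_subset by blast
  define j' where "j' = Min J"
  have j': "j' \<in> J" unfolding j'_def using fin J by (intro Min_in) auto
  have le: "j' \<le> i" if "i \<in> J" for i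
    unfolding j'_def using fin that by (intro Min_le) auto
  have ge: "i \<le> j" if "i \<in> J" for i using False that by (simp add: not_less)
  have p1: "part k J j = arc k j j'"
    unfolding part_def arc_def using J j' le ge fin
    by (auto simp: last_cut_eq_iff not_less not_le) (metis leD leI le_trans nless_le)+
  have p2: "i = j" if "i \<in> J" "i \<in> arc k j j'" for i
    using that le[OF that(1)] ge[OF that(1)] ge[OF j'] by (auto simp: arc_def)
  have p3: "J = {j}" if "j' = j"
  proof -
    have "i = j" if "i \<in> J" for i using le[OF that] ge[OF that] \<open>j' = j\<close> by simp
    then show ?thesis using J by blast
  qed
  show ?thesis by (rule that[OF j' p1 p3 p2])
qed

text \<open>Walk from \<open>j\<close> to the edge \<open>t\<close>, where \<open>j\<close> and
  \<open>t\<close> belong to the arc from \<open>a\<close> to \<open>b\<close>: the walk either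
  stays on this arc or passes \<open>b\<close> and then covers the whole complementary arc.\<close>

lemma arc_dichotomy:
  assumes "a < k" "b < k" "a \<noteq> b" "t \<noteq> j" "t \<in> arc k a b" "j \<in> arc k a b \<or> j = b"
  shows "insert t (arc k j t) \<subseteq> arc k a b \<or> arc k b a \<subseteq> arc k j t"
proof (cases "a < b")
  case True
  then show ?thesis using assms by (cases "j < t") (auto simp: arc_def)
next
  case False
  then have "b < a" using assms by simp
  then show ?thesis using assms
    by (cases "j < t"; cases "a \<le> j"; cases "a \<le> t") (auto simp: arc_def)
qed

section \<open>The tournament of short arcs\<close>

locale short_arcs =
  fixes k :: nat and F :: "nat set set"
  assumes pos: "0 < k"
    and singleton: "\<And>i. i < k \<Longrightarrow> {i} \<in> F"
    and down: "\<And>S T. S \<in> F \<Longrightarrow> T \<subseteq> S \<Longrightarrow> T \<in> F"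
    and compl: "\<And>S. S \<subseteq> {..<k} \<Longrightarrow> S \<in> F \<longleftrightarrow> {..<k} - S \<notin> F"
begin

definition beats :: "nat \<Rightarrow> nat \<Rightarrow> bool" where
  "beats i j \<longleftrightarrow> arc k i j \<in> F"

lemma full: "{..<k} \<notin> F"
  using compl[of "{}"] down[OF singleton[OF pos], of "{}"] by simp

lemma k_ge_3: "3 \<le> k"
proof (rule ccontr)
  assume "\<not> 3 \<le> k"
  then have "k = 1 \<or> k = 2" using pos by auto
  then show False
  proof
    assume "k = 1"
    then show False using full singleton[of 0] by (simp add: lessThan_Suc)
  next
    assume k: "k = 2"
    then have "{..<k} - {0} = {1}" by auto
    then show False using compl[of "{0}"] singleton[of 0] singleton[of 1] k by simp
  qed
qed

lemma beats_irrefl: "i < k \<Longrightarrow> \<not> beats i i"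
  by (simp add: beats_def arc_full full)

text \<open>The two arcs between distinct cuts are complementary, so exactly one is short:
  \<open>beats\<close> is a tournament.\<close>

lemma beats_asym: "i \<noteq> j \<Longrightarrow> i < k \<Longrightarrow> j < k \<Longrightarrow> beats i j \<longleftrightarrow> \<not> beats j i"
  unfolding beats_def using compl[OF arc_subset, of i j] arc_compl[of i j k] by simp

definition admissible :: "nat set \<Rightarrow> bool" where
  "admissible J \<longleftrightarrow> J \<subseteq> {..<k} \<and> J \<noteq> {} \<and> (\<forall>j\<in>J. part k J j \<in> F)"

definition triangle :: "nat \<Rightarrow> nat \<Rightarrow> nat \<Rightarrow> bool" where
  "triangle a b c \<longleftrightarrow> a < k \<and> b < k \<and> c < k \<and> beats a b \<and> beats b c \<and> beats c a"

text \<open>Take the cut \<open>j\<close> of \<open>J\<close> that is beaten by the most cuts of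
  \<open>J\<close>. Its part is short, so it beats the next cut \<open>j'\<close>. Without a cyclic
  triangle everything that beats \<open>j\<close> also beats \<open>j'\<close>, and so does
  \<open>j\<close> itself, so \<open>j'\<close> is beaten by more cuts.\<close>

lemma admissible_has_triangle:
  assumes J: "admissible J"
  shows "\<exists>a\<in>J. \<exists>b\<in>J. \<exists>c\<in>J. triangle a b c"
proof (rule ccontr)
  assume no: "\<not> ?thesis"
  have Jk: "J \<subseteq> {..<k}" "J \<noteq> {}" using J by (auto simp: admissible_def)
  have fin: "finite J" using Jk finite_subset by blast
  define N where "N j = card {i \<in> J. beats i j}" for j
  have "Max (N ` J) \<in> N ` J" using fin Jk(2) by (intro Max_in) auto
  then obtain j where j0: "j \<in> J" "N j = Max (N ` J)" by auto
  have j: "j \<in> J" "\<And>i. i \<in> J \<Longrightarrow> N i \<le> N j" unfolding j0(2) using fin j0(1) by auto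
  obtain j' where j': "j' \<in> J" "part k J j = arc k j j'"
    by (rule part_is_arc[OF Jk(1) j(1)]) (rule that, assumption+)
  have jj': "beats j j'" using J j(1) j' by (auto simp: admissible_def beats_def)
  then have ne: "j \<noteq> j'" using beats_irrefl j(1) Jk by auto
  have "insert j {i \<in> J. beats i j} \<subseteq> {i \<in> J. beats i j'}"
  proof
    fix i assume "i \<in> insert j {i \<in> J. beats i j}"
    then consider "i = j" | "i \<in> J" "beats i j" by auto
    then show "i \<in> {i \<in> J. beats i j'}"
    proof cases
      case 2
      have "i \<noteq> j'" using 2 beats_asym[of j j'] jj' ne j j' Jk by auto
      moreover have "\<not> beats j' i"
        using no 2 jj' j(1) j'(1) Jk unfolding triangle_def by blast
      ultimately show ?thesis using beats_asym[of i j'] 2 j' Jk by auto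
    qed (use j jj' in auto)
  qed
  then have "card (insert j {i \<in> J. beats i j}) \<le> N j'"
    unfolding N_def using fin by (intro card_mono) auto
  moreover have "j \<notin> {i \<in> J. beats i j}" using beats_irrefl j(1) Jk by auto
  ultimately have "N j < N j'" using fin by (simp add: N_def)
  then show False using j(2)[OF j'(1)] by simp
qed

text \<open>If some part is long, the arc from its end \<open>j'\<close> round to its start
  \<open>j\<close> is short and passes all cuts of \<open>J\<close>, so along this arc an earlier
  cut always beats a later one. The tournament on \<open>J\<close> is then a linear order and has no
  cyclic triangle.\<close>

lemma triangle_admissible:
  assumes J: "J \<subseteq> {..<k}" and abc: "a \<in> J" "b \<in> J" "c \<in> J" "triangle a b c"
  shows "admissible J"
proof (rule ccontr)
  assume "\<not> admissible J"
  then obtain j where j: "j \<in> J" "part k J j \<notin> F" using J abc(1) by (auto simp: admissible_def)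
  obtain j' where j': "j' \<in> J" "part k J j = arc k j j'" "j' = j \<Longrightarrow> J = {j}"
    "\<And>i. i \<in> J \<Longrightarrow> i \<in> arc k j j' \<Longrightarrow> i = j"
    by (rule part_is_arc[OF J j(1)]) (rule that, assumption+)
  have jk: "j < k" "j' < k" using j j' J by auto
  have ne: "j' \<noteq> j" using abc j'(3) beats_irrefl[OF jk(1)] unfolding triangle_def by auto
  have short: "arc k j' j \<in> F" using beats_asym[of j j'] ne j jk j'(2) by (simp add: beats_def)
  \<comment> \<open>Position along the arc that starts at \<open>j'\<close>: cuts below
    \<open>j'\<close> come after the wrap and get \<open>k\<close> added.\<close>
  define p where "p i = (if i < j' then i + k else i)" for i
  have before: "beats i l" if il: "i \<in> J" "l \<in> J" "p i < p l" for i l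
  proof -
    have "i < k" "l < k" using il J by auto
    then have "arc k i l \<subseteq> arc k j' j"
      using il(3) j'(4)[OF il(1)] j'(4)[OF il(2)] ne jk unfolding arc_def p_def
      by (cases "j \<le> l") (auto split: if_splits)
    then show ?thesis using down[OF short] by (auto simp: beats_def)
  qed
  have pinj: "p i \<noteq> p l" if "i < k" "l < k" "i \<noteq> l" for i l
    using that by (auto simp: p_def split: if_splits)
  have mono: "p i < p l" if il: "i \<in> J" "l \<in> J" "beats i l" for i l
  proof -
    have k: "i < k" "l < k" using il J by auto
    have ne: "i \<noteq> l" using beats_irrefl k il by auto
    then have "\<not> p l < p i" using before[of l i] beats_asym[of i l] il k by auto
    then show ?thesis using pinj[OF k ne] by simp
  qed
  show False using mono[of a b] mono[of b c] mono[of c a] abc by (auto simp: triangle_def)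
qed

lemma admissible_iff:
  "admissible J \<longleftrightarrow> J \<subseteq> {..<k} \<and> (\<exists>a\<in>J. \<exists>b\<in>J. \<exists>c\<in>J. triangle a b c)"
  using admissible_has_triangle triangle_admissible by (auto simp: admissible_def)

lemma triangle_exists: "\<exists>a b c. triangle a b c"
proof -
  have "part k {..<k} j = {j}" if "j < k" for j
    using that by (auto simp: part_def last_cut_eq_iff)
  then have "admissible {..<k}" using singleton pos by (auto simp: admissible_def)
  then show ?thesis using admissible_has_triangle by blast
qed

lemma triangle_distinct: "triangle a b c \<Longrightarrow> a \<noteq> b \<and> b \<noteq> c \<and> c \<noteq> a"
  using beats_irrefl by (auto simp: triangle_def)

section \<open>Realisation by lengths\<close>

text \<open>The arcs from \<open>j\<close> grow edge by edge from a single edge, which is short, to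
  the complement of a single edge, which is long, so at some edge they turn long.\<close>

lemma antipodal_edge:
  assumes j: "j < k"
  shows "\<exists>t<k. t \<noteq> j \<and> arc k j t \<in> F \<and> arc k j (Suc t mod k) \<notin> F"
proof (rule ccontr)
  assume no: "\<not> ?thesis"
  have "arc k j ((j + Suc m) mod k) \<in> F" if "Suc m < k" for m
    using that
  proof (induction m)
    case 0
    then show ?case using arc_init[OF j] singleton[OF j] k_ge_3 by simp
  next
    case (Suc m)
    let ?t = "(j + Suc m) mod k"
    have "arc k j ?t \<in> F" using Suc by simp
    moreover have "?t \<noteq> j" "?t < k" using Suc.prems j by (auto simp: mod_if)
    ultimately have "arc k j (Suc ?t mod k) \<in> F" using no by blast
    then show ?case by (simp add: mod_Suc_eq)
  qed
  from this[of "k - 2"] have "arc k j ((j + (k - 1)) mod k) \<in> F" using k_ge_3 by (simp add: Suc_diff_Suc numeral_2_eq_2)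
  moreover define i where "i = (j + (k - 1)) mod k"
  ultimately have F: "arc k j i \<in> F" by simp
  have i: "i < k" "i \<noteq> j" "Suc i mod k = j"
    using j k_ge_3 by (auto simp: i_def mod_if mod_Suc)
  then have "arc k i j = {i}" using arc_init[OF i(1)] k_ge_3 by simp
  then have "beats i j" using singleton i by (simp add: beats_def)
  moreover have "beats j i" using F by (simp add: beats_def)
  ultimately show False using beats_asym i j by blast
qed

definition antipode :: "nat \<Rightarrow> nat" where
  "antipode j = (SOME t. t < k \<and> t \<noteq> j \<and> arc k j t \<in> F \<and> arc k j (Suc t mod k) \<notin> F)"

lemma antipode:
  assumes "j < k"
  shows "antipode j < k" "antipode j \<noteq> j" "arc k j (antipode j) \<in> F" "arc k j (Suc (antipode j) mod k) \<notin> F"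
  using someI_ex[OF antipodal_edge[OF assms, unfolded Bex_def]] unfolding antipode_def by auto

definition weight :: "nat set \<Rightarrow> nat" where
  "weight S = card S + card {j \<in> {..<k}. antipode j \<in> S}"

lemma weight_compl:
  assumes "S \<subseteq> {..<k}"
  shows "weight S + weight ({..<k} - S) = 2 * k"
proof -
  have "{j \<in> {..<k}. antipode j \<in> S} \<union> {j \<in> {..<k}. antipode j \<in> {..<k} - S} = {..<k}"
    using antipode by auto
  moreover have "{j \<in> {..<k}. antipode j \<in> S} \<inter> {j \<in> {..<k}. antipode j \<in> {..<k} - S} = {}" by auto
  ultimately have "card {j \<in> {..<k}. antipode j \<in> S} + card {j \<in> {..<k}. antipode j \<in> {..<k} - S} = k"
    using card_Un_disjoint[of "{j \<in> {..<k}. antipode j \<in> S}" "{j \<in> {..<k}. antipode j \<in> {..<k} - S}"] by simp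
  moreover have "card S + card ({..<k} - S) = k"
    using card_Diff_subset[OF finite_subset[OF assms] assms] card_mono[OF _ assms] by simp
  ultimately show ?thesis by (simp add: weight_def)
qed

text \<open>The origin of the lengths: the total weight is \<open>2 * k\<close>, so a short arc A
  must weigh less than \<open>k\<close>. If the antipodal edge of a cut \<open>j\<close> lies on A,
  then \<open>j\<close> is neither in A nor its end \<open>b\<close>: otherwise
  \<open>arc_dichotomy\<close> puts a long arc inside A, or the long complement of A inside a short
  arc. So at most k - |A| - 1 cuts have their antipode on A, and adding |A| stays below
  \<open>k\<close>.\<close>

lemma weight_short_arc:
  assumes ab: "a < k" "b < k" "a \<noteq> b" and short: "arc k a b \<in> F"
  shows "weight (arc k a b) < k"
proof -
  let ?A = "arc k a b"
  have long: "arc k b a \<notin> F" using beats_asym[OF ab(3,1,2)] short by (auto simp: beats_def)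
  have out: "j \<notin> ?A \<and> j \<noteq> b" if j: "j < k" and e: "antipode j \<in> ?A" for j
  proof (rule ccontr)
    let ?t = "antipode j"
    assume "\<not> (j \<notin> ?A \<and> j \<noteq> b)"
    then have "insert ?t (arc k j ?t) \<subseteq> ?A \<or> arc k b a \<subseteq> arc k j ?t"
      using arc_dichotomy[OF ab antipode(2)[OF j] e] by blast
    then show False
      using antipode[OF j] down[OF short] down[OF antipode(3)[OF j]] long arc_Suc[OF j antipode(1,2)[OF j]]
      by auto
  qed
  have "b \<notin> ?A" using ab by (auto simp: arc_def)
  have "{j \<in> {..<k}. antipode j \<in> ?A} \<subseteq> {..<k} - insert b ?A" using out by auto
  then have "card {j \<in> {..<k}. antipode j \<in> ?A} \<le> card ({..<k} - insert b ?A)"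
    by (intro card_mono) auto
  also have "\<dots> = k - Suc (card ?A)"
    using ab arc_subset[of k a b] \<open>b \<notin> ?A\<close> finite_subset[OF arc_subset[of k a b]]
    by (subst card_Diff_subset) auto
  finally have "card {j \<in> {..<k}. antipode j \<in> ?A} \<le> k - Suc (card ?A)" .
  moreover have "card (insert b ?A) \<le> card {..<k}" using ab arc_subset by (intro card_mono) auto
  then have "Suc (card ?A) \<le> k" using \<open>b \<notin> ?A\<close> finite_subset[OF arc_subset[of k a b]] by simp
  ultimately show ?thesis by (simp add: weight_def)
qed

text \<open>The integral part makes exactly the arcs of \<open>F\<close> short; the fractional part makes the
  lengths generic.\<close>

definition len :: "nat \<Rightarrow> real" where
  "len t = 1 + real (card {j \<in> {..<k}. antipode j = t}) + 2 ^ t / 2 ^ Suc k"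

lemma len_pos: "0 < len t"
  by (simp add: len_def add_pos_nonneg)

lemma sum_len:
  assumes "S \<subseteq> {..<k}"
  shows "sum len S = real (weight S) + real (\<Sum>t\<in>S. 2 ^ t) / 2 ^ Suc k"
proof -
  have fin: "finite S" using assms finite_subset by blast
  have "(\<Sum>t\<in>S. card {j \<in> {..<k}. antipode j = t}) = card (\<Union>t\<in>S. {j \<in> {..<k}. antipode j = t})"
    using fin by (intro card_UN_disjoint[symmetric]) auto
  also have "(\<Union>t\<in>S. {j \<in> {..<k}. antipode j = t}) = {j \<in> {..<k}. antipode j \<in> S}" by auto
  finally have "(\<Sum>t\<in>S. real (card {j \<in> {..<k}. antipode j = t})) = card {j \<in> {..<k}. antipode j \<in> S}"
    unfolding of_nat_sum[symmetric] by (rule arg_cong)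
  moreover have "sum len S = (\<Sum>t\<in>S. 1) + (\<Sum>t\<in>S. real (card {j \<in> {..<k}. antipode j = t})) + (\<Sum>t\<in>S. 2 ^ t / 2 ^ Suc k)"
    unfolding len_def sum.distrib ..
  moreover have "(\<Sum>t\<in>S. 2 ^ t / 2 ^ Suc k :: real) = real (\<Sum>t\<in>S. 2 ^ t) / 2 ^ Suc k"
    by (simp only: sum_divide_distrib of_nat_sum of_nat_power of_nat_numeral)
  ultimately show ?thesis by (simp add: weight_def)
qed

lemma sum_powers: "(\<Sum>t\<in>S. 2 ^ t) + (\<Sum>t\<in>{..<k} - S. 2 ^ t) = 2 ^ k - (1::nat)" if "S \<subseteq> {..<k}"
  using sum.subset_diff[OF that, of "\<lambda>t. 2 ^ t :: nat"] by (simp add: sum_power2 lessThan_atLeast0)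

lemma frac_bounds:
  assumes "S \<subseteq> {..<k}"
  shows "0 \<le> real (\<Sum>t\<in>S. 2 ^ t) / 2 ^ Suc k" "real (\<Sum>t\<in>S. 2 ^ t) / 2 ^ Suc k < 1 / 2"
proof -
  have "(\<Sum>t\<in>S. 2 ^ t) < (2 ^ k :: nat)" using sum_powers[OF assms] by (metis add_lessD1 diff_less less_numeral_extra(1) pos2 zero_less_power)
  then have "real (\<Sum>t\<in>S. 2 ^ t) < 2 ^ k" by (metis of_nat_less_iff of_nat_numeral of_nat_power)
  then show "real (\<Sum>t\<in>S. 2 ^ t) / 2 ^ Suc k < 1 / 2" by (simp add: field_simps)
  show "0 \<le> real (\<Sum>t\<in>S. 2 ^ t) / 2 ^ Suc k" by (intro divide_nonneg_pos of_nat_0_le_iff) simp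
qed

text \<open>Weights are integers and the fractional parts lie in [0, 1/2), so equal sums force equal
  fractional parts. But the numerators for \<open>S\<close> and its complement add up to the odd
  number \<open>2 ^ k - 1\<close>.\<close>

lemma len_generic:
  assumes S: "S \<subseteq> {..<k}"
  shows "sum len S \<noteq> sum len ({..<k} - S)"
proof
  assume eq: "sum len S = sum len ({..<k} - S)"
  have S': "{..<k} - S \<subseteq> {..<k}" by auto
  let ?f = "\<lambda>S. real (\<Sum>t\<in>S. 2 ^ t) / 2 ^ Suc k"
  have e: "real (weight S) + ?f S = real (weight ({..<k} - S)) + ?f ({..<k} - S)"
    using eq sum_len[OF S] sum_len[OF S'] by simp
  have b: "0 \<le> ?f S" "?f S < 1 / 2" "0 \<le> ?f ({..<k} - S)" "?f ({..<k} - S) < 1 / 2"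
    using frac_bounds[OF S] frac_bounds[OF S'] by blast+
  have "real (weight S) < real (Suc (weight ({..<k} - S)))" "real (weight ({..<k} - S)) < real (Suc (weight S))"
    using e b unfolding of_nat_Suc by linarith+
  then have "weight S = weight ({..<k} - S)" unfolding of_nat_less_iff by simp
  then have "?f S = ?f ({..<k} - S)" using e by linarith
  then have "real (\<Sum>t\<in>S. 2 ^ t) = real (\<Sum>t\<in>{..<k} - S. 2 ^ t)" by simp
  then have "(\<Sum>t\<in>S. 2 ^ t) = (\<Sum>t\<in>{..<k} - S. 2 ^ t :: nat)" by (simp only: of_nat_eq_iff)
  then have "even (2 ^ k - (1::nat))" using sum_powers[OF S] by (metis dvd_triv_left mult_2)
  then show False using pos by simp
qed

text \<open>The weight gap between a short arc and its complement is at least one, more than the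
  fractional parts can offset; the converse is the same statement for the complementary arc.\<close>

lemma len_short_arc:
  assumes ab: "a < k" "b < k" "a \<noteq> b"
  shows "beats a b \<longleftrightarrow> sum len (arc k a b) < sum len ({..<k} - arc k a b)"
proof -
  have *: "sum len (arc k a b) < sum len ({..<k} - arc k a b)"
    if ab: "a < k" "b < k" "a \<noteq> b" and s: "beats a b" for a b
  proof -
    have S: "arc k a b \<subseteq> {..<k}" "{..<k} - arc k a b \<subseteq> {..<k}" using arc_subset by auto
    have "weight (arc k a b) < k" using weight_short_arc ab s by (simp add: beats_def)
    moreover have "weight (arc k a b) + weight ({..<k} - arc k a b) = 2 * k" by (rule weight_compl[OF S(1)])
    ultimately have "real (weight (arc k a b)) + 1 \<le> real (weight ({..<k} - arc k a b))" by linarith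
    then show ?thesis using sum_len[OF S(1)] sum_len[OF S(2)] frac_bounds[OF S(1)] frac_bounds[OF S(2)] by linarith
  qed
  have "{..<k} - arc k b a = arc k a b" using arc_compl[of b a k] ab by simp
  then show ?thesis using *[OF ab] *[OF ab(2,1)] beats_asym[OF ab(3,1,2)] arc_compl[OF ab(3,1,2)] ab(3)
    by (metis less_asym)
qed

end

section \<open>The Gale dual fan\<close>

context short_arcs
begin

definition angle :: "nat \<Rightarrow> real" where
  "angle i = sum len {..<i}"

definition half :: real where
  "half = sum len {..<k} / 2"

text \<open>The vectors \<open>(gx i, gy i)\<close> in the plane are directed like the cut points on a circle whose
  arcs have the lengths \<open>len\<close>: slopes replace angles, and cuts in the second half are antipodes.\<close>

definition gx :: "nat \<Rightarrow> real" where
  "gx i = (if angle i < half then 1 else -1)"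

definition gy :: "nat \<Rightarrow> real" where
  "gy i = gx i * (if angle i < half then angle i else angle i - half)"

text \<open>The cross product of two of the vectors, positive when the second lies within half a
  turn counterclockwise of the first.\<close>

definition gdet :: "nat \<Rightarrow> nat \<Rightarrow> real" where
  "gdet i j = gx i * gy j - gx j * gy i"

lemma gdet_swap: "gdet j i = - gdet i j"
  by (simp add: gdet_def)

text \<open>On one side of the diameter the determinant is the difference of the angles; across it,
  it is \<open>half\<close> minus this difference. Genericity excludes arcs of length exactly
  \<open>half\<close>.\<close>

lemma gdet_aux:
  assumes ij: "i < j" "j < k"
  shows "(0 < gdet i j \<longleftrightarrow> beats i j) \<and> gdet i j \<noteq> 0"
proof -
  have arc: "arc k i j = {i..<j}" using ij by (auto simp: arc_def)
  have s: "sum len {i..<j} = angle j - angle i"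
    unfolding angle_def using ij sum.atLeastLessThan_concat[of 0 i j len]
    by (simp add: lessThan_atLeast0)
  have sub: "{i..<j} \<subseteq> {..<k}" using ij by auto
  have c: "sum len ({..<k} - {i..<j}) = 2 * half - (angle j - angle i)"
    using sum.subset_diff[OF sub, of len] s unfolding half_def by (simp only: field_simps) simp
  have b: "beats i j \<longleftrightarrow> angle j - angle i < half"
    using len_short_arc[of i j] ij arc s c by auto
  have ne: "angle j - angle i \<noteq> half"
    using len_generic[OF sub] s c by simp
  have a0: "0 \<le> angle i" unfolding angle_def by (intro sum_nonneg less_imp_le len_pos)
  have aij: "angle i < angle j"
    using s ij len_pos sum_pos[of "{i..<j}" len] by auto
  have "0 < sum len {j..<k}" using ij len_pos by (intro sum_pos) auto
  then have ak: "angle j < 2 * half"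
    unfolding angle_def half_def using ij sum.atLeastLessThan_concat[of 0 j k len]
    by (simp add: lessThan_atLeast0)
  show ?thesis
    unfolding gdet_def gy_def gx_def b using a0 aij ak ne by (auto simp: field_simps)
qed

lemma gdet_pos_iff: "i \<noteq> j \<Longrightarrow> i < k \<Longrightarrow> j < k \<Longrightarrow> 0 < gdet i j \<longleftrightarrow> beats i j"
  using gdet_aux[of i j] gdet_aux[of j i] gdet_swap[of i j] beats_asym[of i j]
  by (cases "i < j") auto

lemma triangle_gdet:
  assumes "triangle a b c"
  shows "0 < gdet a b" "0 < gdet b c" "0 < gdet c a"
  using assms triangle_distinct[OF assms] gdet_pos_iff by (auto simp: triangle_def)

text \<open>Cramer's rule for three vectors of the plane. For a cyclic triangle all coefficients are
  positive, so the origin is interior to the triangle of the three points.\<close>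

lemma gdet_relation:
  "gdet b c * gx a + gdet c a * gx b + gdet a b * gx c = 0"
  "gdet b c * gy a + gdet c a * gy b + gdet a b * gy c = 0"
  by (auto simp: gdet_def algebra_simps)

lemma gdet_relation3: "gdet b c * gdet a m + gdet c a * gdet b m + gdet a b * gdet c m = 0"
  by (auto simp: gdet_def algebra_simps)

text \<open>The restriction of an affine function of the plane to the cut points; \<open>w\<close>
  is its value at the centre.\<close>

definition aff :: "real \<Rightarrow> real \<Rightarrow> real \<Rightarrow> nat \<Rightarrow> real" where
  "aff u v w i = u * gx i + v * gy i + w"

text \<open>By \<open>gdet_relation\<close> a positive combination of the three values is zero.
  Being nonpositive, they all vanish, and two of the points form a basis of the plane.\<close>

lemma triangle_nonpos:
  assumes t: "triangle a b c"
    and le: "\<And>i. i \<in> {a, b, c} \<Longrightarrow> u * gx i + v * gy i \<le> 0"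
  shows "u = 0 \<and> v = 0"
proof -
  define L where "L i = u * gx i + v * gy i" for i
  note d = triangle_gdet[OF t]
  have "gdet b c * L a + gdet c a * L b + gdet a b * L c =
    u * (gdet b c * gx a + gdet c a * gx b + gdet a b * gx c) +
    v * (gdet b c * gy a + gdet c a * gy b + gdet a b * gy c)"
    unfolding L_def by (simp add: algebra_simps)
  then have sum: "gdet b c * L a + gdet c a * L b + gdet a b * L c = 0"
    unfolding gdet_relation by simp
  have nn: "L a \<le> 0" "L b \<le> 0" "L c \<le> 0" using le by (auto simp: L_def)
  have "gdet b c * L a \<le> 0" "gdet c a * L b \<le> 0" "gdet a b * L c \<le> 0"
    using d nn by (auto intro: mult_nonneg_nonpos)
  then have "gdet b c * L a = 0" "gdet c a * L b = 0" using sum by linarith+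
  then have "L a = 0" "L b = 0" using d by auto
  then have z: "u * gx a + v * gy a = 0" "u * gx b + v * gy b = 0" by (auto simp: L_def)
  have "gdet a b * u = gy b * (u * gx a + v * gy a) - gy a * (u * gx b + v * gy b)"
    "gdet a b * v = gx a * (u * gx b + v * gy b) - gx b * (u * gx a + v * gy a)"
    by (auto simp: gdet_def algebra_simps)
  then have "gdet a b * u = 0" "gdet a b * v = 0" unfolding z by simp_all
  then show ?thesis using d by simp
qed

lemma triangle_aff_nonpos:
  assumes t: "triangle a b c" and w: "0 \<le> w" and le: "\<And>i. i \<in> {a, b, c} \<Longrightarrow> aff u v w i \<le> 0"
  shows "u = 0 \<and> v = 0 \<and> w = 0"
proof -
  have "u = 0 \<and> v = 0" by (rule triangle_nonpos[OF t]) (use le w in \<open>force simp: aff_def\<close>)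
  then show ?thesis using le[of a] w by (simp add: aff_def)
qed

lemma aff_minus: "aff (- u) (- v) (- w) i = - aff u v w i"
  by (simp add: aff_def)

text \<open>The value at the centre of the affine function that agrees with \<open>y\<close> at the
  three points; the weights are the barycentric coordinates of the centre.\<close>

definition val :: "(nat \<Rightarrow> real) \<Rightarrow> nat \<Rightarrow> nat \<Rightarrow> nat \<Rightarrow> real" where
  "val y a b c = (gdet b c * y a + gdet c a * y b + gdet a b * y c) / (gdet b c + gdet c a + gdet a b)"

text \<open>Cramer's rule at \<open>a\<close> and \<open>b\<close> gives the linear part; the value
  at \<open>c\<close> then follows from \<open>gdet_relation\<close> and the choice of
  \<open>val\<close>.\<close>

lemma interpolate:
  assumes t: "triangle a b c"
  obtains u v where "\<And>i. i \<in> {a, b, c} \<Longrightarrow> aff u v (val y a b c) i = y i"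
proof -
  note d = triangle_gdet[OF t]
  define w where "w = val y a b c"
  define u where "u = ((y a - w) * gy b - (y b - w) * gy a) / gdet a b"
  define v where "v = (gx a * (y b - w) - gx b * (y a - w)) / gdet a b"
  have uv: "gdet a b * u = (y a - w) * gy b - (y b - w) * gy a"
    "gdet a b * v = gx a * (y b - w) - gx b * (y a - w)" using d by (auto simp: u_def v_def)
  have "gdet a b * (u * gx a + v * gy a) = gx a * (gdet a b * u) + gy a * (gdet a b * v)"
    by (simp add: algebra_simps)
  also have "\<dots> = gdet a b * (y a - w)" unfolding uv by (simp add: gdet_def algebra_simps)
  finally have a: "u * gx a + v * gy a = y a - w" using d by simp
  have "gdet a b * (u * gx b + v * gy b) = gx b * (gdet a b * u) + gy b * (gdet a b * v)"
    by (simp add: algebra_simps)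
  also have "\<dots> = gdet a b * (y b - w)" unfolding uv by (simp add: gdet_def algebra_simps)
  finally have b: "u * gx b + v * gy b = y b - w" using d by simp
  have "w * (gdet b c + gdet c a + gdet a b) = gdet b c * y a + gdet c a * y b + gdet a b * y c"
    using d by (simp add: w_def val_def)
  then have w: "gdet b c * (y a - w) + gdet c a * (y b - w) = - (gdet a b * (y c - w))"
    by (simp add: algebra_simps)
  have "gdet a b * (u * gx c + v * gy c) = u * (gdet a b * gx c) + v * (gdet a b * gy c)"
    by (simp add: algebra_simps)
  also have "gdet a b * gx c = - (gdet b c * gx a + gdet c a * gx b)" using gdet_relation(1)[of b c a] by linarith
  also have "gdet a b * gy c = - (gdet b c * gy a + gdet c a * gy b)" using gdet_relation(2)[of b c a] by linarith
  also have "u * - (gdet b c * gx a + gdet c a * gx b) + v * - (gdet b c * gy a + gdet c a * gy b) =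
      - (gdet b c * (u * gx a + v * gy a) + gdet c a * (u * gx b + v * gy b))" by (simp add: algebra_simps)
  also have "\<dots> = gdet a b * (y c - w)" unfolding a b w by simp
  finally have c: "u * gx c + v * gy c = y c - w" using d by simp
  show ?thesis by (rule that[of u v]) (use a b c in \<open>auto simp: aff_def w_def\<close>)
qed

lemma val_aff:
  assumes t: "triangle a b c"
  shows "val (aff u v w) a b c = w"
proof -
  note d = triangle_gdet[OF t]
  have "gdet b c * aff u v w a + gdet c a * aff u v w b + gdet a b * aff u v w c =
    u * (gdet b c * gx a + gdet c a * gx b + gdet a b * gx c) +
    v * (gdet b c * gy a + gdet c a * gy b + gdet a b * gy c) + w * (gdet b c + gdet c a + gdet a b)"
    by (simp add: aff_def algebra_simps)
  also have "\<dots> = w * (gdet b c + gdet c a + gdet a b)" unfolding gdet_relation by simp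
  finally show ?thesis using d by (simp add: val_def)
qed

text \<open>The centre has a positive barycentric coordinate at \<open>m\<close>, so lowering the
  value there lowers the value at the centre.\<close>

lemma val_improves:
  assumes t: "triangle m b c" and eq: "y b = aff u v w b" "y c = aff u v w c" and lt: "y m < aff u v w m"
  shows "val y m b c < w"
proof -
  note d = triangle_gdet[OF t]
  have "val y m b c < val (aff u v w) m b c"
    unfolding val_def using d eq lt by (intro divide_strict_right_mono) auto
  then show ?thesis using val_aff[OF t] by simp
qed

text \<open>If no exchange works, the tournament forces \<open>m\<close> to beat all three corners
  or to be beaten by all three, and then \<open>gdet_relation3\<close> is a vanishing sum of terms
  of equal strict sign.\<close>

lemma pivot:
  assumes t: "triangle a b c" and m: "m < k" "m \<notin> {a, b, c}"
  shows "triangle m b c \<or> triangle m c a \<or> triangle m a b"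
proof (rule ccontr)
  assume no: "\<not> ?thesis"
  have abc: "a < k" "b < k" "c < k" "beats a b" "beats b c" "beats c a"
    using t by (auto simp: triangle_def)
  note d = triangle_gdet[OF t]
  have asym: "beats m i \<longleftrightarrow> \<not> beats i m" if "i \<in> {a, b, c}" for i
    using beats_asym[of m i] that m abc by auto
  have pos: "0 < gdet i m \<longleftrightarrow> beats i m" "gdet i m < 0 \<longleftrightarrow> beats m i" if "i \<in> {a, b, c}" for i
    using gdet_pos_iff[of i m] gdet_pos_iff[of m i] gdet_swap[of i m] that m abc by auto
  have "(beats a m \<and> beats b m \<and> beats c m) \<or> (beats m a \<and> beats m b \<and> beats m c)"
    using no abc m asym[of a] asym[of b] asym[of c] by (auto simp: triangle_def)
  then show False
  proof
    assume "beats a m \<and> beats b m \<and> beats c m"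
    then have "0 < gdet b c * gdet a m" "0 < gdet c a * gdet b m" "0 < gdet a b * gdet c m"
      using pos d by auto
    then show False using gdet_relation3[of b c a m] by linarith
  next
    assume "beats m a \<and> beats m b \<and> beats m c"
    then have "gdet b c * gdet a m < 0" "gdet c a * gdet b m < 0" "gdet a b * gdet c m < 0"
      using pos d by (auto intro: mult_pos_neg)
    then show False using gdet_relation3[of b c a m] by linarith
  qed
qed

text \<open>Linear programming duality by pivoting: the triangle of least value supports the lower hull
  of \<open>y\<close>.\<close>

lemma supporting_triangle:
  obtains a b c u v w where "triangle a b c" "\<And>i. i \<in> {a, b, c} \<Longrightarrow> aff u v w i = y i"
    "\<And>i. i < k \<Longrightarrow> aff u v w i \<le> y i"
proof -
  define Tr where "Tr = {(a, b, c). triangle a b c}"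
  define vv where "vv = (\<lambda>(a, b, c). val y a b c)"
  have fin: "finite Tr"
    by (rule finite_subset[of _ "{..<k} \<times> {..<k} \<times> {..<k}"]) (auto simp: Tr_def triangle_def)
  have ne: "Tr \<noteq> {}" using triangle_exists by (auto simp: Tr_def)
  have "Min (vv ` Tr) \<in> vv ` Tr" using fin ne by (intro Min_in) auto
  then obtain a b c where t: "triangle a b c" and eq: "val y a b c = Min (vv ` Tr)"
    by (auto simp: Tr_def vv_def)
  have min: "val y a b c \<le> val y a' b' c'" if "triangle a' b' c'" for a' b' c'
  proof -
    have "vv (a', b', c') \<in> vv ` Tr" using that by (intro imageI) (simp add: Tr_def)
    then show ?thesis unfolding eq using fin by (simp add: vv_def)
  qed
  define w where "w = val y a b c"
  obtain u v where uv: "\<And>i. i \<in> {a, b, c} \<Longrightarrow> aff u v w i = y i"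
    using interpolate[OF t, of y] unfolding w_def by blast
  have "aff u v w m \<le> y m" if m: "m < k" for m
  proof (rule ccontr)
    assume "\<not> ?thesis"
    then have lt: "y m < aff u v w m" by simp
    then have nm: "m \<notin> {a, b, c}" using uv by fastforce
    have "\<not> triangle m b' c'" if "b' \<in> {a, b, c}" "c' \<in> {a, b, c}" for b' c'
      using val_improves[where y = y and u = u and v = v and w = w, OF _ uv[OF that(1), symmetric] uv[OF that(2), symmetric] lt]
        min[of m b' c'] by (fastforce simp: w_def)
    then show False using pivot[OF t m nm] by blast
  qed
  then show ?thesis using that[OF t uv] by blast
qed

text \<open>Complements are taken as in Gale duality: a face consists of the cuts where a function
  may be positive, and the admissible set is where it vanishes.\<close>

definition upper :: "nat set set" where
  "upper = {I. I \<subseteq> {..<k} \<and> admissible ({..<k} - I)}"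

lemma admissible_subset: "admissible J \<Longrightarrow> J \<subseteq> {..<k}"
  by (simp add: admissible_def)

lemma admissible_mono: "admissible J \<Longrightarrow> J \<subseteq> J' \<Longrightarrow> J' \<subseteq> {..<k} \<Longrightarrow> admissible J'"
  unfolding admissible_iff by blast

lemma admissible_full: "admissible {..<k}"
  using triangle_exists unfolding admissible_iff by (auto simp: triangle_def)

lemma cone_upper:
  "y \<in> cone upper \<longleftrightarrow> (\<forall>i. 0 \<le> y i) \<and> (\<forall>i. k \<le> i \<longrightarrow> y i = 0) \<and> admissible {i. i < k \<and> y i = 0}"
proof -
  have "{..<k} - supp y = {i. i < k \<and> y i = 0}" by auto
  then show ?thesis by (auto simp: cone_def upper_def not_le[symmetric])
qed

text \<open>At a triangle of zeros of \<open>y\<close> the difference equals \<open>- y'\<close> and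
  is nonpositive, so if its value \<open>w\<close> at the centre is nonnegative,
  \<open>triangle_aff_nonpos\<close> makes it vanish. For negative \<open>w\<close> the two
  functions are exchanged.\<close>

lemma upper_unique:
  assumes y: "y \<in> cone upper" "y' \<in> cone upper" and eq: "\<And>i. i < k \<Longrightarrow> y i - y' i = aff u v w i"
  shows "y = y'"
proof -
  have *: "\<forall>i<k. y i = y' i"
    if y: "y \<in> cone upper" "y' \<in> cone upper" and eq: "\<And>i. i < k \<Longrightarrow> y i - y' i = aff u v w i"
      and w: "0 \<le> w" for y y' u v w
  proof -
    obtain a b c where t: "triangle a b c" and z: "y a = 0" "y b = 0" "y c = 0"
      using y(1) unfolding cone_upper admissible_iff by auto
    have "0 \<le> y' i" for i using y(2) cone_upper by blast
    then have "u = 0 \<and> v = 0 \<and> w = 0"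
      using t z eq[symmetric] by (intro triangle_aff_nonpos[OF t w]) (auto simp: triangle_def)
    then show ?thesis using eq by (simp add: aff_def)
  qed
  have "\<forall>i<k. y i = y' i"
  proof (cases "0 \<le> w")
    case False
    have "\<forall>i<k. y' i = y i"
      by (rule *[OF y(2,1), of "- u" "- v" "- w"]) (use eq False in \<open>simp_all add: aff_minus flip: eq\<close>)
    then show ?thesis by simp
  qed (rule *[OF y eq])
  moreover have "y i = 0" "y' i = 0" if "k \<le> i" for i using y that cone_upper by auto
  ultimately show ?thesis by (metis ext not_le)
qed

text \<open>Subtracting the supporting affine function leaves zeros at the corners of a triangle,
  which make the zero set admissible.\<close>

lemma upper_exists:
  obtains z u v w where "z \<in> cone upper" "\<And>i. i < k \<Longrightarrow> z i = y i - aff u v w i"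
proof -
  obtain a b c u v w where *: "triangle a b c" "\<And>i. i \<in> {a, b, c} \<Longrightarrow> aff u v w i = y i"
    "\<And>i. i < k \<Longrightarrow> aff u v w i \<le> y i" by (rule supporting_triangle) (rule that, assumption+)
  define z where "z i = (if i < k then y i - aff u v w i else 0)" for i
  have "admissible {i. i < k \<and> z i = 0}"
    by (rule triangle_admissible[OF _ _ _ _ *(1)])
      (use *(1) *(2)[of a] *(2)[of b] *(2)[of c] in \<open>auto simp: z_def triangle_def\<close>)
  then have "z \<in> cone upper" using *(3) by (auto simp: cone_upper z_def)
  then show ?thesis by (rule that) (simp add: z_def)
qed

text \<open>The quotient by affine functions is realised linearly by making each function vanish at
  the corners of one fixed triangle; the remaining cuts are coordinates.\<close>

lemma upper_projection:
  assumes t: "triangle a b c"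
  obtains \<pi> :: "(nat \<Rightarrow> real) \<Rightarrow> nat \<Rightarrow> real" where "linear \<pi>"
    "bij_betw \<pi> (cone upper) (vec ({..<k} - {a, b, c}))"
proof -
  have "\<exists>u v w. \<forall>i\<in>{a, b, c}. aff u v w i = y i" for y
    by (rule interpolate[OF t, of y]) blast
  then obtain U V W where UVW: "\<And>y i. i \<in> {a, b, c} \<Longrightarrow> aff (U y) (V y) (W y) i = y i" by metis
  have k: "a < k" "b < k" "c < k" using t by (auto simp: triangle_def)
  have uniq: "u = 0 \<and> v = 0 \<and> w = 0" if z: "\<And>i. i \<in> {a, b, c} \<Longrightarrow> aff u v w i = 0" for u v w
    using triangle_aff_nonpos[OF t, of w u v] triangle_aff_nonpos[OF t, of "- w" "- u" "- v"] z
    by (cases "0 \<le> w") (auto simp: aff_minus)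
  have uniq2: "u = u' \<and> v = v' \<and> w = w'" if "\<And>i. i \<in> {a, b, c} \<Longrightarrow> aff u v w i = aff u' v' w' i" for u v w u' v' w'
    using uniq[of "u - u'" "v - v'" "w - w'"] that by (force simp: aff_def algebra_simps)
  define \<pi> where "\<pi> y i = (if i < k then y i - aff (U y) (V y) (W y) i else 0)" for y i
  have "linear \<pi>"
  proof (rule linearI)
    fix y z :: "nat \<Rightarrow> real"
    have "U (y + z) = U y + U z \<and> V (y + z) = V y + V z \<and> W (y + z) = W y + W z"
    proof (rule uniq2)
      fix i assume i: "i \<in> {a, b, c}"
      have "aff (U y + U z) (V y + V z) (W y + W z) i = aff (U y) (V y) (W y) i + aff (U z) (V z) (W z) i"
        by (simp add: aff_def algebra_simps)
      then show "aff (U (y + z)) (V (y + z)) (W (y + z)) i = aff (U y + U z) (V y + V z) (W y + W z) i"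
        using UVW[OF i] by simp
    qed
    then show "\<pi> (y + z) = \<pi> y + \<pi> z" by (auto simp: \<pi>_def aff_def fun_eq_iff algebra_simps)
  next
    fix r :: real and y :: "nat \<Rightarrow> real"
    have "U (r *\<^sub>R y) = r * U y \<and> V (r *\<^sub>R y) = r * V y \<and> W (r *\<^sub>R y) = r * W y"
    proof (rule uniq2)
      fix i assume i: "i \<in> {a, b, c}"
      have "aff (r * U y) (r * V y) (r * W y) i = r * aff (U y) (V y) (W y) i"
        by (simp add: aff_def algebra_simps)
      then show "aff (U (r *\<^sub>R y)) (V (r *\<^sub>R y)) (W (r *\<^sub>R y)) i = aff (r * U y) (r * V y) (r * W y) i"
        using UVW[OF i] by simp
    qed
    then show "\<pi> (r *\<^sub>R y) = r *\<^sub>R \<pi> y" by (auto simp: \<pi>_def aff_def fun_eq_iff algebra_simps)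
  qed
  moreover have "bij_betw \<pi> (cone upper) (vec ({..<k} - {a, b, c}))"
    unfolding bij_betw_def
  proof
    show "inj_on \<pi> (cone upper)"
    proof
      fix y y' assume y: "y \<in> cone upper" "y' \<in> cone upper" "\<pi> y = \<pi> y'"
      show "y = y'"
      proof (rule upper_unique[OF y(1,2)])
        show "y i - y' i = aff (U y - U y') (V y - V y') (W y - W y') i" if "i < k" for i
          using fun_cong[OF y(3), of i] that by (simp add: \<pi>_def aff_def algebra_simps)
      qed
    qed
    show "\<pi> ` cone upper = vec ({..<k} - {a, b, c})"
    proof (intro equalityI subsetI)
      fix x assume "x \<in> \<pi> ` cone upper"
      then show "x \<in> vec ({..<k} - {a, b, c})" using UVW by (auto simp: vec_def \<pi>_def)
    next
      fix x assume x: "x \<in> vec ({..<k} - {a, b, c})"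
      obtain z u v w where z: "z \<in> cone upper" "\<And>i. i < k \<Longrightarrow> z i = x i - aff u v w i"
        by (rule upper_exists) (rule that, assumption+)
      have "U z = - u \<and> V z = - v \<and> W z = - w"
      proof (rule uniq2)
        fix i assume i: "i \<in> {a, b, c}"
        then have "x i = 0" "i < k" using x k by (auto simp: vec_def)
        then show "aff (U z) (V z) (W z) i = aff (- u) (- v) (- w) i"
          using UVW[OF i, of z] z(2)[of i] by (simp add: aff_def)
      qed
      then have "\<pi> z i = x i" for i using z(2)[of i] x by (auto simp: \<pi>_def aff_def vec_def)
      then have "\<pi> z = x" by (rule ext)
      then show "x \<in> \<pi> ` cone upper" using z(1) by blast
    qed
  qed
  ultimately show ?thesis by (rule that)
qed

text \<open>\<open>D\<close> names the cells, later by \<open>merged xs\<close>, and reverses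
  inclusion of cut sets. \<open>cone upper\<close> need not be a subspace, so the greedy
  decomposition is carried out inside it and then transported by the linear projection.\<close>

theorem upper_fan:
  assumes le: "\<And>J J'. admissible J \<Longrightarrow> admissible J' \<Longrightarrow> le (D J) (D J') \<longleftrightarrow> J' \<subseteq> J"
  obtains S b where "S \<subseteq> {..<k}" "card S = k - 3"
    "complete_fan (vec S) (order_complex (D ` {J. admissible J \<and> J \<noteq> {..<k}}) le) b"
proof -
  let ?P = "D ` {J. admissible J \<and> J \<noteq> {..<k}}"
  have inj: "J = J'" if "admissible J" "admissible J'" "D J = D J'" for J J'
    using le[OF that(1,2)] le[OF that(2,1)] le[OF that(1,1)] le[OF that(2,2)] that(3) by auto
  define cut where "cut p = (SOME J. admissible J \<and> D J = p)" for p
  have cut: "cut (D J) = J" if "admissible J" for J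
  proof -
    have "admissible (cut (D J)) \<and> D (cut (D J)) = D J"
      unfolding cut_def by (rule someI[of _ J]) (use that in simp)
    then show ?thesis using inj that by blast
  qed
  define Z where "Z y = {i. i < k \<and> y i = 0}" for y :: "nat \<Rightarrow> real"
  \<comment> \<open>The sum of the unit rays of a face, that is, its barycentre up to
    scaling.\<close>
  define e where "e p i = (if i < k \<and> i \<notin> cut p then 1 else 0 :: real)" for p i
  have Z: "admissible (Z y)" if "y \<in> cone upper" for y using that by (simp add: cone_upper Z_def)
  have nn: "0 \<le> y i" if "y \<in> cone upper" for y i using that by (simp add: cone_upper)
  have Z_full: "Z y \<noteq> {..<k}" if "y \<in> cone upper" "y \<noteq> 0" for y
  proof
    assume "Z y = {..<k}"
    then have "y i = 0" for i using that(1) by (cases "i < k") (auto simp: Z_def cone_upper set_eq_iff)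
    then show False using that(2) by (auto simp: fun_eq_iff)
  qed
  interpret greedy ?P le "cone upper" "\<lambda>y. D (Z y)" e
  proof
    show "finite ?P"
      by (intro finite_imageI finite_subset[of "{J. admissible J \<and> J \<noteq> {..<k}}" "Pow {..<k}"])
        (use admissible_subset in blast, simp)
    show "le p p" if "p \<in> ?P" for p using that le by auto
    show "p = q" if "p \<in> ?P" "q \<in> ?P" "le p q" "le q p" for p q using that le by auto
    show "le p r" if "p \<in> ?P" "q \<in> ?P" "r \<in> ?P" "le p q" "le q r" for p q r using that le by auto
    show "0 \<in> cone upper"
      using admissible_full by (auto simp: cone_upper lessThan_def)
    show "D (Z y) \<in> ?P" if "y \<in> cone upper" "y \<noteq> 0" for y using Z Z_full that by blast
  next
    fix p y and t :: real
    assume p: "p \<in> ?P" and t: "t > 0" and y: "y \<in> cone upper" and bel: "y = 0 \<or> le (D (Z y)) p \<and> D (Z y) \<noteq> p"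
    obtain J where J: "admissible J" "J \<noteq> {..<k}" "p = D J" using p by blast
    have Jk: "J \<subseteq> {..<k}" using J by (simp add: admissible_def)
    have sub: "J \<subseteq> Z y"
      using bel le[OF Z[OF y] J(1)] J Jk by (auto simp: Z_def)
    let ?z = "y + t *\<^sub>R e p"
    have zi: "?z i = y i + (if i < k \<and> i \<notin> J then t else 0)" for i by (simp add: e_def J cut)
    have ZJ: "Z ?z = J"
    proof -
      have "?z i = 0 \<longleftrightarrow> i \<in> J" if "i < k" for i
        using sub nn[OF y, of i] t that unfolding zi Z_def by (auto simp: add_nonneg_eq_0_iff)
      then show ?thesis using Jk by (auto simp: Z_def)
    qed
    have "0 \<le> ?z i" for i unfolding zi using nn[OF y, of i] t by simp
    moreover have "?z i = 0" if "k \<le> i" for i unfolding zi using y that by (simp add: cone_upper)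
    moreover have "admissible {i. i < k \<and> ?z i = 0}" using ZJ J(1) by (simp only: Z_def)
    ultimately have "?z \<in> cone upper" unfolding cone_upper by blast
    have "?z \<noteq> 0"
    proof
      assume "?z = 0"
      then have "Z ?z = {..<k}" by (auto simp: Z_def)
      then show False using ZJ J by simp
    qed
    then show "?z \<in> cone upper \<and> ?z \<noteq> 0 \<and> D (Z ?z) = p"
      using \<open>?z \<in> cone upper\<close> arg_cong[OF ZJ, of D] J(3) by simp
  next
    fix y assume y: "y \<in> cone upper" "y \<noteq> 0"
    let ?Y = "{..<k} - Z y"
    have ne: "?Y \<noteq> {}" using Z_full[OF y] by (auto simp: Z_def)
    \<comment> \<open>The smallest nonzero coordinate: subtracting it from all nonzero ones keeps
      the function nonnegative and creates a new zero.\<close>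
    define t where "t = Min (y ` ?Y)"
    have "t \<in> y ` ?Y" unfolding t_def using ne by (intro Min_in) auto
    then obtain m where m: "m \<in> ?Y" "t = y m" by blast
    have t: "t > 0" using m nn[OF y(1), of m] by (auto simp: Z_def less_le)
    have tle: "t \<le> y i" if "i \<in> ?Y" for i unfolding t_def using that by (intro Min_le) auto
    let ?z = "y - t *\<^sub>R e (D (Z y))"
    have zi: "?z i = y i - (if i \<in> ?Y then t else 0)" for i by (simp add: e_def cut Z[OF y(1)])
    have "?z i = 0 \<and> i < k" if "i \<in> insert m (Z y)" for i
      unfolding zi using that m by (auto simp: Z_def)
    then have sub: "insert m (Z y) \<subseteq> Z ?z" unfolding Z_def by blast
    have "0 \<le> ?z i" for i unfolding zi using nn[OF y(1), of i] tle[of i] by simp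
    moreover have "?z i = 0" if "k \<le> i" for i unfolding zi using y(1) that by (simp add: cone_upper)
    moreover have "admissible (Z ?z)"
      by (rule admissible_mono[OF Z[OF y(1)]]) (use sub in \<open>auto simp: Z_def\<close>)
    ultimately have z: "?z \<in> cone upper" unfolding cone_upper Z_def[symmetric] by blast
    have "le (D (Z ?z)) (D (Z y))" using le[OF Z[OF z] Z[OF y(1)]] sub by simp
    moreover have "D (Z ?z) \<noteq> D (Z y)" using inj[OF Z[OF z] Z[OF y(1)]] sub m by blast
    ultimately show "\<exists>t>0. y - t *\<^sub>R e (D (Z y)) \<in> cone upper \<and> (y - t *\<^sub>R e (D (Z y)) = 0 \<or>
         le (D (Z (y - t *\<^sub>R e (D (Z y))))) (D (Z y)) \<and> D (Z (y - t *\<^sub>R e (D (Z y)))) \<noteq> D (Z y))"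
      using t z by blast
  qed
  obtain a b c where abc: "triangle a b c" using triangle_exists by blast
  obtain \<pi> :: "(nat \<Rightarrow> real) \<Rightarrow> nat \<Rightarrow> real" where \<pi>: "linear \<pi>"
    "bij_betw \<pi> (cone upper) (vec ({..<k} - {a, b, c}))" by (rule upper_projection[OF abc])
  let ?S = "{..<k} - {a, b, c}"
  have fan: "complete_fan (cone upper) (order_complex ?P le) e" by (rule complete_fan_order_complex)
  have "lin (\<pi> \<circ> e) = \<pi> \<circ> lin e"
    using \<pi>(1) by (auto simp: lin_def linear_sum linear_scale fun_eq_iff)
  then have "complete_fan (vec ?S) (order_complex ?P le) (\<pi> \<circ> e)"
    using fan \<pi>(2) bij_betw_trans[of "lin e" "cone (order_complex ?P le)" "cone upper" \<pi> "vec ?S"]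
    by (simp add: complete_fan_def)
  moreover have "card ?S = k - 3"
    using abc triangle_distinct[OF abc] by (subst card_Diff_subset) (auto simp: triangle_def)
  ultimately show ?thesis using that[of ?S] by blast
qed

end

section \<open>Coarsenings of a cyclically ordered partition\<close>

lemma cyclic_class_rotate [simp]: "cyclic_class (rotate i xs) = cyclic_class xs"
proof -
  have "\<exists>m. rotate j xs = rotate m (rotate i xs)" for j
  proof (cases "xs = []")
    case False
    \<comment> \<open>A rotation by \<open>i\<close> is undone by \<open>i * (length xs - 1)\<close>
      further steps.\<close>
    then have "j + i * (length xs - 1) + i = j + i * length xs" by (cases "length xs") auto
    then have "rotate (j + i * (length xs - 1)) (rotate i xs) = rotate (j + i * length xs) xs"
      by (simp only: rotate_rotate)
    also have "\<dots> = rotate j xs" by (subst (1 2) rotate_conv_mod) simp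
    finally show ?thesis by metis
  qed simp
  then show ?thesis unfolding cyclic_class_def by (auto simp: rotate_rotate)
qed

lemma cyclic_class_self: "xs \<in> cyclic_class xs"
  unfolding cyclic_class_def by (intro CollectI exI[of _ 0]) simp

lemma cyclic_class_eq_iff: "cyclic_class ys = cyclic_class xs \<longleftrightarrow> (\<exists>i. ys = rotate i xs)"
proof
  assume "cyclic_class ys = cyclic_class xs"
  then have "ys \<in> cyclic_class xs" using cyclic_class_self[of ys] by simp
  then show "\<exists>i. ys = rotate i xs" by (auto simp: cyclic_class_def)
qed auto

lemma cyclic_class_map: "cyclic_class ys = cyclic_class xs \<Longrightarrow> cyclic_class (map f ys) = cyclic_class (map f xs)"
  unfolding cyclic_class_eq_iff by (metis rotate_map)

lemma cyclic_class_append: "cyclic_class (xs @ ys) = cyclic_class (ys @ xs)"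
  by (metis rotate_append cyclic_class_rotate)

lemma cyclic_class_filter:
  assumes "cyclic_class ys = cyclic_class xs"
  shows "cyclic_class (filter P ys) = cyclic_class (filter P xs)"
proof -
  obtain i where "ys = rotate i xs" using assms cyclic_class_eq_iff by blast
  then have "ys = drop (i mod length xs) xs @ take (i mod length xs) xs" by (simp add: rotate_drop_take)
  then have "filter P ys = filter P (drop (i mod length xs) xs) @ filter P (take (i mod length xs) xs)" by simp
  then have "cyclic_class (filter P ys) = cyclic_class (filter P (take (i mod length xs) xs) @ filter P (drop (i mod length xs) xs))"
    by (simp add: cyclic_class_append)
  then show ?thesis by (simp flip: filter_append)
qed

lemma blocks_cyclic_class [simp]: "blocks (cyclic_class xs) = set xs"
  unfolding blocks_def cyclic_class_def by auto

definition block :: "nat set list \<Rightarrow> nat set \<Rightarrow> nat \<Rightarrow> nat set" where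
  "block xs J j = (\<Union>t\<in>part (length xs) J j. xs ! t)"

definition merged :: "nat set list \<Rightarrow> nat set \<Rightarrow> nat set list set" where
  "merged xs J = cyclic_class (map (block xs J) (sorted_list_of_set J))"

lemma part_full: "j < k \<Longrightarrow> part k {..<k} j = {j}"
  by (auto simp: part_def last_cut_eq_iff)

lemma merged_full: "merged xs {..<length xs} = cyclic_class xs"
proof -
  have "sorted_list_of_set {..<length xs} = [0..<length xs]" by (simp add: lessThan_atLeast0)
  then have "map (block xs {..<length xs}) (sorted_list_of_set {..<length xs}) = map (nth xs) [0..<length xs]"
    by (auto simp: block_def part_full)
  then show ?thesis by (simp add: merged_def map_nth)
qed

text \<open>The second alternative is the wrap-around, with \<open>a\<close> the largest and
  \<open>b\<close> the smallest cut.\<close>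

lemma rotated_sorted_consecutive:
  assumes fin: "finite J" and rot: "rotate i (sorted_list_of_set J) = a # b # r"
  shows "(a < b \<and> (\<forall>c\<in>J. c \<le> a \<or> b \<le> c)) \<or> (b < a \<and> (\<forall>c\<in>J. b \<le> c \<and> c \<le> a))"
proof -
  let ?L = "sorted_list_of_set J"
  define n where "n = i mod length ?L"
  have L: "sorted_wrt (<) ?L" "set ?L = J" using fin by (auto simp: strict_sorted_list_of_set)
  have dt: "drop n ?L @ take n ?L = a # b # r" using rot by (simp add: rotate_drop_take n_def)
  have tdL: "take n ?L @ drop n ?L = ?L" by simp
  show ?thesis
  proof (cases "drop n ?L")
    case Nil
    then have "?L = a # b # r" using dt tdL by simp
    then show ?thesis using L by (metis order_less_imp_le order_refl set_ConsD sorted_wrt.simps(2) list.set_intros(1))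
  next
    case (Cons a' u)
    then have [simp]: "a' = a" using dt by simp
    show ?thesis
    proof (cases u)
      case Nil
      then obtain v where "take n ?L = b # v" using dt Cons by simp
      then have "?L = b # v @ [a]" using tdL Cons Nil by simp
      moreover from this have "sorted_wrt (<) (b # v @ [a])" using L(1) by simp
      then have "b < a" "\<forall>c\<in>set v. b < c \<and> c < a" by (auto simp: sorted_wrt_append)
      moreover have "J = insert b (insert a (set v))" using L(2) calculation(1) by (metis list.simps(15) set_append append_Cons Un_insert_right append_Nil sup_bot_right list.set(1))
      ultimately show ?thesis by auto
    next
      case (Cons b' v)
      then have [simp]: "b' = b" using dt \<open>drop n ?L = a' # u\<close> by simp
      have Leq: "?L = take n ?L @ a # b # v" using tdL Cons \<open>drop n ?L = a' # u\<close> by simp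
      then have s: "sorted_wrt (<) (take n ?L @ a # b # v)" using L(1) by simp
      then have less: "a < b" "\<forall>c\<in>set (take n ?L). c < a" "\<forall>c\<in>set v. b < c"
        unfolding sorted_wrt_append by auto
      have "J = set (take n ?L) \<union> {a, b} \<union> set v" using L(2) arg_cong[OF Leq, of set] by auto
      moreover have "c \<le> a \<or> b \<le> c" if "c \<in> set (take n ?L) \<union> {a, b} \<union> set v" for c
        using that less by (auto intro: less_imp_le)
      ultimately show ?thesis using less(1) by blast
    qed
  qed
qed

text \<open>Removing \<open>b\<close> hands its part to \<open>a\<close>, the cut cyclically before
  it.\<close>

lemma last_cut_remove:
  assumes fin: "finite J" and ab: "a \<in> J" "b \<in> J" "a \<noteq> b"
    and cons: "(a < b \<and> (\<forall>c\<in>J. c \<le> a \<or> b \<le> c)) \<or> (b < a \<and> (\<forall>c\<in>J. b \<le> c \<and> c \<le> a))"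
  shows "last_cut (J - {b}) t = (if last_cut J t = b then a else last_cut J t)"
proof (cases "last_cut J t = b")
  case True
  then have "(b \<le> t \<and> (\<forall>i\<in>J. i \<le> t \<longrightarrow> i \<le> b)) \<or> ((\<forall>i\<in>J. t < i) \<and> (\<forall>i\<in>J. i \<le> b))"
    using last_cut_eq_iff[OF fin ab(2)] by blast
  then have "(a \<le> t \<and> (\<forall>i\<in>J - {b}. i \<le> t \<longrightarrow> i \<le> a)) \<or> ((\<forall>i\<in>J - {b}. t < i) \<and> (\<forall>i\<in>J - {b}. i \<le> a))"
  proof
    assume c: "b \<le> t \<and> (\<forall>i\<in>J. i \<le> t \<longrightarrow> i \<le> b)"
    from cons show ?thesis
    proof
      assume d: "a < b \<and> (\<forall>c\<in>J. c \<le> a \<or> b \<le> c)"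
      have "i \<le> a" if "i \<in> J - {b}" "i \<le> t" for i
        using c[THEN conjunct2, rule_format, of i] d[THEN conjunct2, rule_format, of i] that by auto
      then show ?thesis using c d by auto
    next
      assume d: "b < a \<and> (\<forall>c\<in>J. b \<le> c \<and> c \<le> a)"
      have "t < i" if "i \<in> J - {b}" for i
        using c[THEN conjunct2, rule_format, of i] d[THEN conjunct2, rule_format, of i] that by force
      then show ?thesis using d by auto
    qed
  next
    assume c: "(\<forall>i\<in>J. t < i) \<and> (\<forall>i\<in>J. i \<le> b)"
    have "i \<le> a" if "i \<in> J - {b}" for i
      using c[THEN conjunct2, rule_format, of i] c[THEN conjunct2, rule_format, of a] cons that ab by auto
    then show ?thesis using c by auto
  qed
  then have "last_cut (J - {b}) t = a"
    using last_cut_eq_iff[of "J - {b}" a t] fin ab by blast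
  then show ?thesis using True by simp
next
  case False
  define e where "e = last_cut J t"
  have e: "e \<in> J" "e \<noteq> b" using last_cut_in[OF fin] ab False by (auto simp: e_def)
  then have "(e \<le> t \<and> (\<forall>i\<in>J. i \<le> t \<longrightarrow> i \<le> e)) \<or> ((\<forall>i\<in>J. t < i) \<and> (\<forall>i\<in>J. i \<le> e))"
    using last_cut_eq_iff[OF fin e(1), of t] by (simp add: e_def)
  then have "last_cut (J - {b}) t = e"
    using last_cut_eq_iff[of "J - {b}" e t] fin e by auto
  then show ?thesis using False by (simp add: e_def)
qed

text \<open>The dictionary between partitions and cut sets: merging two consecutive blocks is the
  removal of the cut \<open>b\<close> between them.\<close>

lemma merged_remove:
  assumes fin: "finite J" and rot: "rotate i (sorted_list_of_set J) = a # b # r"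
  shows "cyclic_class ((block xs J a \<union> block xs J b) # map (block xs J) r) = merged xs (J - {b})"
proof -
  let ?L = "sorted_list_of_set J"
  have set: "set (a # b # r) = J" using rot fin by (metis set_rotate set_sorted_list_of_set)
  have dist: "distinct (a # b # r)" using rot by (metis distinct_rotate distinct_sorted_list_of_set)
  have ab: "a \<in> J" "b \<in> J" "a \<noteq> b" using set dist by auto
  note lc = last_cut_remove[OF fin ab rotated_sorted_consecutive[OF fin rot]]
  have pa: "part k (J - {b}) a = part k J a \<union> part k J b" for k
    using ab by (auto simp: part_def lc)
  have pc: "part k (J - {b}) c = part k J c" if "c \<in> set r" for c k
    using that dist by (auto simp: part_def lc)
  have "filter (\<lambda>c. c \<noteq> b) (a # b # r) = a # r" using dist by (auto simp: filter_id_conv)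
  moreover have "cyclic_class (a # b # r) = cyclic_class ?L" using rot by (metis cyclic_class_rotate)
  ultimately have "cyclic_class (a # r) = cyclic_class (filter (\<lambda>c. c \<noteq> b) ?L)"
    using cyclic_class_filter by metis
  also have "filter (\<lambda>c. c \<noteq> b) ?L = removeAll b ?L"
    unfolding removeAll_filter_not_eq by (rule filter_cong) auto
  also have "\<dots> = sorted_list_of_set (J - {b})"
    using fin by (simp add: sorted_list_of_set_remove distinct_remove1_removeAll)
  finally have "cyclic_class (map (block xs (J - {b})) (a # r)) = merged xs (J - {b})"
    unfolding merged_def by (rule cyclic_class_map)
  moreover have "map (block xs (J - {b})) (a # r) = (block xs J a \<union> block xs J b) # map (block xs J) r"
    by (auto simp: block_def pa pc)
  ultimately show ?thesis by (simp only:)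
qed

text \<open>Rotate so that \<open>b\<close> is in second place; a predecessor \<open>a\<close>
  exists because \<open>b\<close> is not the only cut.\<close>

lemma merge_step_merged:
  assumes J: "finite J" "b \<in> J" "J \<noteq> {b}"
  shows "merge_step (merged xs J) (merged xs (J - {b}))"
proof -
  let ?L = "sorted_list_of_set J"
  have "b \<in> set ?L" using J by simp
  then obtain u v where uv: "?L = u @ b # v" by (meson split_list)
  have ne: "v @ u \<noteq> []"
  proof
    assume "v @ u = []"
    then have "set ?L = {b}" using uv by simp
    then show False using J by simp
  qed
  then obtain w a where wa: "v @ u = w @ [a]" by (metis rev_exhaust)
  have "rotate (length u) ?L = (b # w) @ [a]" using uv wa by (simp add: rotate_append)
  then have "rotate (length (b # w)) (rotate (length u) ?L) = a # b # w"
    by (simp only: rotate_append) simp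
  then have rot: "rotate (length (b # w) + length u) ?L = a # b # w" by (simp only: rotate_rotate)
  then have "merged xs J = cyclic_class (block xs J a # block xs J b # map (block xs J) w)"
    unfolding merged_def by (metis (no_types, lifting) cyclic_class_map cyclic_class_rotate list.simps(9))
  then show ?thesis
    unfolding merge_step_def using merged_remove[OF J(1) rot, of xs] by metis
qed

lemma merge_step_mergedD:
  assumes J: "finite J" and step: "merge_step (merged xs J) D"
  shows "\<exists>b\<in>J. J \<noteq> {b} \<and> D = merged xs (J - {b})"
proof -
  let ?L = "sorted_list_of_set J"
  obtain A B ys where AB: "merged xs J = cyclic_class (A # B # ys)" "D = cyclic_class ((A \<union> B) # ys)"
    using step by (auto simp: merge_step_def)
  then obtain i where "A # B # ys = rotate i (map (block xs J) ?L)"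
    unfolding merged_def using cyclic_class_eq_iff by metis
  then have eq: "A # B # ys = map (block xs J) (rotate i ?L)" by (simp add: rotate_map)
  then obtain a b r where rot: "rotate i ?L = a # b # r" "A = block xs J a" "B = block xs J b" "ys = map (block xs J) r"
    by (auto simp: Cons_eq_map_conv)
  have set: "set (a # b # r) = J" using rot(1) J by (metis set_rotate set_sorted_list_of_set)
  have "distinct (a # b # r)" using rot(1) by (metis distinct_rotate distinct_sorted_list_of_set)
  then have "b \<in> J" "J \<noteq> {b}" using set by auto
  moreover have "D = merged xs (J - {b})" using merged_remove[OF J rot(1), of xs] AB(2) rot by simp
  ultimately show ?thesis by blast
qed

lemma finer_mergedD:
  assumes "finer (merged xs J) D" "finite J" "J \<noteq> {}"
  shows "\<exists>J'. J' \<subseteq> J \<and> J' \<noteq> {} \<and> D = merged xs J'"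
  using assms(1) unfolding finer_def
proof (induction rule: rtranclp_induct)
  case base
  then show ?case using assms by blast
next
  case (step D D')
  then obtain J' where J': "J' \<subseteq> J" "J' \<noteq> {}" "D = merged xs J'" by blast
  have "finite J'" using J' assms finite_subset by blast
  then obtain b where "b \<in> J'" "J' \<noteq> {b}" "D' = merged xs (J' - {b})"
    using merge_step_mergedD[of J' xs D'] step.hyps(2) J'(3) by auto
  then show ?case using J' by (intro exI[of _ "J' - {b}"]) auto
qed

lemma finer_mergedI:
  assumes "finite J" "J' \<subseteq> J" "J' \<noteq> {}"
  shows "finer (merged xs J) (merged xs J')"
  using assms
proof (induction "card (J - J')" arbitrary: J)
  case 0
  then have "J = J'" by (simp add: subset_antisym)
  then show ?case by (simp add: finer_def)
next
  case (Suc m)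
  then obtain b where b: "b \<in> J" "b \<notin> J'" by (metis DiffE card_eq_0_iff ex_in_conv nat.distinct(1))
  have "J - J' = insert b ((J - {b}) - J')" using b by auto
  then have "card ((J - {b}) - J') = m" using Suc.hyps(2) Suc.prems(1) b by simp
  then have "finer (merged xs (J - {b})) (merged xs J')"
    using Suc.hyps(1)[of "J - {b}"] Suc.prems b by auto
  moreover have "merge_step (merged xs J) (merged xs (J - {b}))"
    using Suc.prems b by (intro merge_step_merged) auto
  ultimately show ?case unfolding finer_def by (rule converse_rtranclp_into_rtranclp[rotated])
qed

section \<open>Cut sets of a fixed ordered partition\<close>

locale ordered_blocks =
  fixes n :: nat and xs :: "nat set list"
  assumes op: "ordered_partition n xs"
begin

abbreviation "k \<equiv> length xs"

lemma nonempty: "t < k \<Longrightarrow> xs ! t \<noteq> {}"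
  using op by (auto simp: ordered_partition_def partition_on_def in_set_conv_nth)

lemma disj: "s < k \<Longrightarrow> t < k \<Longrightarrow> s \<noteq> t \<Longrightarrow> xs ! s \<inter> xs ! t = {}"
  using op unfolding ordered_partition_def partition_on_def disjoint_def
  by (metis nth_eq_iff_index_eq nth_mem)

lemma union: "(\<Union>t<k. xs ! t) = {1..n}"
  using op unfolding ordered_partition_def partition_on_def
  by (metis UN_extend_simps(10) atLeast_upt lessThan_atLeast0 map_nth set_map set_upt image_image)

lemma mem_block_iff:
  assumes "p \<in> xs ! t" "t < k"
  shows "p \<in> block xs J j \<longleftrightarrow> last_cut J t = j"
  using assms disj unfolding block_def part_def by blast

lemma blocks_merged: "finite J \<Longrightarrow> blocks (merged xs J) = block xs J ` J"
  by (simp add: merged_def)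

text \<open>The cuts can be read off from the blocks. If \<open>j\<close> were a cut of
  \<open>J2\<close> only, the edges on its two sides would lie in one block, but a part that starts
  at \<open>j\<close> contains the edge before \<open>j\<close> only if it is the whole cycle.
  One-element sets are excluded since they all give the partition with one block.\<close>

lemma merged_subset:
  assumes J1: "J1 \<subseteq> {..<k}" "J1 \<noteq> {}" and J2: "J2 \<subseteq> {..<k}" "\<And>j. J2 \<noteq> {j}"
    and eq: "merged xs J1 = merged xs J2"
  shows "J2 \<subseteq> J1"
proof
  fix j assume j: "j \<in> J2"
  show "j \<in> J1"
  proof (rule ccontr)
    assume nj: "j \<notin> J1"
    have fin2: "finite J2" using J2 finite_subset by blast
    have fin1: "finite J1" using J1 finite_subset by blast
    \<comment> \<open>The edge just before cut \<open>j\<close>, cyclically.\<close>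
    define s where "s = (if j = 0 then k - 1 else j - 1)"
    have jk: "j < k" "s < k" using j J2 by (auto simp: s_def)
    define e where "e = last_cut J1 s"
    have e1: "e \<in> J1" using last_cut_in[OF fin1 J1(2)] by (simp add: e_def)
    have es: "(e \<le> s \<and> (\<forall>i\<in>J1. i \<le> s \<longrightarrow> i \<le> e)) \<or> ((\<forall>i\<in>J1. s < i) \<and> (\<forall>i\<in>J1. i \<le> e))"
      using last_cut_eq_iff[OF fin1 e1, of s] by (simp add: e_def)
    have lt: "i < k" "i \<noteq> j" if "i \<in> J1" for i using that J1 nj by auto
    have "(e \<le> j \<and> (\<forall>i\<in>J1. i \<le> j \<longrightarrow> i \<le> e)) \<or> ((\<forall>i\<in>J1. j < i) \<and> (\<forall>i\<in>J1. i \<le> e))"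
    proof (cases "j = 0")
      case True
      then have "i \<le> s \<and> j < i" if "i \<in> J1" for i using lt[OF that] by (auto simp: s_def)
      then show ?thesis using es e1 by (meson not_le)
    next
      case False
      then have "i \<le> s \<longleftrightarrow> i \<le> j" "s < i \<longleftrightarrow> j < i" if "i \<in> J1" for i using lt[OF that] by (auto simp: s_def)
      then show ?thesis using es e1 by meson
    qed
    then have e: "e \<in> J1" "last_cut J1 j = e" "last_cut J1 s = e"
      using last_cut_eq_iff[OF fin1 e1, of j] e1 e_def by auto
    have "block xs J1 e \<in> block xs J2 ` J2"
      using eq e(1) blocks_merged[OF fin1] blocks_merged[OF fin2] by auto
    then obtain e' where e': "block xs J1 e = block xs J2 e'" by blast
    obtain p q where pq: "p \<in> xs ! j" "q \<in> xs ! s" using nonempty jk by blast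
    have "p \<in> block xs J1 e" "q \<in> block xs J1 e"
      using mem_block_iff[OF pq(1) jk(1)] mem_block_iff[OF pq(2) jk(2)] e by auto
    then have "last_cut J2 j = e'" "last_cut J2 s = e'"
      using mem_block_iff[OF pq(1) jk(1)] mem_block_iff[OF pq(2) jk(2)] e' by auto
    moreover have "last_cut J2 j = j" using last_cut_eq_iff[OF fin2 j] by auto
    ultimately have "last_cut J2 s = j" by simp
    then have "(j \<le> s \<and> (\<forall>i\<in>J2. i \<le> s \<longrightarrow> i \<le> j)) \<or> ((\<forall>i\<in>J2. s < i) \<and> (\<forall>i\<in>J2. i \<le> j))"
      using last_cut_eq_iff[OF fin2 j] by blast
    then have "i = j" if i: "i \<in> J2" for i
    proof
      assume c: "j \<le> s \<and> (\<forall>i\<in>J2. i \<le> s \<longrightarrow> i \<le> j)"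
      then have "j = 0" by (auto simp: s_def split: if_splits)
      moreover have "i < k" using i J2(1) by blast
      ultimately show "i = j" using c[THEN conjunct2, rule_format, OF i] by (simp add: s_def)
    next
      assume c: "(\<forall>i\<in>J2. s < i) \<and> (\<forall>i\<in>J2. i \<le> j)"
      then show "i = j" using c[THEN conjunct1, rule_format, OF i] c[THEN conjunct2, rule_format, OF i]
          c[THEN conjunct1, rule_format, OF j] jk by (auto simp: s_def split: if_splits)
    qed
    then show False using J2(2)[of j] j by blast
  qed
qed

lemma finer_merged_iff:
  assumes J1: "J1 \<subseteq> {..<k}" "J1 \<noteq> {}" and J2: "J2 \<subseteq> {..<k}" "J2 \<noteq> {}" "\<And>j. J2 \<noteq> {j}"
  shows "finer (merged xs J1) (merged xs J2) \<longleftrightarrow> J2 \<subseteq> J1"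
proof
  have fin: "finite J1" using J1 finite_subset by blast
  assume f: "finer (merged xs J1) (merged xs J2)"
  obtain J where J: "J \<subseteq> J1" "J \<noteq> {}" "merged xs J2 = merged xs J"
    using finer_mergedD[OF f fin J1(2)] by blast
  then have "J2 \<subseteq> J" using merged_subset[of J J2] J1 J2 by auto
  then show "J2 \<subseteq> J1" using J by blast
next
  assume "J2 \<subseteq> J1"
  then show "finer (merged xs J1) (merged xs J2)"
    using finite_subset[OF J1(1)] J2(2) by (intro finer_mergedI) simp_all
qed

lemma merged_cyclic_partition:
  assumes J: "J \<subseteq> {..<k}" "J \<noteq> {}"
  shows "merged xs J \<in> cyclic_partitions n"
proof -
  have fin: "finite J" using J finite_subset by blast
  have self: "last_cut J j = j" if "j \<in> J" for j using last_cut_eq_iff[OF fin that] by auto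
  have sub: "xs ! j \<subseteq> block xs J j" if "j \<in> J" for j
    using self[OF that] that J by (auto simp: mem_block_iff)
  have memD: "\<exists>t<k. p \<in> xs ! t \<and> last_cut J t = j" if "p \<in> block xs J j" for p j
    using that by (auto simp: block_def part_def)
  have djnt: "i = j" if "i \<in> J" "j \<in> J" "p \<in> block xs J i" "p \<in> block xs J j" for i j p
    using memD[OF that(3)] mem_block_iff that(4) by metis
  have inj: "inj_on (block xs J) J"
  proof
    fix i j assume ij: "i \<in> J" "j \<in> J" "block xs J i = block xs J j"
    obtain p where "p \<in> xs ! i" using nonempty[of i] ij J by blast
    then show "i = j" using djnt[OF ij(1,2), of p] sub ij by blast
  qed
  let ?L = "map (block xs J) (sorted_list_of_set J)"
  have "(\<Union>j\<in>J. block xs J j) = (\<Union>t<k. xs ! t)"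
  proof (intro equalityI subsetI)
    fix p assume "p \<in> (\<Union>j\<in>J. block xs J j)"
    then show "p \<in> (\<Union>t<k. xs ! t)" using memD by blast
  next
    fix p assume "p \<in> (\<Union>t<k. xs ! t)"
    then obtain t where "t < k" "p \<in> xs ! t" by blast
    then have "p \<in> block xs J (last_cut J t)" using mem_block_iff by blast
    then show "p \<in> (\<Union>j\<in>J. block xs J j)" using last_cut_in[OF fin J(2)] by blast
  qed
  then have "\<Union> (block xs J ` J) = {1..n}" using union by simp
  moreover have "disjoint (block xs J ` J)" unfolding disjoint_def using djnt by blast
  moreover have "{} \<notin> block xs J ` J"
  proof
    assume "{} \<in> block xs J ` J"
    then obtain j where "j \<in> J" "block xs J j = {}" by auto
    then show False using sub[of j] nonempty[of j] J by blast
  qed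
  ultimately have "partition_on {1..n} (block xs J ` J)" unfolding partition_on_def by blast
  then have "ordered_partition n ?L"
    using inj fin by (auto simp: ordered_partition_def distinct_map)
  then show ?thesis unfolding cyclic_partitions_def merged_def by blast
qed

lemma star_merged:
  assumes pos: "0 < k"
  shows "star (family_complex n F) (cyclic_class xs) =
    merged xs ` {J. J \<subseteq> {..<k} \<and> J \<noteq> {} \<and> (\<forall>j\<in>J. block xs J j \<in> F)}"
proof (intro equalityI subsetI)
  fix C assume "C \<in> star (family_complex n F) (cyclic_class xs)"
  then have C: "blocks C \<subseteq> F" "finer (merged xs {..<k}) C"
    by (auto simp: star_def family_complex_def merged_full)
  then obtain J where J: "J \<subseteq> {..<k}" "J \<noteq> {}" "C = merged xs J"
    using finer_mergedD[OF C(2)] pos by auto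
  then have "block xs J ` J \<subseteq> F" using C(1) blocks_merged finite_subset[OF J(1)] by simp
  then show "C \<in> merged xs ` {J. J \<subseteq> {..<k} \<and> J \<noteq> {} \<and> (\<forall>j\<in>J. block xs J j \<in> F)}"
    using J by blast
next
  fix C assume "C \<in> merged xs ` {J. J \<subseteq> {..<k} \<and> J \<noteq> {} \<and> (\<forall>j\<in>J. block xs J j \<in> F)}"
  then obtain J where J: "J \<subseteq> {..<k}" "J \<noteq> {}" "\<forall>j\<in>J. block xs J j \<in> F" "C = merged xs J" by blast
  have "finer (merged xs {..<k}) (merged xs J)" using J by (intro finer_mergedI) auto
  moreover have "blocks C \<subseteq> F" using J blocks_merged finite_subset[OF J(1)] by auto
  ultimately show "C \<in> star (family_complex n F) (cyclic_class xs)"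
    using merged_cyclic_partition[OF J(1,2)] J(4) by (simp add: star_def family_complex_def merged_full)
qed

lemma length_le: "k \<le> n"
proof -
  have "\<forall>t<k. \<exists>p. p \<in> xs ! t" using nonempty by blast
  then obtain f where f: "\<And>t. t < k \<Longrightarrow> f t \<in> xs ! t" by metis
  have "inj_on f {..<k}" using f disj by (auto intro!: inj_onI) (metis disjoint_iff)
  moreover have "f ` {..<k} \<subseteq> {1..n}" using f union by blast
  ultimately show ?thesis using card_inj_on_le[of f "{..<k}" "{1..n}"] by simp
qed

lemma card_blocks: "card (set xs) = k"
  using op by (simp add: ordered_partition_def distinct_card)

end

lemma quasilinkage_pos: "quasilinkage n Q \<Longrightarrow> 0 < n"
  unfolding quasilinkage_def by (cases n) auto

section \<open>Stars of the cells of a quasilinkage\<close>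

locale short_blocks = ordered_blocks +
  fixes Q :: "nat set set"
  assumes quasi: "quasilinkage n Q" and short: "set xs \<subseteq> Q"
begin

definition short_index_sets :: "nat set set" where
  "short_index_sets = {I. I \<subseteq> {..<k} \<and> (\<Union>t\<in>I. xs ! t) \<in> Q}"

lemma Union_compl:
  assumes "S \<subseteq> {..<k}"
  shows "(\<Union>t\<in>{..<k} - S. xs ! t) = {1..n} - (\<Union>t\<in>S. xs ! t)"
  unfolding union[symmetric]
proof (intro equalityI subsetI)
  fix p assume "p \<in> (\<Union>t\<in>{..<k} - S. xs ! t)"
  then obtain t where t: "t < k" "t \<notin> S" "p \<in> xs ! t" by blast
  moreover have "p \<notin> xs ! s" if "s \<in> S" for s using disj[of t s] t that assms by blast
  ultimately show "p \<in> (\<Union>t<k. xs ! t) - (\<Union>t\<in>S. xs ! t)" by blast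
qed blast

text \<open>The quasilinkage axioms pass from elements to blocks because the blocks partition the
  ground set and are themselves short.\<close>

sublocale short_arcs k short_index_sets
proof
  show "0 < k"
  proof (rule ccontr)
    assume "\<not> 0 < k"
    then have "{1..n} = {}" using union by simp
    then show False using quasilinkage_pos[OF quasi] by simp
  qed
  show "{i} \<in> short_index_sets" if "i < k" for i
    using that short by (auto simp: short_index_sets_def)
  show "T \<in> short_index_sets" if "S \<in> short_index_sets" "T \<subseteq> S" for S T
  proof -
    have "(\<Union>t\<in>T. xs ! t) \<subseteq> (\<Union>t\<in>S. xs ! t)" using that by blast
    moreover have "(\<Union>t\<in>S. xs ! t) \<in> Q" "T \<subseteq> {..<k}" using that by (auto simp: short_index_sets_def)
    moreover have "\<forall>A\<in>Q. \<forall>B. B \<subseteq> A \<longrightarrow> B \<in> Q" using quasi by (simp add: quasilinkage_def)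
    ultimately show ?thesis unfolding short_index_sets_def by blast
  qed
  show "S \<in> short_index_sets \<longleftrightarrow> {..<k} - S \<notin> short_index_sets" if S: "S \<subseteq> {..<k}" for S
  proof -
    have "(\<Union>t\<in>S. xs ! t) \<subseteq> {1..n}" using S union by blast
    then have "((\<Union>t\<in>S. xs ! t) \<in> Q) \<noteq> ({1..n} - (\<Union>t\<in>S. xs ! t) \<in> Q)"
      using quasi unfolding quasilinkage_def by blast
    then show ?thesis using S Union_compl[OF S] by (auto simp: short_index_sets_def)
  qed
qed

lemma admissible_blocks:
  "admissible J \<longleftrightarrow> J \<subseteq> {..<k} \<and> J \<noteq> {} \<and> (\<forall>j\<in>J. block xs J j \<in> Q)"
proof -
  have "part k J j \<in> short_index_sets \<longleftrightarrow> block xs J j \<in> Q" for j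
    by (auto simp: short_index_sets_def block_def part_def)
  then show ?thesis unfolding admissible_def by simp
qed

lemma star_admissible: "star (family_complex n Q) (cyclic_class xs) = merged xs ` {J. admissible J}"
  unfolding star_merged[OF pos] admissible_blocks ..

lemma admissible_not_singleton: "admissible J \<Longrightarrow> J \<noteq> {j}"
  using admissible_has_triangle triangle_distinct by blast

lemma finer_admissible:
  "admissible J \<Longrightarrow> admissible J' \<Longrightarrow> finer (merged xs J) (merged xs J') \<longleftrightarrow> J' \<subseteq> J"
  using admissible_not_singleton by (intro finer_merged_iff) (auto simp: admissible_def)

text \<open>Blocks are counted from 0, the entries of a length vector from 1.\<close>

definition lengths :: "nat \<Rightarrow> real" where
  "lengths i = len (i - 1)"

abbreviation "singles \<equiv> map (\<lambda>i. {Suc i}) [0..<k]"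

lemma sum_lengths: "sum lengths (Suc ` I) = sum len I"
  by (simp add: sum.reindex lengths_def)

lemma Suc_image: "{1..k} = Suc ` {..<k}"
  by (simp add: lessThan_atLeast0 image_Suc_atLeastLessThan atLeastLessThanSuc_atLeastAtMost)

lemma Suc_image_compl: "{1..k} - Suc ` I = Suc ` ({..<k} - I)"
  unfolding Suc_image by (simp add: image_set_diff)

lemma length_vector_lengths: "length_vector k lengths"
  by (simp add: length_vector_def lengths_def len_pos)

lemma subset_Suc_image: "J \<subseteq> {1..k} \<Longrightarrow> \<exists>I. I \<subseteq> {..<k} \<and> J = Suc ` I"
  unfolding Suc_image by (simp add: subset_image_iff)

lemma generic_lengths: "generic k lengths"
  unfolding generic_def
proof (intro allI impI)
  fix J assume "J \<subseteq> {1..k}"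
  then obtain I where "I \<subseteq> {..<k}" "J = Suc ` I" using subset_Suc_image by blast
  then show "sum lengths J \<noteq> sum lengths ({1..k} - J)"
    using len_generic by (simp add: Suc_image_compl sum_lengths del: One_nat_def)
qed

lemma ordered_partition_singles: "ordered_partition k singles"
proof -
  have "set singles = (\<lambda>i. {Suc i}) ` {..<k}" by auto
  moreover have "partition_on {1..k} ((\<lambda>i. {Suc i}) ` {..<k})"
  proof -
    have "(\<Union>i<k. {Suc i}) = {1..k}" unfolding Suc_image by auto
    then show ?thesis by (auto simp: partition_on_def disjoint_def)
  qed
  ultimately show ?thesis by (auto simp: ordered_partition_def distinct_map inj_on_def)
qed

text \<open>Admissibility only tests parts, every part is an arc, and on arcs shortness in
  \<open>Q\<close> and shortness for \<open>lengths\<close> agree by \<open>len_short_arc\<close>.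
  The whole cycle, which is the part of a single cut, is long in both senses.\<close>

lemma singles_admissible:
  "admissible J \<longleftrightarrow> J \<subseteq> {..<k} \<and> J \<noteq> {} \<and> (\<forall>j\<in>J. block singles J j \<in> short_sets k lengths)"
proof -
  have "part k J j \<in> short_index_sets \<longleftrightarrow> block singles J j \<in> short_sets k lengths"
    if J: "J \<subseteq> {..<k}" "j \<in> J" for j
  proof -
    obtain j' where j': "j' \<in> J" "part k J j = arc k j j'" "j' = j \<Longrightarrow> J = {j}"
      by (rule part_is_arc[OF J]) (rule that, assumption+)
    have jk: "j < k" "j' < k" using j' J by auto
    let ?A = "arc k j j'"
    have "block singles J j = Suc ` part k J j"
      by (auto simp: block_def part_def)
    then have "block singles J j \<in> short_sets k lengths \<longleftrightarrow> sum len ?A < sum len ({..<k} - ?A)"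
      using arc_subset[of k j j'] by (auto simp: short_sets_def Suc_image_compl sum_lengths j'(2) simp del: One_nat_def)
    also have "\<dots> \<longleftrightarrow> ?A \<in> short_index_sets"
    proof (cases "j = j'")
      case True
      have "0 \<le> sum len {..<k}" by (intro sum_nonneg less_imp_le len_pos)
      then show ?thesis using True full arc_full[OF jk(1)] by simp
    next
      case False
      then show ?thesis using len_short_arc[OF jk False] by (simp add: beats_def)
    qed
    finally show ?thesis using j'(2) by simp
  qed
  then show ?thesis unfolding admissible_def by blast
qed

text \<open>Both stars are copies of the admissible cut sets under reverse inclusion; the vertex is
  the cyclic order of \<open>k\<close> singletons.\<close>

lemma star_realizable:
  "length_vector k lengths \<and> generic k lengths \<and>
   (\<exists>w\<in>vertices (CWM k lengths). stars_isomorphic (family_complex n Q) (cyclic_class xs) (CWM k lengths) w)"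
proof -
  interpret S: ordered_blocks k singles by standard (rule ordered_partition_singles)
  let ?X = "family_complex n Q" and ?Y = "CWM k lengths" and ?v = "cyclic_class xs" and ?w = "cyclic_class singles"
  have starX: "star ?X ?v = merged xs ` {J. admissible J}" by (rule star_admissible)
  have starY: "star ?Y ?w = merged singles ` {J. admissible J}"
    unfolding CWM_def using S.star_merged pos by (simp add: singles_admissible)
  have fX: "face ?X (merged xs J) (merged xs J') \<longleftrightarrow> J' \<subseteq> J" if "admissible J" "admissible J'" for J J'
    using finer_admissible that by (simp add: family_complex_def)
  have fY: "face ?Y (merged singles J) (merged singles J') \<longleftrightarrow> J' \<subseteq> J" if "admissible J" "admissible J'" for J J'
    using S.finer_merged_iff[of J J'] that admissible_not_singleton
    by (simp add: CWM_def family_complex_def admissible_def)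
  have injX: "inj_on (merged xs) {J. admissible J}"
  proof (rule inj_onI, unfold mem_Collect_eq)
    fix J J' assume "admissible J" "admissible J'" "merged xs J = merged xs J'"
    then show "J = J'" using fX[of J J'] fX[of J' J] fX[of J J] by auto
  qed
  have injY: "inj_on (merged singles) {J. admissible J}"
  proof (rule inj_onI, unfold mem_Collect_eq)
    fix J J' assume "admissible J" "admissible J'" "merged singles J = merged singles J'"
    then show "J = J'" using fY[of J J'] fY[of J' J] fY[of J J] by auto
  qed
  define g where "g = the_inv_into {J. admissible J} (merged xs)"
  have g: "g (merged xs J) = J" if "admissible J" for J
    unfolding g_def using the_inv_into_f_f[OF injX] that by simp
  have "bij_betw (merged singles \<circ> g) (star ?X ?v) (star ?Y ?w)"
    unfolding starX starY bij_betw_def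
    using g injY by (auto simp: inj_on_def image_iff)
  moreover have "face ?X C D \<longleftrightarrow> face ?Y ((merged singles \<circ> g) C) ((merged singles \<circ> g) D)"
    if "C \<in> star ?X ?v" "D \<in> star ?X ?v" for C D
    using that fX fY g unfolding starX by auto
  ultimately have iso: "stars_isomorphic ?X ?v ?Y ?w" unfolding stars_isomorphic_def by blast
  have "?w \<in> star ?Y ?w"
    unfolding starY using admissible_full merged_full[of singles] by (metis (mono_tags, lifting) image_eqI length_map length_upt mem_Collect_eq minus_nat.diff_0)
  then have "?w \<in> vertices ?Y"
    using S.card_blocks by (simp add: vertices_def star_def CWM_def family_complex_def)
  then show ?thesis using iso length_vector_lengths generic_lengths by blast
qed

end

section \<open>Refinements of a cyclically ordered partition\<close>

lemma finer_refl: "finer C C"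
  by (simp add: finer_def)

lemma finer_trans: "finer C D \<Longrightarrow> finer D E \<Longrightarrow> finer C E"
  unfolding finer_def by (rule rtranclp_trans)

text \<open>A merge strictly lowers this count, which makes \<open>finer\<close>
  antisymmetric.\<close>

definition class_length :: "nat set list set \<Rightarrow> nat" where
  "class_length C = length (SOME xs. xs \<in> C)"

lemma class_length [simp]: "class_length (cyclic_class xs) = length xs"
proof -
  have "(SOME ys. ys \<in> cyclic_class xs) \<in> cyclic_class xs" by (rule someI) (rule cyclic_class_self)
  then show ?thesis unfolding class_length_def by (auto simp: cyclic_class_def)
qed

lemma finer_length: "finer C D \<Longrightarrow> C = D \<or> class_length D < class_length C"
  unfolding finer_def by (induction rule: rtranclp_induct) (auto simp: merge_step_def)

lemma finer_antisym: "finer C D \<Longrightarrow> finer D C \<Longrightarrow> C = D"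
  by (metis finer_length less_asym)

lemma finer_merge_adjacent:
  "finer (cyclic_class (ps @ A # B # qs)) (cyclic_class (ps @ (A \<union> B) # qs))"
proof -
  have "merge_step (cyclic_class (A # B # qs @ ps)) (cyclic_class ((A \<union> B) # qs @ ps))"
    by (auto simp: merge_step_def)
  then show ?thesis unfolding finer_def
    using cyclic_class_append[of ps "A # B # qs"] cyclic_class_append[of ps "(A \<union> B) # qs"] by auto
qed

lemma finer_merge_segment:
  "ys \<noteq> [] \<Longrightarrow> finer (cyclic_class (ps @ ys @ qs)) (cyclic_class (ps @ \<Union>(set ys) # qs))"
proof (induction ys rule: induct_list012)
  case (2 A)
  then show ?case by (simp add: finer_refl)
next
  case (3 A B ys)
  show ?case
  proof (induction ys arbitrary: A B)
    case Nil
    then show ?case using finer_merge_adjacent[of ps A B qs] by simp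
  next
    case (Cons C ys)
    have "finer (cyclic_class (ps @ (A # B # C # ys) @ qs)) (cyclic_class (ps @ ((A \<union> B) # C # ys) @ qs))"
      using finer_merge_adjacent[of ps A B "C # ys @ qs"] by simp
    then show ?case using finer_trans[OF _ Cons[of "A \<union> B" C]] by (simp add: Un_assoc)
  qed
qed simp

text \<open>The prefix \<open>ps\<close> holds the blocks merged so far and grows during the
  induction.\<close>

lemma finer_concat:
  assumes "\<And>ys. ys \<in> set yss \<Longrightarrow> ys \<noteq> []"
  shows "finer (cyclic_class (ps @ concat yss)) (cyclic_class (ps @ map (\<lambda>ys. \<Union>(set ys)) yss))"
  using assms
proof (induction yss arbitrary: ps)
  case Nil
  then show ?case by (simp add: finer_refl)
next
  case (Cons ys yss)
  have "finer (cyclic_class (ps @ ys @ concat yss)) (cyclic_class (ps @ \<Union>(set ys) # concat yss))"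
    using Cons.prems by (intro finer_merge_segment) simp
  moreover have "finer (cyclic_class ((ps @ [\<Union>(set ys)]) @ concat yss))
      (cyclic_class ((ps @ [\<Union>(set ys)]) @ map (\<lambda>ys. \<Union>(set ys)) yss))"
    using Cons.prems by (intro Cons.IH) simp
  ultimately show ?case using finer_trans by simp
qed

lemma concat_split:
  assumes "concat yss = u @ z # v"
  shows "\<exists>p q r s. yss = p @ (q @ z # r) # s \<and> u = concat p @ q \<and> v = r @ concat s"
  using assms
proof (induction yss arbitrary: u)
  case Nil
  then show ?case by simp
next
  case (Cons ys yss)
  then have eq: "ys @ concat yss = u @ z # v" by simp
  then consider w where "u = ys @ w" "concat yss = w @ z # v" | w where "ys = u @ z # w" "v = w @ concat yss"
    by (auto simp: append_eq_append_conv2 append_eq_Cons_conv Cons_eq_append_conv)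
  then show ?case
  proof cases
    case 1
    then obtain p q r s where *: "yss = p @ (q @ z # r) # s" "w = concat p @ q" "v = r @ concat s"
      using Cons.IH by blast
    show ?thesis by (rule exI[of _ "ys # p"], rule exI[of _ q]) (use 1 * in auto)
  next
    case 2
    then show ?thesis by (intro exI[of _ "[]"] exI[of _ u] exI[of _ w] exI[of _ yss]) simp
  qed
qed

text \<open>Read backwards, a merge splits one block \<open>A \<union> B\<close>. This block sits in
  one inner list of \<open>yss\<close>, and replacing it there by \<open>A\<close> and
  \<open>B\<close> changes no union.\<close>

lemma finer_concatD:
  assumes "finer C (cyclic_class xs)"
  shows "\<exists>yss. C = cyclic_class (concat yss) \<and> cyclic_class xs = cyclic_class (map (\<lambda>ys. \<Union>(set ys)) yss)"
  using assms unfolding finer_def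
proof (induction rule: converse_rtranclp_induct)
  case base
  show ?case by (intro exI[of _ "map (\<lambda>z. [z]) xs"]) (auto simp: concat_map_singleton comp_def)
next
  case (step C C')
  then obtain yss where yss: "C' = cyclic_class (concat yss)"
    "cyclic_class xs = cyclic_class (map (\<lambda>ys. \<Union>(set ys)) yss)" by blast
  obtain A B ws where AB: "C = cyclic_class (A # B # ws)" "C' = cyclic_class ((A \<union> B) # ws)"
    using step.hyps by (auto simp: merge_step_def)
  have "cyclic_class (concat yss) = cyclic_class ((A \<union> B) # ws)" using yss(1) AB(2) by simp
  then obtain i where "concat yss = rotate i ((A \<union> B) # ws)" using cyclic_class_eq_iff by blast
  then obtain m where rot: "concat yss = drop m ((A \<union> B) # ws) @ take m ((A \<union> B) # ws)"
    by (auto simp: rotate_drop_take)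
  have "\<exists>u v. concat yss = u @ (A \<union> B) # v \<and> ws = v @ u"
  proof (cases m)
    case 0
    then show ?thesis using rot by auto
  next
    case (Suc m')
    then show ?thesis using rot by (intro exI[of _ "drop m' ws"] exI[of _ "take m' ws"]) simp
  qed
  then obtain u v where uv: "concat yss = u @ (A \<union> B) # v" "ws = v @ u" by blast
  obtain p q r s where pqrs: "yss = p @ (q @ (A \<union> B) # r) # s" "u = concat p @ q" "v = r @ concat s"
    using concat_split[OF uv(1)] by blast
  let ?yss = "p @ (q @ A # B # r) # s"
  have "cyclic_class (concat ?yss) = cyclic_class (u @ A # B # v)" using pqrs by simp
  also have "\<dots> = C" using cyclic_class_append[of u "A # B # v"] AB(1) uv(2) by simp
  finally have "C = cyclic_class (concat ?yss)" by simp
  moreover have "map (\<lambda>ys. \<Union>(set ys)) ?yss = map (\<lambda>ys. \<Union>(set ys)) yss"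
    using pqrs(1) by (simp add: Un_assoc)
  ultimately show ?case using yss(2) by metis
qed

section \<open>Cyclic order of triples\<close>

fun pair_in :: "'a set list \<Rightarrow> 'a \<Rightarrow> 'a \<Rightarrow> bool" where
  "pair_in [] b c \<longleftrightarrow> False"
| "pair_in (X # xs) b c \<longleftrightarrow> b \<in> X \<and> c \<in> \<Union>(set xs) \<or> pair_in xs b c"

fun triple_in :: "'a set list \<Rightarrow> 'a \<Rightarrow> 'a \<Rightarrow> 'a \<Rightarrow> bool" where
  "triple_in [] a b c \<longleftrightarrow> False"
| "triple_in (X # xs) a b c \<longleftrightarrow> a \<in> X \<and> pair_in xs b c \<or> triple_in xs a b c"

text \<open>The orientation of three elements at distinct positions is invariant under rotation and
  survives refinement, unlike the order of two elements, which depends on where the cycle is cut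
  open.\<close>

definition cyclic_triple :: "'a set list \<Rightarrow> 'a \<Rightarrow> 'a \<Rightarrow> 'a \<Rightarrow> bool" where
  "cyclic_triple xs a b c \<longleftrightarrow> triple_in xs a b c \<or> triple_in xs b c a \<or> triple_in xs c a b"

lemma pair_in_snoc: "pair_in (xs @ [X]) b c \<longleftrightarrow> pair_in xs b c \<or> b \<in> \<Union>(set xs) \<and> c \<in> X"
  by (induction xs) auto

lemma triple_in_snoc: "triple_in (xs @ [X]) a b c \<longleftrightarrow> triple_in xs a b c \<or> pair_in xs a b \<and> c \<in> X"
  by (induction xs) (auto simp: pair_in_snoc)

lemma cyclic_triple_rotate: "cyclic_triple (rotate i xs) a b c \<longleftrightarrow> cyclic_triple xs a b c"
proof (induction i)
  case (Suc i)
  have "cyclic_triple (rotate1 ys) a b c \<longleftrightarrow> cyclic_triple ys a b c" for ys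
    by (cases ys) (auto simp: cyclic_triple_def triple_in_snoc)
  then show ?case using Suc by simp
qed simp

lemma cyclic_triple_class:
  "cyclic_class ys = cyclic_class xs \<Longrightarrow> cyclic_triple ys a b c \<longleftrightarrow> cyclic_triple xs a b c"
  unfolding cyclic_class_eq_iff by (auto simp: cyclic_triple_rotate)

lemma finer_cyclic_triple:
  assumes "finer (cyclic_class xs) (cyclic_class ys)" "cyclic_triple ys a b c"
  shows "cyclic_triple xs a b c"
proof -
  have "finer C D \<Longrightarrow> \<forall>xs ys. C = cyclic_class xs \<longrightarrow> D = cyclic_class ys \<longrightarrow>
      cyclic_triple ys a b c \<longrightarrow> cyclic_triple xs a b c" for C D
    unfolding finer_def
  proof (induction rule: rtranclp_induct)
    case base
    show ?case
    proof (intro allI impI)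
      fix xs ys assume xs: "C = cyclic_class xs" and ys: "C = cyclic_class ys" "cyclic_triple ys a b c"
      have "cyclic_class ys = cyclic_class xs" using xs ys(1) by simp
      then show "cyclic_triple xs a b c" using cyclic_triple_class[of ys xs a b c] ys(2) by simp
    qed
  next
    case (step D E)
    obtain A B ws where AB: "D = cyclic_class (A # B # ws)" "E = cyclic_class ((A \<union> B) # ws)"
      using step.hyps by (auto simp: merge_step_def)
    have *: "cyclic_triple (A # B # ws) a b c" if "cyclic_triple ((A \<union> B) # ws) a b c"
      using that by (auto simp: cyclic_triple_def)
    show ?case
    proof (intro allI impI)
      fix xs ys assume xs: "C = cyclic_class xs" and ys: "E = cyclic_class ys" "cyclic_triple ys a b c"
      have "cyclic_class ys = cyclic_class ((A \<union> B) # ws)" using ys(1) AB(2) by simp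
      then have "cyclic_triple ((A \<union> B) # ws) a b c"
        using cyclic_triple_class[of ys _ a b c] ys(2) by simp
      then show "cyclic_triple xs a b c" using step.IH xs AB(1) * by blast
    qed
  qed
  then show ?thesis using assms by blast
qed

lemma pair_in_total:
  "b \<in> \<Union>(set xs) \<Longrightarrow> c \<in> \<Union>(set xs) \<Longrightarrow> pair_in xs b c \<or> pair_in xs c b \<or> (\<exists>X\<in>set xs. b \<in> X \<and> c \<in> X)"
  by (induction xs) auto

lemma triple_in_total:
  assumes "a \<in> \<Union>(set xs)" "b \<in> \<Union>(set xs)" "c \<in> \<Union>(set xs)"
    and "\<And>X. X \<in> set xs \<Longrightarrow> \<not> (a \<in> X \<and> b \<in> X)" "\<And>X. X \<in> set xs \<Longrightarrow> \<not> (b \<in> X \<and> c \<in> X)"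
      "\<And>X. X \<in> set xs \<Longrightarrow> \<not> (a \<in> X \<and> c \<in> X)"
  shows "cyclic_triple xs a b c \<or> cyclic_triple xs b a c"
  using assms
proof (induction xs)
  case (Cons X xs)
  note nAB = Cons.prems(4-6)
  have tot: "pair_in xs p q \<or> pair_in xs q p"
    if "p \<in> \<Union>(set xs)" "q \<in> \<Union>(set xs)" "\<And>Y. Y \<in> set xs \<Longrightarrow> \<not> (p \<in> Y \<and> q \<in> Y)" for p q
    using pair_in_total[OF that(1,2)] that(3) by blast
  have nX: "\<not> (a \<in> X \<and> b \<in> X)" "\<not> (b \<in> X \<and> c \<in> X)" "\<not> (a \<in> X \<and> c \<in> X)"
    using nAB by auto
  have nxs: "\<And>Y. Y \<in> set xs \<Longrightarrow> \<not> (a \<in> Y \<and> b \<in> Y)" "\<And>Y. Y \<in> set xs \<Longrightarrow> \<not> (b \<in> Y \<and> c \<in> Y)"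
    "\<And>Y. Y \<in> set xs \<Longrightarrow> \<not> (a \<in> Y \<and> c \<in> Y)"
    using nAB by auto
  consider "a \<in> X" | "b \<in> X" | "c \<in> X" | "a \<notin> X" "b \<notin> X" "c \<notin> X" by blast
  then show ?case
  proof cases
    case 1
    then have "pair_in xs b c \<or> pair_in xs c b" using nX nxs(2) Cons.prems(2,3) by (intro tot) auto
    then show ?thesis using 1 by (auto simp: cyclic_triple_def)
  next
    case 2
    then have "pair_in xs a c \<or> pair_in xs c a" using nX nxs(3) Cons.prems(1,3) by (intro tot) auto
    then show ?thesis using 2 by (auto simp: cyclic_triple_def)
  next
    case 3
    then have "pair_in xs a b \<or> pair_in xs b a" using nX nxs(1) Cons.prems(1,2) by (intro tot) auto
    then show ?thesis using 3 by (auto simp: cyclic_triple_def)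
  next
    case 4
    then have "cyclic_triple xs a b c \<or> cyclic_triple xs b a c"
      using Cons.prems(1-3) nxs by (intro Cons.IH) auto
    then show ?thesis by (auto simp: cyclic_triple_def)
  qed
qed simp

section \<open>Level sets\<close>

text \<open>Encodes an ordered partition of \<open>S\<close> by a real function, so that refinements
  of a cell become points of a vector space and are distinguished by signs of differences.\<close>

definition levels :: "('a \<Rightarrow> real) \<Rightarrow> 'a set \<Rightarrow> 'a set list" where
  "levels x S = map (\<lambda>v. {e \<in> S. x e = v}) (sorted_list_of_set (x ` S))"

lemma set_levels: "finite S \<Longrightarrow> set (levels x S) = (\<lambda>v. {e \<in> S. x e = v}) ` x ` S"
  by (simp add: levels_def)

lemma Union_levels: "finite S \<Longrightarrow> \<Union>(set (levels x S)) = S"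
  by (auto simp: set_levels)

lemma levels_nonempty: "finite S \<Longrightarrow> S \<noteq> {} \<Longrightarrow> levels x S \<noteq> []"
  using Union_levels[of S x] by fastforce

lemma sorted_wrt_levels:
  "finite S \<Longrightarrow> sorted_wrt (\<lambda>A B. \<forall>a\<in>A. \<forall>b\<in>B. x a < x b) (levels x S)"
  unfolding levels_def sorted_wrt_map
  by (rule sorted_wrt_mono_rel[of _ "(<)"]) (auto simp: strict_sorted_list_of_set)

lemma sorted_wrt_concat:
  assumes "\<And>l. l \<in> set ls \<Longrightarrow> sorted_wrt R l"
    and "sorted_wrt (\<lambda>l l'. \<forall>A\<in>set l. \<forall>B\<in>set l'. R A B) ls"
  shows "sorted_wrt R (concat ls)"
  using assms by (induction ls) (auto simp: sorted_wrt_append)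

text \<open>By \<open>mono\<close>, elements with equal \<open>x\<close> have equal
  \<open>y\<close>, and the \<open>x\<close>-values on one \<open>y\<close>-level lie below those on
  the next.\<close>

lemma levels_levels:
  assumes S: "finite S" and mono: "\<And>e e'. e \<in> S \<Longrightarrow> e' \<in> S \<Longrightarrow> y e < y e' \<Longrightarrow> x e < x e'"
  shows "concat (map (levels x) (levels y S)) = levels x S"
proof -
  define L where "L v = {e \<in> S. y e = v}" for v
  let ?vs = "sorted_list_of_set (y ` S)"
  let ?ws = "concat (map (\<lambda>v. sorted_list_of_set (x ` L v)) ?vs)"
  have finL: "finite (L v)" for v using S by (simp add: L_def)
  have "sorted_wrt (<) ?ws"
  proof (rule sorted_wrt_concat)
    show "sorted_wrt (<) l" if "l \<in> set (map (\<lambda>v. sorted_list_of_set (x ` L v)) ?vs)" for l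
      using that by (auto simp: strict_sorted_list_of_set)
    have "sorted_wrt (<) ?vs" by (rule strict_sorted_list_of_set)
    then show "sorted_wrt (\<lambda>l l'. \<forall>A\<in>set l. \<forall>B\<in>set l'. A < B) (map (\<lambda>v. sorted_list_of_set (x ` L v)) ?vs)"
      unfolding sorted_wrt_map
      by (rule sorted_wrt_mono_rel[rotated]) (use finL mono in \<open>auto simp: L_def\<close>)
  qed
  moreover have "set ?ws = x ` S" using S finL by (auto simp: L_def)
  ultimately have ws: "sorted_list_of_set (x ` S) = ?ws"
    by (metis strict_sorted_iff sorted_list_of_set.idem_if_sorted_distinct)
  have lev: "{e \<in> S. x e = w} = {e \<in> L v. x e = w}" if "w \<in> x ` L v" for v w
  proof -
    from that obtain e where "e \<in> L v" "w = x e" by blast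
    then have e: "e \<in> S" "y e = v" "x e = w" by (auto simp: L_def)
    have "y e' = v" if "e' \<in> S" "x e' = w" for e'
      using mono[OF e(1) that(1)] mono[OF that(1) e(1)] e that by force
    then show ?thesis by (auto simp: L_def)
  qed
  have "levels x S = concat (map (\<lambda>v. map (\<lambda>w. {e \<in> S. x e = w}) (sorted_list_of_set (x ` L v))) ?vs)"
    unfolding levels_def ws by (simp add: map_concat comp_def)
  also have "\<dots> = concat (map (\<lambda>v. levels x (L v)) ?vs)"
    unfolding levels_def using lev finL by (intro arg_cong[where f = concat] map_cong) auto
  also have "\<dots> = concat (map (levels x) (levels y S))"
    unfolding levels_def[of y] L_def by (simp add: comp_def)
  finally show ?thesis by simp
qed

lemma levels_of_list:
  assumes fin: "finite (\<Union>(set ys))" and x: "\<And>i e. i < length ys \<Longrightarrow> e \<in> ys ! i \<Longrightarrow> x e = real i"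
    and ne: "\<And>A. A \<in> set ys \<Longrightarrow> A \<noteq> {}"
  shows "levels x (\<Union>(set ys)) = ys"
proof -
  let ?S = "\<Union>(set ys)"
  have mem: "e \<in> ?S \<longleftrightarrow> (\<exists>i<length ys. e \<in> ys ! i)" for e
    by (metis UnionE UnionI in_set_conv_nth)
  have "x ` ?S = real ` {..<length ys}"
  proof (intro equalityI subsetI)
    fix w assume "w \<in> x ` ?S"
    then obtain e where "e \<in> ?S" "w = x e" by blast
    then show "w \<in> real ` {..<length ys}" using mem x by auto
  next
    fix w assume "w \<in> real ` {..<length ys}"
    then obtain i where i: "i < length ys" "w = real i" by blast
    then obtain e where "e \<in> ys ! i" using ne by fastforce
    then show "w \<in> x ` ?S" using i x[of i e] mem by (auto intro!: image_eqI[of _ _ e])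
  qed
  then have "x ` ?S = set (map real [0..<length ys])" by auto
  then have "sorted_list_of_set (x ` ?S) = map real [0..<length ys]"
    by (simp only:) (rule sorted_list_of_set.idem_if_sorted_distinct; simp add: sorted_map distinct_map inj_on_def)
  moreover have "{e \<in> ?S. x e = real i} = ys ! i" if "i < length ys" for i
  proof (intro equalityI subsetI)
    fix e assume "e \<in> {e \<in> ?S. x e = real i}"
    then have e: "e \<in> ?S" "x e = real i" by auto
    then obtain j where "j < length ys" "e \<in> ys ! j" using mem by blast
    then show "e \<in> ys ! i" using x[of j e] e(2) by simp
  next
    fix e assume "e \<in> ys ! i"
    then show "e \<in> {e \<in> ?S. x e = real i}" using x[OF that] mem[of e] that by blast
  qed
  ultimately have "levels x ?S = map (nth ys) [0..<length ys]"
    unfolding levels_def by simp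
  then show ?thesis by (simp add: map_nth)
qed

lemma pair_in_sorted:
  "sorted_wrt (\<lambda>A B. \<forall>a\<in>A. \<forall>b\<in>B. R a b) xs \<Longrightarrow> pair_in xs b c \<Longrightarrow> R b c"
  by (induction xs) auto

lemma triple_in_sorted:
  assumes "sorted_wrt (\<lambda>A B. \<forall>a\<in>A. \<forall>b\<in>B. R a b) xs" "triple_in xs a b c"
  shows "R a b \<and> R b c"
proof -
  have "pair_in ys b c \<Longrightarrow> b \<in> \<Union>(set ys)" for ys :: "'a set list" by (induction ys) auto
  then show ?thesis using assms
  proof (induction xs)
    case (Cons X xs)
    then show ?case using pair_in_sorted[of R xs b c] by auto
  qed simp
qed

lemma sorted_wrt_irrefl_distinct:
  "sorted_wrt R xs \<Longrightarrow> (\<And>A. A \<in> set xs \<Longrightarrow> \<not> R A A) \<Longrightarrow> distinct xs"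
  by (induction xs) auto

lemma sorted_wrt_cases:
  "sorted_wrt R xs \<Longrightarrow> A \<in> set xs \<Longrightarrow> B \<in> set xs \<Longrightarrow> A = B \<or> R A B \<or> R B A"
  by (induction xs) auto

section \<open>Refinements from real functions\<close>

context ordered_blocks
begin

definition idx :: "nat \<Rightarrow> nat" where
  "idx e = (SOME i. i < k \<and> e \<in> xs ! i)"

lemma idx: "i < k \<Longrightarrow> e \<in> xs ! i \<Longrightarrow> idx e = i"
  unfolding idx_def by (rule some_equality) (use disj in blast)+

lemma idx_in: "e \<in> {1..n} \<Longrightarrow> idx e < k \<and> e \<in> xs ! idx e"
  unfolding union[symmetric] using idx by auto

lemma block_props:
  assumes "S \<in> set xs"
  shows "finite S" "S \<noteq> {}" "S \<subseteq> {1..n}"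
proof -
  obtain i where i: "i < k" "S = xs ! i" using assms by (auto simp: in_set_conv_nth)
  show "S \<noteq> {}" using i nonempty by simp
  show "S \<subseteq> {1..n}" using i union by blast
  then show "finite S" by (rule finite_subset) simp
qed

end

lemma finite_cyclic_partitions: "finite (cyclic_partitions n)"
proof -
  have "finite {ys. set ys \<subseteq> Pow {1..n} \<and> length ys \<le> n}" by (rule finite_lists_length_le) simp
  moreover have "cyclic_partitions n \<subseteq> cyclic_class ` {ys. set ys \<subseteq> Pow {1..n} \<and> length ys \<le> n}"
  proof
    fix C assume "C \<in> cyclic_partitions n"
    then obtain ys where ys: "C = cyclic_class ys" "ordered_partition n ys" by (auto simp: cyclic_partitions_def)
    interpret Y: ordered_blocks n ys by (rule ordered_blocks.intro[OF ys(2)])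
    show "C \<in> cyclic_class ` {ys. set ys \<subseteq> Pow {1..n} \<and> length ys \<le> n}"
      using Y.block_props(3) Y.length_le ys(1) by blast
  qed
  ultimately show ?thesis by (meson finite_imageI finite_subset)
qed

context ordered_blocks
begin

definition prec :: "(nat \<Rightarrow> real) \<Rightarrow> nat \<Rightarrow> nat \<Rightarrow> bool" where
  "prec x a b \<longleftrightarrow> idx a < idx b \<or> idx a = idx b \<and> x a < x b"

definition refined_list :: "(nat \<Rightarrow> real) \<Rightarrow> nat set list" where
  "refined_list x = concat (map (levels x) xs)"

definition refined :: "(nat \<Rightarrow> real) \<Rightarrow> nat set list set" where
  "refined x = cyclic_class (refined_list x)"

lemma set_refined_list: "set (refined_list x) = (\<Union>S\<in>set xs. (\<lambda>v. {e \<in> S. x e = v}) ` x ` S)"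
proof -
  have "set (refined_list x) = (\<Union>S\<in>set xs. set (levels x S))" by (simp add: refined_list_def)
  also have "\<dots> = (\<Union>S\<in>set xs. (\<lambda>v. {e \<in> S. x e = v}) ` x ` S)"
    by (rule SUP_cong[OF refl set_levels[OF block_props(1)]])
  finally show ?thesis .
qed

lemma refined_listD:
  assumes "A \<in> set (refined_list x)" "a \<in> A" "b \<in> A"
  shows "idx a = idx b \<and> x a = x b"
  using assms unfolding set_refined_list by (auto simp: in_set_conv_nth idx)

lemma Union_refined_list: "\<Union>(set (refined_list x)) = {1..n}"
proof -
  have "\<Union>(set (refined_list x)) = (\<Union>S\<in>set xs. S)" unfolding set_refined_list by auto
  also have "set xs = nth xs ` {..<k}" by (auto simp: set_conv_nth)
  finally show ?thesis using union by simp
qed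

lemma sorted_refined_list:
  "sorted_wrt (\<lambda>A B. \<forall>a\<in>A. \<forall>b\<in>B. prec x a b) (refined_list x)"
  unfolding refined_list_def
proof (rule sorted_wrt_concat)
  fix l assume "l \<in> set (map (levels x) xs)"
  then obtain i where i: "i < k" "l = levels x (xs ! i)" by (auto simp: in_set_conv_nth)
  have fin: "finite (xs ! i)" using block_props(1) i nth_mem by blast
  have "idx a = i" if "a \<in> A" "A \<in> set l" for a A
    using that i idx[OF i(1)] fin by (auto simp: set_levels)
  then have "\<forall>a\<in>A. \<forall>b\<in>B. prec x a b"
    if "A \<in> set l" "B \<in> set l" "\<forall>a\<in>A. \<forall>b\<in>B. x a < x b" for A B
    using that by (simp add: prec_def)
  then show "sorted_wrt (\<lambda>A B. \<forall>a\<in>A. \<forall>b\<in>B. prec x a b) l"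
    using sorted_wrt_levels[OF fin, of x] unfolding i(2) by (rule sorted_wrt_mono_rel)
next
  have "prec x a b" if "i < j" "j < k" "A \<in> set (levels x (xs ! i))" "B \<in> set (levels x (xs ! j))" "a \<in> A" "b \<in> B"
    for i j A B a b
  proof -
    have "a \<in> xs ! i" "b \<in> xs ! j"
      using that block_props(1)[of "xs ! i"] block_props(1)[of "xs ! j"] by (auto simp: set_levels)
    then show ?thesis using that idx[of i a] idx[of j b] by (simp add: prec_def)
  qed
  then show "sorted_wrt (\<lambda>l l'. \<forall>A\<in>set l. \<forall>B\<in>set l'. \<forall>a\<in>A. \<forall>b\<in>B. prec x a b) (map (levels x) xs)"
    by (simp add: sorted_wrt_iff_nth_less)
qed

lemma ordered_partition_refined: "ordered_partition n (refined_list x)"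
proof -
  let ?W = "refined_list x"
  have ne: "{} \<notin> set ?W" by (auto simp: set_refined_list)
  have irr: "\<not> prec x a a" for a by (simp add: prec_def)
  have "distinct ?W"
    by (rule sorted_wrt_irrefl_distinct[OF sorted_refined_list]) (use irr ne in \<open>metis ex_in_conv\<close>)
  moreover have "disjoint (set ?W)"
    unfolding disjoint_def using sorted_wrt_cases[OF sorted_refined_list] irr by blast
  ultimately show ?thesis
    using ne Union_refined_list by (simp add: ordered_partition_def partition_on_def)
qed

lemma refined_cyclic_partition: "refined x \<in> cyclic_partitions n"
  using ordered_partition_refined unfolding refined_def cyclic_partitions_def by blast

lemma finer_refined: "finer (refined x) (cyclic_class xs)"
proof -
  have "map (\<lambda>ys. \<Union>(set ys)) (map (levels x) xs) = xs"
    unfolding map_map comp_def by (rule map_idI) (rule Union_levels[OF block_props(1)])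
  moreover have "ys \<noteq> []" if "ys \<in> set (map (levels x) xs)" for ys
    using that levels_nonempty[OF block_props(1,2)] by auto
  ultimately show ?thesis
    using finer_concat[of "map (levels x) xs" "[]"] by (simp add: refined_def refined_list_def)
qed

lemma refined_zero: "refined (\<lambda>_. 0) = cyclic_class xs"
proof -
  have "levels (\<lambda>_. 0) S = [S]" if "S \<in> set xs" for S
    using block_props[OF that] by (simp add: levels_def image_constant_conv)
  then have "refined_list (\<lambda>_. 0) = concat (map (\<lambda>S. [S]) xs)"
    unfolding refined_list_def by (intro arg_cong[where f = concat] map_cong) auto
  then show ?thesis by (simp add: refined_def)
qed

text \<open>Two elements alone have no order on a cycle, but an element \<open>c\<close> of another
  block serves as base point: the orientation of \<open>e\<close>, \<open>e'\<close>,
  \<open>c\<close> tells which of the two comes first inside their block. Conversely,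
  \<open>levels_levels\<close> groups the finer list into the blocks of the coarser one.\<close>

lemma finer_refined_iff:
  assumes k2: "2 \<le> k"
  shows "finer (refined x) (refined y) \<longleftrightarrow>
    (\<forall>e\<in>{1..n}. \<forall>e'\<in>{1..n}. idx e = idx e' \<longrightarrow> y e < y e' \<longrightarrow> x e < x e')"
proof
  assume fin: "finer (refined x) (refined y)"
  show "\<forall>e\<in>{1..n}. \<forall>e'\<in>{1..n}. idx e = idx e' \<longrightarrow> y e < y e' \<longrightarrow> x e < x e'"
  proof (intro ballI impI)
    fix e e' assume e: "e \<in> {1..n}" "e' \<in> {1..n}" "idx e = idx e'" "y e < y e'"
    \<comment> \<open>The index of a block other than that of \<open>e\<close>; this is where
      \<open>2 \<le> k\<close> enters.\<close>
    define s' where "s' = (if idx e = 0 then 1 else 0 :: nat)"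
    have s': "s' < k" "s' \<noteq> idx e" using k2 by (auto simp: s'_def)
    obtain c where "c \<in> xs ! s'" using nonempty[OF s'(1)] by blast
    then have c: "c \<in> {1..n}" "idx c \<noteq> idx e" "idx c \<noteq> idx e'"
      using s' idx[OF s'(1)] e(3) union by auto
    have tri: "prec z a b \<and> prec z b d" if "triple_in (refined_list z) a b d" for z a b d
      by (rule triple_in_sorted[OF sorted_refined_list that])
    have "cyclic_triple (refined_list y) e e' c \<or> cyclic_triple (refined_list y) e' e c"
    proof (rule triple_in_total; (unfold Union_refined_list)?)
      show "\<not> (e \<in> X \<and> e' \<in> X)" if "X \<in> set (refined_list y)" for X
        using refined_listD[OF that, of e e'] e(4) by auto
      show "\<not> (e' \<in> X \<and> c \<in> X)" if "X \<in> set (refined_list y)" for X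
        using refined_listD[OF that, of e' c] c by auto
      show "\<not> (e \<in> X \<and> c \<in> X)" if "X \<in> set (refined_list y)" for X
        using refined_listD[OF that, of e c] c by auto
    qed (rule e c)+
    moreover have "\<not> cyclic_triple (refined_list y) e' e c"
      using tri[of y] e c unfolding cyclic_triple_def prec_def by fastforce
    ultimately have "cyclic_triple (refined_list x) e e' c"
      using finer_cyclic_triple fin unfolding refined_def by blast
    then show "x e < x e'"
      using tri[of x] e c unfolding cyclic_triple_def prec_def by fastforce
  qed
next
  assume mono: "\<forall>e\<in>{1..n}. \<forall>e'\<in>{1..n}. idx e = idx e' \<longrightarrow> y e < y e' \<longrightarrow> x e < x e'"
  define yss where "yss = concat (map (\<lambda>S. map (levels x) (levels y S)) xs)"
  have lev: "A \<subseteq> S \<and> A \<noteq> {} \<and> finite A" if "S \<in> set xs" "A \<in> set (levels y S)" for S A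
    using that block_props[OF that(1)] by (auto simp: set_levels)
  have "map (\<lambda>ys. \<Union>(set ys)) yss = concat (map (\<lambda>S. map (\<lambda>A. \<Union>(set (levels x A))) (levels y S)) xs)"
    unfolding yss_def by (simp add: map_concat comp_def)
  also have "\<dots> = refined_list y"
    unfolding refined_list_def
  proof (rule arg_cong[where f = concat], rule map_cong[OF refl])
    fix S assume S: "S \<in> set xs"
    show "map (\<lambda>A. \<Union>(set (levels x A))) (levels y S) = levels y S"
      by (rule map_idI, rule Union_levels) (use lev[OF S] in blast)
  qed
  finally have y: "map (\<lambda>ys. \<Union>(set ys)) yss = refined_list y" .
  have "concat yss = concat (map (\<lambda>S. concat (map (levels x) (levels y S))) xs)"
    unfolding yss_def by (induction xs) auto
  also have "\<dots> = refined_list x"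
    unfolding refined_list_def
  proof (rule arg_cong[where f = concat], rule map_cong[OF refl])
    fix S assume S: "S \<in> set xs"
    then obtain i where i: "i < k" "S = xs ! i" by (auto simp: in_set_conv_nth)
    show "concat (map (levels x) (levels y S)) = levels x S"
    proof (rule levels_levels[OF block_props(1)[OF S]])
      fix e e' assume e: "e \<in> S" "e' \<in> S" "y e < y e'"
      then have "idx e = idx e'" "e \<in> {1..n}" "e' \<in> {1..n}"
        using idx i block_props(3)[OF S] by auto
      then show "x e < x e'" using mono e by blast
    qed
  qed
  finally have x: "concat yss = refined_list x" .
  have "ys \<noteq> []" if ys: "ys \<in> set yss" for ys
  proof -
    obtain S A where "S \<in> set xs" "A \<in> set (levels y S)" "ys = levels x A"
      using ys unfolding yss_def by auto
    then show ?thesis using levels_nonempty[of A x] lev[of S A] by simp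
  qed
  then show "finer (refined x) (refined y)"
    using finer_concat[of yss "[]"] x y by (simp add: refined_def)
qed

text \<open>\<open>finer_concatD\<close> splits the blocks of some rotation of \<open>xs\<close>;
  rotating the list of lists aligns it with \<open>xs\<close>, and \<open>x\<close> is then the
  position of an element's piece within its block.\<close>

lemma refined_surj:
  assumes C: "C \<in> cyclic_partitions n" and fin: "finer C (cyclic_class xs)"
  shows "\<exists>x. C = refined x"
proof -
  let ?U = "\<lambda>ys. \<Union>(set ys) :: nat set"
  obtain yss where yss: "C = cyclic_class (concat yss)" "cyclic_class xs = cyclic_class (map ?U yss)"
    using finer_concatD[OF fin] by blast
  obtain i where i: "xs = rotate i (map ?U yss)" using yss(2) cyclic_class_eq_iff by blast
  define zss where "zss = rotate i yss"
  have xs: "map ?U zss = xs" unfolding zss_def i by (simp add: rotate_map)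
  let ?m = "i mod length yss"
  have "concat zss = concat (drop ?m yss) @ concat (take ?m yss)"
    unfolding zss_def by (simp add: rotate_drop_take)
  also have "cyclic_class \<dots> = cyclic_class (concat (take ?m yss) @ concat (drop ?m yss))"
    by (rule cyclic_class_append)
  also have "concat (take ?m yss) @ concat (drop ?m yss) = concat yss"
    by (metis append_take_drop_id concat_append)
  finally have C': "C = cyclic_class (concat zss)" using yss(1) by simp
  obtain ws where ws: "C = cyclic_class ws" "ordered_partition n ws"
    using C by (auto simp: cyclic_partitions_def)
  obtain j where "concat zss = rotate j ws" using C' ws(1) cyclic_class_eq_iff by metis
  then have "ordered_partition n (concat zss)" using ws(2) by (simp add: ordered_partition_def)
  then interpret W: ordered_blocks n "concat zss" by (rule ordered_blocks.intro)
  define x where "x e = real (SOME i. \<exists>ys\<in>set zss. i < length ys \<and> e \<in> ys ! i)" for e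
  have uniq: "i = i'" if ys: "ys \<in> set zss" "i < length ys" "e \<in> ys ! i"
    and ys': "ys' \<in> set zss" "i' < length ys'" "e \<in> ys' ! i'" for ys ys' i i' e
  proof -
    obtain a where a: "a < length zss" "ys = zss ! a" using ys(1) by (auto simp: in_set_conv_nth)
    obtain b where b: "b < length zss" "ys' = zss ! b" using ys'(1) by (auto simp: in_set_conv_nth)
    have len: "length zss = k" using xs by (metis length_map)
    have "e \<in> ?U ys" "e \<in> ?U ys'" using ys ys' nth_mem by blast+
    then have "e \<in> xs ! a" "e \<in> xs ! b" using a b xs by (metis nth_map)+
    then have "a = b" using idx a b len by metis
    then have eq: "ys' = ys" using a b by simp
    have "ys ! i \<in> set ys" "ys ! i' \<in> set ys" using ys ys' eq by auto
    then have mem: "ys ! i \<in> set (concat zss)" "ys ! i' \<in> set (concat zss)" using ys(1) by auto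
    moreover have "disjoint (set (concat zss))"
      using W.op by (simp add: ordered_partition_def partition_on_def)
    moreover have "ys ! i \<inter> ys ! i' \<noteq> {}" using ys(3) ys'(3) eq by blast
    ultimately have "ys ! i = ys ! i'" unfolding disjoint_def by blast
    moreover have "distinct ys"
      using W.op ys(1) by (auto simp: ordered_partition_def distinct_concat_iff)
    ultimately show ?thesis using ys ys' eq by (simp add: nth_eq_iff_index_eq)
  qed
  have xeq: "x e = real i" if "ys \<in> set zss" "i < length ys" "e \<in> ys ! i" for ys i e
  proof -
    have "(SOME i. \<exists>ys\<in>set zss. i < length ys \<and> e \<in> ys ! i) = i"
      by (rule some_equality) (use that uniq in blast)+
    then show ?thesis by (simp add: x_def)
  qed
  have "levels x (?U ys) = ys" if ys: "ys \<in> set zss" for ys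
  proof (rule levels_of_list)
    have "?U ys \<in> set xs" using ys xs by (metis image_eqI set_map)
    then show "finite (?U ys)" by (rule block_props)
    show "x e = real i" if "i < length ys" "e \<in> ys ! i" for i e by (rule xeq[OF ys that])
    show "A \<noteq> {}" if "A \<in> set ys" for A
      using W.block_props(2)[of A] that ys by auto
  qed
  then have "map (levels x) (map ?U zss) = zss" by (simp add: map_idI comp_def)
  then have "refined_list x = concat zss" unfolding refined_list_def xs by simp
  then show ?thesis using C' by (intro exI[of _ x]) (simp add: refined_def)
qed

text \<open>Adding a constant on a block leaves its level sets unchanged. Normalising functions to 0
  at one base point of each block removes this ambiguity.\<close>

definition base_points :: "nat set" where
  "base_points = Min ` set xs"

definition base :: "nat \<Rightarrow> nat" where
  "base e = Min (xs ! idx e)"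

lemma base: 
  assumes "e \<in> {1..n}"
  shows "base e \<in> {1..n}" "idx (base e) = idx e" "base e \<in> base_points"
proof -
  have i: "idx e < k" using idx_in[OF assms] by simp
  then have S: "xs ! idx e \<in> set xs" by simp
  then have m: "base e \<in> xs ! idx e" unfolding base_def using block_props[OF S] by (intro Min_in) auto
  then show "base e \<in> {1..n}" using block_props(3)[OF S] by blast
  show "idx (base e) = idx e" by (rule idx[OF i m])
  show "base e \<in> base_points" unfolding base_points_def base_def using S by (rule imageI)
qed

lemma base_points_base: "e \<in> base_points \<Longrightarrow> base e = e"
proof -
  assume "e \<in> base_points"
  then obtain i where i: "i < k" "e = Min (xs ! i)" by (auto simp: base_points_def in_set_conv_nth)
  then have "e \<in> xs ! i" using block_props[of "xs ! i"] by (metis Min_in nth_mem)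
  then show ?thesis using idx[OF i(1)] i(2) by (simp add: base_def)
qed

lemma card_base_points: "base_points \<subseteq> {1..n}" "card base_points = k"
proof -
  have Min: "Min S \<in> S" if "S \<in> set xs" for S using block_props[OF that] by (intro Min_in) auto
  show "base_points \<subseteq> {1..n}" unfolding base_points_def using Min block_props(3) by blast
  have "inj_on Min (set xs)"
  proof
    fix S T assume ST: "S \<in> set xs" "T \<in> set xs" "Min S = Min T"
    then have "Min S \<in> S \<inter> T" using Min[OF ST(1)] Min[OF ST(2)] by simp
    moreover have "disjoint (set xs)" using op by (simp add: ordered_partition_def partition_on_def)
    ultimately show "S = T" using ST unfolding disjoint_def by blast
  qed
  then show "card base_points = k" using card_image card_blocks by (metis base_points_def)
qed

text \<open>The product of the braid arrangements of the blocks: the forms are differences of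
  coordinates inside one block. The order is reversed because a finer partition has the larger
  cone.\<close>

theorem lower_fan:
  assumes k2: "2 \<le> k"
  obtains S b where "S \<subseteq> {1..n}" "card S = n - k"
    "complete_fan (vec S) (order_complex {C \<in> cyclic_partitions n. finer C (cyclic_class xs) \<and> C \<noteq> cyclic_class xs}
      (\<lambda>p q. finer q p)) b"
proof -
  let ?\<sigma> = "cyclic_class xs"
  let ?P = "{C \<in> cyclic_partitions n. finer C ?\<sigma> \<and> C \<noteq> ?\<sigma>}"
  define S where "S = {1..n} - base_points"
  define \<Lambda> :: "((nat \<Rightarrow> real) \<Rightarrow> real) set" where
    "\<Lambda> = {\<lambda>x. x e - x e' | e e'. e \<in> {1..n} \<and> e' \<in> {1..n} \<and> idx e = idx e'}"
  define b where "b C = (SOME x. x \<in> vec S \<and> x \<noteq> 0 \<and> refined x = C)" for C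
  have vbase: "x (base e) = 0" if "x \<in> vec S" "e \<in> {1..n}" for x e
    using that base[OF that(2)] by (auto simp: vec_def S_def)
  have \<sigma>: "refined x \<noteq> ?\<sigma>" if x: "x \<in> vec S" "x \<noteq> 0" for x
  proof
    assume "refined x = ?\<sigma>"
    then have "refined x = refined (\<lambda>_. 0)" by (simp add: refined_zero)
    then have "finer (refined (\<lambda>_. 0)) (refined x)" by (simp add: finer_refl)
    then have c: "\<not> x e < x e'" if "e \<in> {1..n}" "e' \<in> {1..n}" "idx e = idx e'" for e e'
      using that unfolding finer_refined_iff[OF k2] by blast
    have "x e = 0" for e
    proof (cases "e \<in> {1..n}")
      case True
      then show ?thesis using c[OF True base(1)[OF True]] c[OF base(1)[OF True] True] base(2)[OF True] vbase[OF x(1) True]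
        by simp
    next
      case False
      then show ?thesis using x(1) by (auto simp: vec_def S_def)
    qed
    then show False using x(2) by (auto simp: fun_eq_iff)
  qed
  have ex: "\<exists>x. x \<in> vec S \<and> x \<noteq> 0 \<and> refined x = C" if C: "C \<in> ?P" for C
  proof -
    obtain z where z: "C = refined z" using refined_surj C by blast
    \<comment> \<open>Subtracting the value at the base point moves \<open>z\<close> into
      \<open>vec S\<close> without changing any comparison within a block.\<close>
    define x where "x e = (if e \<in> {1..n} then z e - z (base e) else 0)" for e
    have bb: "base e = base e'" if "idx e = idx e'" for e e' using that by (simp add: base_def)
    have iff: "x e < x e' \<longleftrightarrow> z e < z e'" if "e \<in> {1..n}" "e' \<in> {1..n}" "idx e = idx e'" for e e'
      using that bb[OF that(3)] by (simp add: x_def)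
    have "refined x = refined z"
      by (rule finer_antisym) (use iff in \<open>simp_all add: finer_refined_iff[OF k2] del: atLeastAtMost_iff\<close>)
    moreover have "x \<in> vec S"
      using base_points_base by (auto simp: vec_def S_def x_def)
    moreover have "x \<noteq> 0"
    proof
      assume "x = 0"
      then have "x = (\<lambda>_. 0)" by (auto simp: fun_eq_iff)
      then show False using C z calculation(1) refined_zero by simp
    qed
    ultimately show ?thesis using z by blast
  qed
  have b: "b C \<in> vec S \<and> b C \<noteq> 0 \<and> refined (b C) = C" if "C \<in> ?P" for C
    unfolding b_def using someI_ex[OF ex[OF that]] .
  have finP: "finite ?P" using finite_cyclic_partitions by simp
  have "complete_fan (vec S) (order_complex ?P (\<lambda>p q. finer q p)) b"
  proof (rule sign_fan[where \<Lambda> = \<Lambda> and car = refined])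
    show "subspace (vec S)" by (rule subspace_vec)
    show "linear f" if "f \<in> \<Lambda>" for f
      using that unfolding \<Lambda>_def by (auto intro!: linearI simp: algebra_simps)
    show "finite \<Lambda>"
    proof (rule finite_subset)
      show "\<Lambda> \<subseteq> (\<lambda>(e, e') x. x e - x e') ` ({1..n} \<times> {1..n})" unfolding \<Lambda>_def by auto
    qed simp
    show "(\<lambda>x. - f x) \<in> \<Lambda>" if f: "f \<in> \<Lambda>" for f
    proof -
      obtain e e' where e: "f = (\<lambda>x. x e - x e')" "e \<in> {1..n}" "e' \<in> {1..n}" "idx e = idx e'"
        using f unfolding \<Lambda>_def by blast
      have "(\<lambda>x. - f x) = (\<lambda>x. x e' - x e)" unfolding e(1) by simp
      then show ?thesis using e unfolding \<Lambda>_def by (intro CollectI exI[of _ e'] exI[of _ e]) simp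
    qed
    show "\<exists>f\<in>\<Lambda>. f x < 0" if x: "x \<in> vec S" "x \<noteq> 0" for x
    proof -
      obtain e where e: "x e \<noteq> 0" using x(2) by (auto simp: fun_eq_iff)
      then have en: "e \<in> {1..n}" using x(1) by (auto simp: vec_def S_def)
      have "(\<lambda>x. x e - x (base e)) \<in> \<Lambda>" "(\<lambda>x. x (base e) - x e) \<in> \<Lambda>"
        unfolding \<Lambda>_def
        by (intro CollectI exI[of _ e] exI[of _ "base e"], use en base[OF en] in simp)
          (intro CollectI exI[of _ "base e"] exI[of _ e], use en base[OF en] in simp)
      moreover have "x e - x (base e) < 0 \<or> x (base e) - x e < 0" using e vbase[OF x(1) en] by auto
      ultimately show ?thesis by (elim disjE) (rule bexI, assumption+)+
    qed
    show "finite ?P" by (rule finP)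
    show "refined x \<in> ?P" if "x \<in> vec S" "x \<noteq> 0" for x
      using \<sigma>[OF that] refined_cyclic_partition finer_refined by blast
    show "b C \<in> vec S \<and> b C \<noteq> 0 \<and> refined (b C) = C" if "C \<in> ?P" for C using b[OF that] .
    show "finer (refined y) (refined x) \<longleftrightarrow> (\<forall>f\<in>\<Lambda>. 0 \<le> f y \<longrightarrow> 0 \<le> f x)" for x y
    proof -
      have "(\<forall>f\<in>\<Lambda>. R f) \<longleftrightarrow>
        (\<forall>e\<in>{1..n}. \<forall>e'\<in>{1..n}. idx e = idx e' \<longrightarrow> R (\<lambda>x. x e - x e'))" for R
        unfolding \<Lambda>_def by blast
      moreover have "(0 \<le> y e - y e' \<longrightarrow> 0 \<le> x e - x e') \<longleftrightarrow> (x e < x e' \<longrightarrow> y e < y e')" for e e'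
        by auto
      ultimately show ?thesis unfolding finer_refined_iff[OF k2] by simp
    qed
    show "p = q" if "finer q p" "finer p q" for p q using finer_antisym that by blast
  qed
  moreover have "card S = n - k"
    unfolding S_def using card_base_points finite_subset[OF card_base_points(1)] by (subst card_Diff_subset) auto
  ultimately show ?thesis using that[of S] by (auto simp: S_def)
qed

end

section \<open>Links of cells\<close>

lemma cell_short_blocks:
  assumes "quasilinkage n Q" "\<sigma> \<in> cells (family_complex n Q)"
  obtains xs where "\<sigma> = cyclic_class xs" "short_blocks n xs Q"
proof -
  obtain xs where "\<sigma> = cyclic_class xs" "ordered_partition n xs" "set xs \<subseteq> Q"
    using assms(2) by (auto simp: family_complex_def cyclic_partitions_def)
  then show ?thesis
    using that assms(1) by (simp add: short_blocks_def ordered_blocks_def short_blocks_axioms_def)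
qed

context short_blocks
begin

abbreviation "X \<equiv> family_complex n Q"
abbreviation "\<sigma> \<equiv> cyclic_class xs"

definition lower_cells :: "nat set list set set" where
  "lower_cells = {C \<in> cyclic_partitions n. finer C \<sigma> \<and> C \<noteq> \<sigma>}"

definition upper_cells :: "nat set list set set" where
  "upper_cells = merged xs ` {J. admissible J \<and> J \<noteq> {..<k}}"

lemma upper_cells_eq: "upper_cells = {C \<in> cells X. finer \<sigma> C \<and> C \<noteq> \<sigma>}"
proof -
  have "merged xs J = \<sigma> \<longleftrightarrow> J = {..<k}" if J: "admissible J" for J
    using finer_admissible[OF J admissible_full] finer_admissible[OF J J] J
    by (auto simp: merged_full admissible_def)
  then have "upper_cells = merged xs ` {J. admissible J} - {\<sigma>}" by (auto simp: upper_cells_def)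
  then show ?thesis unfolding star_admissible[symmetric] by (auto simp: star_def family_complex_def)
qed

text \<open>The blocks of a refinement are subsets of blocks of \<open>xs\<close>, hence
  short.\<close>

lemma lower_cells_eq: "lower_cells = {C \<in> cells X. finer C \<sigma> \<and> C \<noteq> \<sigma>}"
proof -
  have "blocks C \<subseteq> Q" if C: "C \<in> cyclic_partitions n" "finer C \<sigma>" for C
  proof -
    obtain x where x: "C = refined x" using refined_surj[OF C] by blast
    have down: "\<forall>A\<in>Q. \<forall>B. B \<subseteq> A \<longrightarrow> B \<in> Q" using quasi by (simp add: quasilinkage_def)
    show ?thesis
    proof
      fix B assume "B \<in> blocks C"
      then obtain S where "S \<in> set xs" "B \<subseteq> S"
        unfolding x refined_def blocks_cyclic_class set_refined_list by blast
      then show "B \<in> Q" using down short by blast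
    qed
  qed
  then show ?thesis by (auto simp: lower_cells_def family_complex_def)
qed

text \<open>A cell comparable with \<open>\<sigma>\<close> lies below or above it, and cells on
  different sides are comparable by transitivity, so the link is a join.\<close>

lemma link_eq:
  "link (barycentric_subdivision X) \<sigma> =
    {s1 \<union> s2 | s1 s2. s1 \<in> order_complex lower_cells (\<lambda>p q. finer q p) \<and> s2 \<in> order_complex upper_cells finer}"
  (is "?L = ?R")
proof (intro equalityI subsetI)
  fix s assume s: "s \<in> ?L"
  let ?s1 = "s \<inter> lower_cells" and ?s2 = "s - lower_cells"
  have s': "finite s" "s \<subseteq> cells X" "\<sigma> \<notin> s" "\<forall>C\<in>insert \<sigma> s. \<forall>D\<in>insert \<sigma> s. finer C D \<or> finer D C"
    using s by (auto simp: link_def barycentric_subdivision_def family_complex_def)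
  have "?s1 \<in> order_complex lower_cells (\<lambda>p q. finer q p)"
    using s' by (auto simp: order_complex_def)
  moreover have "?s2 \<subseteq> upper_cells"
    using s' unfolding upper_cells_eq lower_cells_eq by blast
  then have "?s2 \<in> order_complex upper_cells finer"
    using s' by (auto simp: order_complex_def)
  moreover have "s = ?s1 \<union> ?s2" by blast
  ultimately show "s \<in> ?R" by blast
next
  fix s assume "s \<in> ?R"
  then obtain s1 s2 where s: "s = s1 \<union> s2" "s1 \<in> order_complex lower_cells (\<lambda>p q. finer q p)"
    "s2 \<in> order_complex upper_cells finer" by blast
  have 1: "finite s1" "s1 \<subseteq> lower_cells" "\<forall>C\<in>s1. \<forall>D\<in>s1. finer C D \<or> finer D C"
    and 2: "finite s2" "s2 \<subseteq> upper_cells" "\<forall>C\<in>s2. \<forall>D\<in>s2. finer C D \<or> finer D C"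
    using s by (auto simp: order_complex_def)
  have lo: "C \<in> cells X \<and> finer C \<sigma> \<and> C \<noteq> \<sigma>" if "C \<in> s1" for C using 1(2) that lower_cells_eq by blast
  have up: "C \<in> cells X \<and> finer \<sigma> C \<and> C \<noteq> \<sigma>" if "C \<in> s2" for C using 2(2) that upper_cells_eq by blast
  have \<sigma>: "\<sigma> \<in> cells X"
    using short op by (auto simp: family_complex_def cyclic_partitions_def)
  have chain: "finer C D \<or> finer D C" if "C \<in> insert \<sigma> s" "D \<in> insert \<sigma> s" for C D
    using that unfolding s(1) by (elim insertE UnE) (use lo up 1(3) 2(3) finer_refl finer_trans in blast)+
  have "insert \<sigma> s \<subseteq> cells X" "\<sigma> \<notin> s" "finite s" using s(1) 1(1) 2(1) lo up \<sigma> by blast+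
  moreover have "face X = finer" by (simp add: family_complex_def)
  ultimately show "s \<in> ?L" using chain unfolding link_def barycentric_subdivision_def by auto
qed

text \<open>The dimensions \<open>n - k\<close> and \<open>k - 3\<close> of the two factors add up
  to \<open>n - 3\<close> for every cell.\<close>

lemma link_sphere: "PL_homeomorphic (link (barycentric_subdivision X) \<sigma>) (simplex_boundary (n - 3))"
proof -
  have k2: "2 \<le> k" using k_ge_3 by simp
  obtain S1 b1 where S1: "S1 \<subseteq> {1..n}" "card S1 = n - k"
    "complete_fan (vec S1) (order_complex lower_cells (\<lambda>p q. finer q p)) b1"
    unfolding lower_cells_def by (rule lower_fan[OF k2])
  obtain S2 b2 where S2: "S2 \<subseteq> {..<k}" "card S2 = k - 3"
    "complete_fan (vec S2) (order_complex upper_cells finer) b2"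
    unfolding upper_cells_def by (rule upper_fan[where D = "merged xs" and le = finer, OF finer_admissible])
  have disj: "lower_cells \<inter> upper_cells = {}"
    using finer_antisym unfolding lower_cells_eq upper_cells_eq by blast
  let ?D = "S1 <+> S2"
  have fin: "finite S1" "finite S2" using S1(1) S2(1) finite_subset by blast+
  have "card ?D = n - 3" using fin S1(2) S2(2) k_ge_3 length_le by (simp add: card_Plus)
  then obtain \<psi> where \<psi>: "complete_fan (vec ?D) (simplex_boundary (n - 3)) \<psi>"
    using complete_fan_simplex_boundary[of ?D] fin by auto
  have "\<Union>(order_complex lower_cells (\<lambda>p q. finer q p)) \<subseteq> lower_cells"
    "\<Union>(order_complex upper_cells finer) \<inter> lower_cells = {}"
    using disj by (auto simp: order_complex_def)
  from complete_fan_join[OF S1(3) S2(3) this]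
  obtain b where b: "complete_fan (vec ?D) (link (barycentric_subdivision X) \<sigma>) b"
    unfolding link_eq by blast
  obtain T where "finite T" "vec ?D \<subseteq> span T" using vec_spanned[of ?D] fin by auto
  then show ?thesis by (rule PL_homeomorphic_if_complete_fans[OF b \<psi> subspace_vec])
qed

end

theorem theorem25:
  fixes n :: nat and Q :: "nat set set"
  assumes "quasilinkage n Q"
  shows "(\<forall>v \<in> vertices (family_complex n Q).
            \<exists>l. length_vector n l \<and> generic n l \<and>
              (\<exists>w \<in> vertices (CWM n l). stars_isomorphic (family_complex n Q) v (CWM n l) w))
       \<and> (\<forall>\<sigma> \<in> cells (family_complex n Q).
            \<exists>m l. length_vector m l \<and> generic m l \<and>
              (\<exists>w \<in> vertices (CWM m l). stars_isomorphic (family_complex n Q) \<sigma> (CWM m l) w))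
       \<and> combinatorial_manifold (family_complex n Q)"
proof (intro conjI ballI)
  let ?X = "family_complex n Q"
  fix v assume v: "v \<in> vertices ?X"
  then obtain xs where xs: "v = cyclic_class xs" "short_blocks n xs Q"
    using cell_short_blocks[OF assms] by (auto simp: vertices_def)
  interpret short_blocks n xs Q by (rule xs(2))
  have "n - length xs = 0" using v card_blocks by (simp add: xs(1) vertices_def family_complex_def)
  \<comment> \<open>\<open>cell_dim\<close> is a truncated difference, so equality needs
    \<open>length_le\<close>.\<close>
  then have "length xs = n" using length_le by simp
  then show "\<exists>l. length_vector n l \<and> generic n l \<and> (\<exists>w \<in> vertices (CWM n l). stars_isomorphic ?X v (CWM n l) w)"
    using star_realizable xs(1) by auto
next
  let ?X = "family_complex n Q"
  fix \<sigma> assume "\<sigma> \<in> cells ?X"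
  then obtain xs where xs: "\<sigma> = cyclic_class xs" "short_blocks n xs Q"
    using cell_short_blocks[OF assms] by blast
  interpret short_blocks n xs Q by (rule xs(2))
  show "\<exists>m l. length_vector m l \<and> generic m l \<and> (\<exists>w \<in> vertices (CWM m l). stars_isomorphic ?X \<sigma> (CWM m l) w)"
    using star_realizable xs(1) by blast
next
  let ?X = "family_complex n Q"
  let ?K = "barycentric_subdivision ?X"
  have K: "?K = order_complex (cells ?X) finer"
    by (auto simp: barycentric_subdivision_def order_complex_def family_complex_def)
  have "finite (cells ?X)"
    using finite_subset[OF _ finite_cyclic_partitions[of n]] by (auto simp: family_complex_def)
  then have "finite_simplicial_complex ?K"
    unfolding K by (rule finite_simplicial_complex_order_complex)
  moreover have "PL_homeomorphic (link ?K \<sigma>) (simplex_boundary (n - 3))" if "{\<sigma>} \<in> ?K" for \<sigma>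
  proof -
    have "\<sigma> \<in> cells ?X" using that by (simp add: K order_complex_def)
    then obtain xs where xs: "\<sigma> = cyclic_class xs" "short_blocks n xs Q"
      using cell_short_blocks[OF assms] by blast
    interpret short_blocks n xs Q by (rule xs(2))
    show ?thesis using link_sphere xs(1) by simp
  qed
  ultimately show "combinatorial_manifold ?X"
    unfolding combinatorial_manifold_def combinatorial_manifold_of_dim_def by blast
qed

end
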